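(* Let $k\in\mathbb{N}_0$ and let $(X_t)_{t\in\Theta}$ be a measurable centred second-order random field with covariance kernel $\gamma_X\in C^{k,k}(\overline\Theta\times\overline\Theta)$. Let $\{(\lambda_{j,k},e_{j,k})\}_j$ denote the eigensystem of the associated kernel operator $T_{\gamma_X,k}\in N(H^k)$. Suppose $\Theta$ has the cone property and $k-d/2>s$ for some $s\in\mathbb{N}_0$. Then there is a constant $C=C(\Theta,k,d)>0$, depending only on $\Theta,k,d$, such that $\max_{|\alpha|\le s}\sup_{x\in\Theta}|e_{j,k}^{[\alpha]}(x)|\le C$ for all $j$, and with any such $C$, for all $|\alpha|\le s$ and $m\in\mathbb{N}$, $$\sup_{t\in\Theta}\ \mathbb{E}\Big|X_t^{(\alpha)}-\sum_{j\le m}\langle X,e_{j,k}\rangle_{H^k}\,e_{j,k}^{[\alpha]}(t)\Big|^2\le C^2\sum_{j>m}\lambda_{j,k}.$$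
   Context: $(\Omega,\mathcal{A},\mathbb{P})$ is a complete probability space; $d\in\mathbb{N}$ and $\Theta\subset\mathbb{R}^d$ is a bounded domain, meaning a bounded open subset. All functions are real-valued; $\alpha,\beta\in\mathbb{N}_0^d$ are multi-indices. $f^{(\alpha)}$ is the weak and $f^{[\alpha]}$ the classical derivative. $\partial^{[\alpha,\beta]}h$ is the classical mixed derivative of a kernel $h$ on $\Theta\times\Theta$, of order $\alpha$ in the first variable and $\beta$ in the second. $C^{k,k}(\overline\Theta\times\overline\Theta)$ is the class of uniformly continuous kernels $h\colon\Theta\times\Theta\to\mathbb{R}$ whose mixed partial derivatives $\partial^{[\alpha,\beta]}h$ exist and are uniformly continuous on $\Theta\times\Theta$ for $|\alpha|,|\beta|\le k$. $H^k(\Theta)$ is the $L^2$-based Sobolev space with inner product $\langle f,g\rangle_{H^k}=\sum_{|\alpha|\le k}\langle f^{(\alpha)},g^{(\alpha)}\rangle_{L^2}$. $N(H^k)$ denotes the nuclear operators on $H^k(\Theta)$. The kernel operator of order $k$ associated with $h$ is $T_{h,k}\colon H^k(\Theta)\to H^k(\Theta)$, $$[T_{h,k}f](y)=\int_\Theta\sum_{|\alpha|\le k}\partial^{[\alpha,0]}h(x,y)\,f^{(\alpha)}(x)\,dx .$$ For positive definite $h$ its eigensystem consists of the non-zero eigenvalues $\lambda_{j,k}$, counted with multiplicity and in descending order, with corresponding $H^k$-orthonormal eigenfunctions $e_{j,k}$, which have (and are identified with) representatives in $C^k(\Theta)$ with uniformly continuous derivatives of order $\le k$. The index $j$ runs over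 $\mathbb{N}$, or over $\{1,\dots,N\}$ if $N=\mathrm{rank}(T_{h,k})<\infty$. Cone property: given $x,z\in\mathbb{R}^d$ and open balls $\mathbb{B}_\epsilon(x),\mathbb{B}_\tau(z)$ with $x\notin\mathbb{B}_\tau(z)$, the set $\mathbb{B}_\epsilon(x)\cap\{x+\lambda(y-x)\mid y\in\mathbb{B}_\tau(z),\lambda>0\}$ is a finite cone with vertex $x$. $\Theta$ has the cone property if there is a finite cone $C_0$ such that every $x\in\Theta$ is the vertex of a finite cone contained in $\Theta$ and congruent to $C_0$ (obtained by rigid motion). A random field $(X_t)_{t\in\Theta}$ is measurable if $(t,\omega)\mapsto X_t(\omega)$ is $\mathcal{B}(\Theta)\otimes\mathcal{A}$-measurable, second-order if $\mathrm{Var}(X_t)<\infty$ for all $t$, and centred if $\mathbb{E}[X_t]=0$ for all $t$; $\gamma_X(s,t)=\mathrm{Cov}(X_s,X_t)$. Under the assumptions almost all sample paths lie in $H^k(\Theta)$, and $X=(X_t)_{t\in\Theta}$ is regarded as an $H^k(\Theta)$-valued random element (redefined as $0$ on the exceptional null set). $(X_t^{(\alpha)})_{t\in\Theta}$, $|\alpha|\le k$, denotes the weak derivative process: a measurable process with sample paths in $L^2(\Theta)$ a.s. such that $\int_\Theta X_t\,\varphi^{[\alpha]}(t)\,dt=(-1)^{|\alpha|}\int_\Theta X_t^{(\alpha)}\varphi(t)\,dt$ a.s. for all $\varphi\in C_c^\infty(\Theta)$, with $X^{(0)}=X$. Since this determines it only up to null sets in $t$, versions are taken with $\mathbb{E}[X_s^{(\beta)}X_t^{(\alpha)}]=\partial^{[\beta,\alpha]}\gamma_X(s,t)$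 for all $s,t\in\Theta$ and $|\alpha|,|\beta|\le k$ (mean-square derivatives). *)

theory Defs
  imports "HOL-Probability.Probability"
begin

section \<open>Multi-indices and classical derivatives\<close>

type_synonym 'd multi_index = "nat ^ 'd"

definition mi_order :: "'d::finite multi_index \<Rightarrow> nat" where
  "mi_order \<alpha> = (\<Sum>i\<in>UNIV. \<alpha> $ i)"

definition partial_deriv :: "'d::finite \<Rightarrow> (real ^ 'd \<Rightarrow> real) \<Rightarrow> real ^ 'd \<Rightarrow> real" where
  "partial_deriv i f x = deriv (\<lambda>t. f (x + t *\<^sub>R axis i 1)) 0"

(* The index type carries no order, so the order in which the partial derivatives are taken is
   an arbitrary enumeration of the coordinates.  It is irrelevant for the functions below, all of
   whose derivatives up to the order in question are continuous. *)
definition coords :: "'d::finite list" where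
  "coords = (SOME is. distinct is \<and> set is = UNIV)"

definition cderiv :: "'d::finite multi_index \<Rightarrow> (real ^ 'd \<Rightarrow> real) \<Rightarrow> real ^ 'd \<Rightarrow> real" where
  "cderiv \<alpha> f = foldr (\<lambda>i. partial_deriv i ^^ (\<alpha> $ i)) coords f"

(* deriv is total, so existence of the derivatives has to be required separately from
   their continuity. *)
definition derivs_exist_on :: "nat \<Rightarrow> (real ^ 'd::finite) set \<Rightarrow> (real ^ 'd \<Rightarrow> real) \<Rightarrow> bool" where
  "derivs_exist_on k S f \<longleftrightarrow>
     (\<forall>\<alpha> i. \<forall>x\<in>S. mi_order \<alpha> < k \<longrightarrow>
        ((\<lambda>t. cderiv \<alpha> f (x + t *\<^sub>R axis i 1)) has_real_derivative
           cderiv (\<alpha> + axis i 1) f x) (at 0))"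

definition Ck :: "nat \<Rightarrow> (real ^ 'd::finite) set \<Rightarrow> (real ^ 'd \<Rightarrow> real) set" where
  "Ck k S = {f. derivs_exist_on k S f \<and>
     (\<forall>\<alpha>. mi_order \<alpha> \<le> k \<longrightarrow> continuous_on S (cderiv \<alpha> f))}"

definition Ck_uniform :: "nat \<Rightarrow> (real ^ 'd::finite) set \<Rightarrow> (real ^ 'd \<Rightarrow> real) set" where
  "Ck_uniform k S = {f. derivs_exist_on k S f \<and>
     (\<forall>\<alpha>. mi_order \<alpha> \<le> k \<longrightarrow> uniformly_continuous_on S (cderiv \<alpha> f))}"

(* Elements of C_c^infinity(S), extended by zero to the whole space. *)
definition test_functions :: "(real ^ 'd::finite) set \<Rightarrow> (real ^ 'd \<Rightarrow> real) set" where
  "test_functions S = {\<phi>. (\<forall>k. \<phi> \<in> Ck k UNIV) \<and>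
     (\<exists>K. compact K \<and> K \<subseteq> S \<and> (\<forall>x. x \<notin> K \<longrightarrow> \<phi> x = 0))}"

section \<open>Kernels\<close>

definition mixed_deriv ::
  "'d::finite multi_index \<Rightarrow> 'd multi_index \<Rightarrow> (real ^ 'd \<Rightarrow> real ^ 'd \<Rightarrow> real)
     \<Rightarrow> real ^ 'd \<Rightarrow> real ^ 'd \<Rightarrow> real" where
  "mixed_deriv \<alpha> \<beta> h x y = cderiv \<alpha> (\<lambda>x'. cderiv \<beta> (h x') y) x"

definition Ckk :: "nat \<Rightarrow> (real ^ 'd::finite) set \<Rightarrow> (real ^ 'd \<Rightarrow> real ^ 'd \<Rightarrow> real) set" where
  "Ckk k S = {h.
     (\<forall>\<alpha> \<beta> i. \<forall>x\<in>S. \<forall>y\<in>S. mi_order \<alpha> < k \<and> mi_order \<beta> \<le> k \<longrightarrow>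
        ((\<lambda>t. mixed_deriv \<alpha> \<beta> h (x + t *\<^sub>R axis i 1) y) has_real_derivative
           mixed_deriv (\<alpha> + axis i 1) \<beta> h x y) (at 0)) \<and>
     (\<forall>\<alpha> \<beta> i. \<forall>x\<in>S. \<forall>y\<in>S. mi_order \<alpha> \<le> k \<and> mi_order \<beta> < k \<longrightarrow>
        ((\<lambda>t. mixed_deriv \<alpha> \<beta> h x (y + t *\<^sub>R axis i 1)) has_real_derivative
           mixed_deriv \<alpha> (\<beta> + axis i 1) h x y) (at 0)) \<and>
     (\<forall>\<alpha> \<beta>. mi_order \<alpha> \<le> k \<and> mi_order \<beta> \<le> k \<longrightarrow>
        uniformly_continuous_on (S \<times> S) (\<lambda>(x, y). mixed_deriv \<alpha> \<beta> h x y))}"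

definition positive_definite_on :: "'a set \<Rightarrow> ('a \<Rightarrow> 'a \<Rightarrow> real) \<Rightarrow> bool" where
  "positive_definite_on S h \<longleftrightarrow>
     (\<forall>x\<in>S. \<forall>y\<in>S. h x y = h y x) \<and>
     (\<forall>F c. finite F \<and> F \<subseteq> S \<longrightarrow> 0 \<le> (\<Sum>x\<in>F. \<Sum>y\<in>F. c x * c y * h x y))"

section \<open>Sobolev spaces\<close>

(* Elements of L^2 and H^k are represented by functions; equality of elements is equality
   almost everywhere on S. *)
definition L2 :: "(real ^ 'd::finite) set \<Rightarrow> (real ^ 'd \<Rightarrow> real) set" where
  "L2 S = {f. f \<in> borel_measurable (lebesgue_on S) \<and>
     integrable (lebesgue_on S) (\<lambda>x. (f x)\<^sup>2)}"

definition has_weak_deriv ::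
  "(real ^ 'd::finite) set \<Rightarrow> 'd multi_index \<Rightarrow> (real ^ 'd \<Rightarrow> real) \<Rightarrow> (real ^ 'd \<Rightarrow> real) \<Rightarrow> bool"
where
  "has_weak_deriv S \<alpha> f g \<longleftrightarrow>
     (\<forall>\<phi>\<in>test_functions S.
        (LINT x|lebesgue_on S. f x * cderiv \<alpha> \<phi> x) =
        (- 1) ^ mi_order \<alpha> * (LINT x|lebesgue_on S. g x * \<phi> x))"

definition Hk :: "nat \<Rightarrow> (real ^ 'd::finite) set \<Rightarrow> (real ^ 'd \<Rightarrow> real) set" where
  "Hk k S = {f \<in> L2 S. \<forall>\<alpha>. mi_order \<alpha> \<le> k \<longrightarrow> (\<exists>g\<in>L2 S. has_weak_deriv S \<alpha> f g)}"

definition wderiv ::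
  "(real ^ 'd::finite) set \<Rightarrow> 'd multi_index \<Rightarrow> (real ^ 'd \<Rightarrow> real) \<Rightarrow> real ^ 'd \<Rightarrow> real" where
  "wderiv S \<alpha> f = (SOME g. g \<in> L2 S \<and> has_weak_deriv S \<alpha> f g)"

definition Hk_inner ::
  "nat \<Rightarrow> (real ^ 'd::finite) set \<Rightarrow> (real ^ 'd \<Rightarrow> real) \<Rightarrow> (real ^ 'd \<Rightarrow> real) \<Rightarrow> real" where
  "Hk_inner k S f g =
     (\<Sum>\<alpha> | mi_order \<alpha> \<le> k. LINT x|lebesgue_on S. wderiv S \<alpha> f x * wderiv S \<alpha> g x)"

definition Hk_norm :: "nat \<Rightarrow> (real ^ 'd::finite) set \<Rightarrow> (real ^ 'd \<Rightarrow> real) \<Rightarrow> real" where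
  "Hk_norm k S f = sqrt (Hk_inner k S f f)"

(* Nuclear representation; the functionals are given by their Riesz representatives u n. *)
definition nuclear_on_Hk ::
  "nat \<Rightarrow> (real ^ 'd::finite) set \<Rightarrow> ((real ^ 'd \<Rightarrow> real) \<Rightarrow> real ^ 'd \<Rightarrow> real) \<Rightarrow> bool" where
  "nuclear_on_Hk k S T \<longleftrightarrow>
     (\<forall>f\<in>Hk k S. T f \<in> Hk k S) \<and>
     (\<exists>u v :: nat \<Rightarrow> real ^ 'd \<Rightarrow> real.
        (\<forall>n. u n \<in> Hk k S \<and> v n \<in> Hk k S) \<and>
        summable (\<lambda>n. Hk_norm k S (u n) * Hk_norm k S (v n)) \<and>
        (\<forall>f\<in>Hk k S.
           (\<lambda>N. Hk_norm k S (\<lambda>y. T f y - (\<Sum>n<N. Hk_inner k S f (u n) * v n y)))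
             \<longlonglongrightarrow> 0))"

definition kernel_op ::
  "nat \<Rightarrow> (real ^ 'd::finite) set \<Rightarrow> (real ^ 'd \<Rightarrow> real ^ 'd \<Rightarrow> real)
     \<Rightarrow> (real ^ 'd \<Rightarrow> real) \<Rightarrow> real ^ 'd \<Rightarrow> real" where
  "kernel_op k S h f y =
     (LINT x|lebesgue_on S. (\<Sum>\<alpha> | mi_order \<alpha> \<le> k. mixed_deriv \<alpha> 0 h x y * wderiv S \<alpha> f x))"

(* The last conjunct says that the e j with lam j = \<mu> span the eigenspace of \<mu>, i.e. that
   every non-zero eigenvalue is listed as often as its multiplicity.  It also forces J to be
   {1..N} exactly when the operator has finite rank N. *)
definition eigensystem ::
  "nat \<Rightarrow> (real ^ 'd::finite) set \<Rightarrow> (real ^ 'd \<Rightarrow> real ^ 'd \<Rightarrow> real)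
     \<Rightarrow> nat set \<Rightarrow> (nat \<Rightarrow> real) \<Rightarrow> (nat \<Rightarrow> real ^ 'd \<Rightarrow> real) \<Rightarrow> bool" where
  "eigensystem k S h J lam e \<longleftrightarrow>
     (J = {1..} \<or> (\<exists>N. J = {1..N})) \<and>
     (\<forall>j\<in>J. lam j \<noteq> 0) \<and>
     (\<forall>i\<in>J. \<forall>j\<in>J. i \<le> j \<longrightarrow> lam j \<le> lam i) \<and>
     (\<forall>j\<in>J. e j \<in> Hk k S \<and> e j \<in> Ck_uniform k S) \<and>
     (\<forall>j\<in>J. AE y in lebesgue_on S. kernel_op k S h (e j) y = lam j * e j y) \<and>
     (\<forall>i\<in>J. \<forall>j\<in>J. Hk_inner k S (e i) (e j) = (if i = j then 1 else 0)) \<and>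
     (\<forall>\<mu> f. \<mu> \<noteq> 0 \<and> f \<in> Hk k S \<and>
          (AE y in lebesgue_on S. kernel_op k S h f y = \<mu> * f y) \<longrightarrow>
        (\<exists>F c. finite F \<and> F \<subseteq> {j\<in>J. lam j = \<mu>} \<and>
           (AE y in lebesgue_on S. f y = (\<Sum>j\<in>F. c j * e j y))))"

definition eigenfunction_bound ::
  "(real ^ 'd::finite) set \<Rightarrow> nat \<Rightarrow> nat set \<Rightarrow> (nat \<Rightarrow> real ^ 'd \<Rightarrow> real) \<Rightarrow> real \<Rightarrow> bool" where
  "eigenfunction_bound S s J e C \<longleftrightarrow>
     (\<forall>j\<in>J. (MAX \<alpha>\<in>{\<alpha>. mi_order \<alpha> \<le> s}. SUP x\<in>S. ennreal \<bar>cderiv \<alpha> (e j) x\<bar>) \<le> ennreal C)"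

section \<open>Cone property\<close>

definition finite_cone_at :: "real ^ 'd::finite \<Rightarrow> (real ^ 'd) set \<Rightarrow> bool" where
  "finite_cone_at x A \<longleftrightarrow>
     (\<exists>\<epsilon> \<tau> z. \<epsilon> > 0 \<and> \<tau> > 0 \<and> x \<notin> ball z \<tau> \<and>
        A = ball x \<epsilon> \<inter> {x + l *\<^sub>R (y - x) | y l. y \<in> ball z \<tau> \<and> l > 0})"

(* Reflections count as rigid motions.  For d = 1, where finite cones are one-sided intervals,
   no non-empty bounded open set would otherwise have the cone property. *)
definition congruent_sets :: "(real ^ 'd::finite) set \<Rightarrow> (real ^ 'd) set \<Rightarrow> bool" where
  "congruent_sets A B \<longleftrightarrow>
     (\<exists>Q a. orthogonal_transformation Q \<and> A = (\<lambda>x. a + Q x) ` B)"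

definition cone_property :: "(real ^ 'd::finite) set \<Rightarrow> bool" where
  "cone_property S \<longleftrightarrow>
     (\<exists>v C0. finite_cone_at v C0 \<and>
        (\<forall>x\<in>S. \<exists>A. finite_cone_at x A \<and> A \<subseteq> S \<and> congruent_sets A C0))"

section \<open>Random fields\<close>

definition measurable_field ::
  "'w measure \<Rightarrow> (real ^ 'd::finite) set \<Rightarrow> (real ^ 'd \<Rightarrow> 'w \<Rightarrow> real) \<Rightarrow> bool" where
  "measurable_field M S X \<longleftrightarrow>
     (\<lambda>(t, \<omega>). X t \<omega>) \<in> borel_measurable (restrict_space borel S \<Otimes>\<^sub>M M)"

definition second_order_field ::
  "'w measure \<Rightarrow> 'a set \<Rightarrow> ('a \<Rightarrow> 'w \<Rightarrow> real) \<Rightarrow> bool" where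
  "second_order_field M S X \<longleftrightarrow>
     (\<forall>t\<in>S. X t \<in> borel_measurable M \<and> integrable M (\<lambda>\<omega>. (X t \<omega>)\<^sup>2))"

definition centred_field ::
  "'w measure \<Rightarrow> 'a set \<Rightarrow> ('a \<Rightarrow> 'w \<Rightarrow> real) \<Rightarrow> bool" where
  "centred_field M S X \<longleftrightarrow> (\<forall>t\<in>S. integral\<^sup>L M (X t) = 0)"

definition cov_kernel :: "'w measure \<Rightarrow> ('a \<Rightarrow> 'w \<Rightarrow> real) \<Rightarrow> 'a \<Rightarrow> 'a \<Rightarrow> real" where
  "cov_kernel M X s t =
     (LINT \<omega>|M. (X s \<omega> - integral\<^sup>L M (X s)) * (X t \<omega> - integral\<^sup>L M (X t)))"

definition Hk_path ::
  "nat \<Rightarrow> (real ^ 'd::finite) set \<Rightarrow> (real ^ 'd \<Rightarrow> 'w \<Rightarrow> real) \<Rightarrow> 'w \<Rightarrow> real ^ 'd \<Rightarrow> real" where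
  "Hk_path k S X \<omega> = (if (\<lambda>t. X t \<omega>) \<in> Hk k S then (\<lambda>t. X t \<omega>) else (\<lambda>t. 0))"

(* The second-order condition on Y \<alpha> makes the second moments in the last conjunct genuine
   (the Bochner integral of a non-integrable function is 0). *)
definition weak_deriv_process ::
  "'w measure \<Rightarrow> nat \<Rightarrow> (real ^ 'd::finite) set \<Rightarrow> (real ^ 'd \<Rightarrow> 'w \<Rightarrow> real)
     \<Rightarrow> ('d multi_index \<Rightarrow> real ^ 'd \<Rightarrow> 'w \<Rightarrow> real) \<Rightarrow> bool" where
  "weak_deriv_process M k S X Y \<longleftrightarrow>
     (\<forall>t\<in>S. \<forall>\<omega>\<in>space M. Y 0 t \<omega> = X t \<omega>) \<and>
     (\<forall>\<alpha>. mi_order \<alpha> \<le> k \<longrightarrow>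
        measurable_field M S (Y \<alpha>) \<and> second_order_field M S (Y \<alpha>) \<and>
        (AE \<omega> in M. (\<lambda>t. Y \<alpha> t \<omega>) \<in> L2 S) \<and>
        (\<forall>\<phi>\<in>test_functions S. AE \<omega> in M.
           (LINT t|lebesgue_on S. X t \<omega> * cderiv \<alpha> \<phi> t) =
           (- 1) ^ mi_order \<alpha> * (LINT t|lebesgue_on S. Y \<alpha> t \<omega> * \<phi> t))) \<and>
     (\<forall>\<alpha> \<beta>. \<forall>s\<in>S. \<forall>t\<in>S. mi_order \<alpha> \<le> k \<and> mi_order \<beta> \<le> k \<longrightarrow>
        (LINT \<omega>|M. Y \<beta> s \<omega> * Y \<alpha> t \<omega>) = mixed_deriv \<beta> \<alpha> (cov_kernel M X) s t)"

lemma cov_kernel_positive_definite: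
  assumes "prob_space M" and X: "second_order_field M S X"
  shows "positive_definite_on S (cov_kernel M X)"
proof -
  interpret prob_space M by fact
  define Z where "Z t \<omega> = X t \<omega> - integral\<^sup>L M (X t)" for t \<omega>
  have [measurable]: "X t \<in> borel_measurable M" if "t \<in> S" for t
    using X that by (simp add: second_order_field_def)
  have Zm: "Z t \<in> borel_measurable M" if "t \<in> S" for t
    using that unfolding Z_def by measurable
  have Xi: "integrable M (X t)" if "t \<in> S" for t
    using X that by (auto simp: second_order_field_def intro: square_integrable_imp_integrable)
  have Z2: "integrable M (\<lambda>\<omega>. (Z t \<omega>)\<^sup>2)" if "t \<in> S" for t
    using X that Xi[OF that] unfolding Z_def second_order_field_def power2_diff by auto
  have Zi: "integrable M (\<lambda>\<omega>. Z s \<omega> * Z t \<omega>)" if "s \<in> S" "t \<in> S" for s t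
  proof (rule Bochner_Integration.integrable_bound)
    show "integrable M (\<lambda>\<omega>. (Z s \<omega>)\<^sup>2 + (Z t \<omega>)\<^sup>2)"
      using Z2 that by auto
    show "(\<lambda>\<omega>. Z s \<omega> * Z t \<omega>) \<in> borel_measurable M"
      using Zm that by auto
    have "\<bar>a * b\<bar> \<le> a\<^sup>2 + b\<^sup>2" for a b :: real
    proof -
      have "2 * (\<bar>a\<bar> * \<bar>b\<bar>) \<le> a\<^sup>2 + b\<^sup>2"
        using sum_squares_bound[of "\<bar>a\<bar>" "\<bar>b\<bar>"] by (simp add: mult.assoc)
      moreover have "0 \<le> \<bar>a\<bar> * \<bar>b\<bar>"
        by simp
      ultimately show ?thesis
        unfolding abs_mult by linarith
    qed
    then show "AE \<omega> in M. norm (Z s \<omega> * Z t \<omega>) \<le> norm ((Z s \<omega>)\<^sup>2 + (Z t \<omega>)\<^sup>2)"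
      by auto
  qed
  have cov: "cov_kernel M X s t = (LINT \<omega>|M. Z s \<omega> * Z t \<omega>)" for s t
    by (simp add: cov_kernel_def Z_def)
  have "0 \<le> (\<Sum>x\<in>F. \<Sum>y\<in>F. c x * c y * cov_kernel M X x y)" if F: "finite F" "F \<subseteq> S" for F c
  proof -
    have "(\<Sum>x\<in>F. \<Sum>y\<in>F. c x * c y * cov_kernel M X x y)
        = (\<Sum>x\<in>F. \<Sum>y\<in>F. LINT \<omega>|M. c x * c y * (Z x \<omega> * Z y \<omega>))"
      by (simp add: cov)
    also have "\<dots> = (\<Sum>x\<in>F. LINT \<omega>|M. (\<Sum>y\<in>F. c x * c y * (Z x \<omega> * Z y \<omega>)))"
      by (intro sum.cong refl Bochner_Integration.integral_sum[symmetric] integrable_mult_right Zi)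
        (use F in auto)
    also have "\<dots> = (LINT \<omega>|M. (\<Sum>x\<in>F. \<Sum>y\<in>F. c x * c y * (Z x \<omega> * Z y \<omega>)))"
      by (intro Bochner_Integration.integral_sum[symmetric] Bochner_Integration.integrable_sum
          integrable_mult_right Zi) (use F in auto)
    also have "\<dots> = (LINT \<omega>|M. (\<Sum>x\<in>F. c x * Z x \<omega>)\<^sup>2)"
      by (simp add: power2_eq_square sum_product mult_ac)
    also have "\<dots> \<ge> 0"
      by simp
    finally show ?thesis .
  qed
  then show ?thesis
    by (auto simp: positive_definite_on_def cov mult.commute)
qed

end

theory Submission
  imports Defs "HOL-Complex_Analysis.Great_Picard"
begin

text \<open>
  Sobolev bound: u(x) is recovered from u(y), for y in the cone A with vertex x, by Taylor
  expansion along the segment from y to x.  Averaging over A and substituting z = x + t (y - x), the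
  remainder of order l is controlled by the L2-norm of the derivatives of order l times the integral of
  t^(l - 1 - d/2) over (0, 1), which is finite as l > d/2.  Of A only its volume enters, and this is bounded below
  because all the cones are congruent.

  Error bound: the map sending f to its derivatives up to order k embeds H^k isometrically into L2(Z),
  Z = {|alpha| <= k} x Theta, and turns the kernel operator into the integral operator T with the bounded kernel
  K(z, w) = E[Y_z Y_w], whose eigenfunctions for non-zero eigenvalues are again jets.  On the orthogonal complement of
  the first m eigenfunctions the supremum of the quadratic form of T is an eigenvalue by compactness, hence at most
  trace / (m + 1).  Testing this bound on shrinking balls gives, on the diagonal, the inequality
  K(z, z) - sum_{j <= m} lambda_j e_j(z)^2 <= C^2 sum_{j > m} lambda_j wherever all |e_j| <= C, and the
  left-hand side is the mean square error.
\<close>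

section \<open>Calculus with multi-indices\<close>

text \<open>The eigensystem is a hypothesis; its completeness enters only to exclude eigenvalues
  above trace / (m + 1) on the complement of the first m eigenfunctions. For that, an eigenfunction
  in L2(Z), a priori any square integrable family, must be recognised as a jet; it is one because T
  maps all of L2(Z) to jets of classical functions. Symmetry, positivity and the trace bound of T
  are read off its factorisation through L2 of the probability space, since K is a second moment.
  The diagonal inequality does not come from a single truncation level, because the normalised
  indicator of a ball has squared norm 1 / volume. The ball is kept fixed while the level n \<ge> m
  goes to infinity, which removes the error trace / (n + 1) times 1 / volume; only then does the
  ball shrink. Two obstacles shape the groundwork. \<open>cderiv\<close> iterates the total operator
  \<open>deriv\<close>, so derivatives are handled as whole families indexed by multi-indices. And
  the weak derivative identity holds almost surely for each test function separately, so countably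
  many test functions must be made to suffice.\<close>

lemma mi_order_add: "mi_order (\<alpha> + \<beta>) = mi_order \<alpha> + mi_order \<beta>"
  by (simp add: mi_order_def sum.distrib)

lemma mi_order_zero [simp]: "mi_order 0 = 0"
  by (simp add: mi_order_def)

lemma mi_order_axis [simp]: "mi_order (axis i n) = n"
  by (simp add: mi_order_def axis_def)

lemma mi_le_order: "\<alpha> $ i \<le> mi_order \<alpha>"
  unfolding mi_order_def by (rule member_le_sum) auto

lemma finite_mi_order_le: "finite {\<alpha> :: 'd::finite multi_index. mi_order \<alpha> \<le> k}"
proof -
  have "{\<alpha> :: 'd multi_index. mi_order \<alpha> \<le> k} \<subseteq> vec_lambda ` (PiE UNIV (\<lambda>_. {..k}))"
  proof
    fix \<alpha> :: "'d multi_index" assume "\<alpha> \<in> {\<alpha>. mi_order \<alpha> \<le> k}"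
    then have "($) \<alpha> \<in> PiE UNIV (\<lambda>_. {..k})"
      using mi_le_order[of \<alpha>] by (auto intro: order_trans)
    then show "\<alpha> \<in> vec_lambda ` (PiE UNIV (\<lambda>_. {..k}))"
      by (metis image_iff vec_nth_inverse)
  qed
  then show ?thesis
    by (rule finite_subset) (auto intro!: finite_imageI finite_PiE)
qed

lemma mi_cases_axis:
  assumes "mi_order (\<alpha> :: 'd::finite multi_index) = Suc n"
  obtains \<beta> i where "\<alpha> = \<beta> + axis i 1" "mi_order \<beta> = n"
proof -
  have "\<exists>i. \<alpha> $ i \<noteq> 0"
    using assms unfolding mi_order_def by (metis UNIV_I nat.distinct(1) sum.neutral)
  then obtain i where i: "\<alpha> $ i \<noteq> 0" by blast
  define \<beta> where "\<beta> = \<alpha> - axis i 1"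
  have "\<alpha> = \<beta> + axis i 1"
    using i by (auto simp: \<beta>_def vec_eq_iff axis_def)
  moreover from this have "mi_order \<beta> = n"
    using assms by (simp add: mi_order_add)
  ultimately show ?thesis using that by blast
qed

lemma coords: "distinct (coords :: 'd::finite list)" "set (coords :: 'd list) = UNIV"
proof -
  have "\<exists>is :: 'd list. distinct is \<and> set is = UNIV"
    using finite_distinct_list[of "UNIV :: 'd set"] by auto
  then have "distinct (coords :: 'd list) \<and> set (coords :: 'd list) = UNIV"
    unfolding coords_def by (rule someI_ex)
  then show "distinct (coords :: 'd::finite list)" "set (coords :: 'd list) = UNIV" by auto
qed

lemma cderiv_0 [simp]: "cderiv 0 (f :: real ^ 'd::finite \<Rightarrow> real) = f"
proof -
  have "foldr (\<lambda>i. partial_deriv i ^^ ((0 :: 'd multi_index) $ i)) L f = f" for L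
    by (induction L) auto
  then show ?thesis by (simp add: cderiv_def)
qed

lemma eventually_line_in_open:
  fixes x v :: "'a::real_normed_vector"
  assumes "open S" "x \<in> S"
  shows "\<forall>\<^sub>F t in nhds 0. x + t *\<^sub>R v \<in> S"
proof -
  have "((\<lambda>t. x + t *\<^sub>R v) \<longlongrightarrow> x + 0 *\<^sub>R v) (nhds 0)"
    by (intro tendsto_intros filterlim_ident)
  then show ?thesis
    using assms by (auto dest: topological_tendstoD)
qed

lemma partial_deriv_cong_open:
  assumes "open S" "x \<in> S" and "\<And>y. y \<in> S \<Longrightarrow> f y = g y"
  shows "partial_deriv i f x = partial_deriv i g x"
proof -
  have "\<forall>\<^sub>F t in nhds 0. f (x + t *\<^sub>R axis i 1) = g (x + t *\<^sub>R axis i 1)"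
    using eventually_line_in_open[OF assms(1,2)] assms(3) by (rule eventually_mono)
  then show ?thesis
    unfolding partial_deriv_def by (rule deriv_cong_ev) simp
qed

lemma partial_deriv_pow_cong_open:
  assumes "open S" "\<And>y. y \<in> S \<Longrightarrow> f y = g y" "x \<in> S"
  shows "(partial_deriv i ^^ n) f x = (partial_deriv i ^^ n) g x"
  using assms(3)
proof (induction n arbitrary: x)
  case (Suc n)
  then show ?case
    by (auto intro!: partial_deriv_cong_open[OF assms(1)])
qed (use assms in auto)

text \<open>A partial derivative at a point of an open set sees only the values on a short segment
  inside the set, so agreement on the set survives every differentiation.\<close>

lemma cderiv_cong_open:
  assumes "open S" "\<And>y. y \<in> S \<Longrightarrow> f y = g y" "x \<in> S"
  shows "cderiv \<alpha> f x = cderiv \<alpha> g x"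
proof -
  have "foldr (\<lambda>i. partial_deriv i ^^ (\<alpha> $ i)) L f x = foldr (\<lambda>i. partial_deriv i ^^ (\<alpha> $ i)) L g x"
    if "x \<in> S" for L x
    using that
  proof (induction L arbitrary: x)
    case (Cons a L)
    then show ?case
      by (auto intro!: partial_deriv_pow_cong_open[OF assms(1)])
  qed (use assms in auto)
  then show ?thesis using assms(3) by (simp add: cderiv_def)
qed

lemma has_real_derivative_cong_line:
  fixes x v :: "'a::real_normed_vector"
  assumes "open S" "x \<in> S" "\<And>y. y \<in> S \<Longrightarrow> f y = g y"
  shows "((\<lambda>t. f (x + t *\<^sub>R v)) has_real_derivative D) (at 0) \<longleftrightarrow>
         ((\<lambda>t. g (x + t *\<^sub>R v)) has_real_derivative D) (at 0)"
proof -
  have "\<forall>\<^sub>F t in nhds 0. f (x + t *\<^sub>R v) = g (x + t *\<^sub>R v)"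
    using eventually_line_in_open[OF assms(1,2)] assms(3) by (rule eventually_mono)
  then show ?thesis
    by (intro DERIV_cong_ev refl)
qed

text \<open>All derivatives up to order k are prescribed at once, and
  \<open>\<alpha> + axis i 1\<close> is reached from \<open>\<alpha>\<close> for every i. Each index
  has one value whatever the path to it, so the symmetry of mixed partial derivatives is built
  in.\<close>

definition deriv_family :: "nat \<Rightarrow> (real ^ 'd::finite) set \<Rightarrow> ('d multi_index \<Rightarrow> real ^ 'd \<Rightarrow> real) \<Rightarrow> bool"
  where "deriv_family k S G \<longleftrightarrow> (\<forall>\<alpha> i. \<forall>x\<in>S. mi_order \<alpha> < k \<longrightarrow>
     ((\<lambda>t. G \<alpha> (x + t *\<^sub>R axis i 1)) has_real_derivative G (\<alpha> + axis i 1) x) (at 0))"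

lemma derivs_exist_on_iff: "derivs_exist_on k S f \<longleftrightarrow> deriv_family k S (\<lambda>\<alpha>. cderiv \<alpha> f)"
  by (simp add: derivs_exist_on_def deriv_family_def)

text \<open>\<open>cderiv\<close> works through the coordinates in the unknown order
  \<open>coords\<close>. Each intermediate result is a member of the family, and its index records
  only how often each coordinate has been used, so the order leaves no trace.\<close>

lemma cderiv_eqI:
  fixes f :: "real ^ 'd::finite \<Rightarrow> real"
  assumes "open S" and G0: "\<And>x. x \<in> S \<Longrightarrow> G 0 x = f x" and G: "deriv_family k S G"
    and "mi_order \<alpha> \<le> k" "x \<in> S"
  shows "cderiv \<alpha> f x = G \<alpha> x"
proof -
  \<comment> \<open>\<open>r A\<close> is the index reached once exactly the coordinates in
    \<open>A\<close> have been differentiated.\<close>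
  define r :: "'d set \<Rightarrow> 'd multi_index" where "r A = (\<chi> i. if i \<in> A then \<alpha> $ i else 0)" for A
  have r_le: "mi_order (r A) \<le> mi_order \<alpha>" for A
    unfolding mi_order_def r_def by (rule sum_mono) auto
  have *: "distinct L \<Longrightarrow> (\<forall>x\<in>S. foldr (\<lambda>i. partial_deriv i ^^ (\<alpha> $ i)) L f x = G (r (set L)) x)"
    for L
  proof (induction L)
    case Nil
    have "r {} = 0" by (auto simp: r_def vec_eq_iff)
    then show ?case using G0 by simp
  next
    case (Cons a L)
    define h where "h = foldr (\<lambda>i. partial_deriv i ^^ (\<alpha> $ i)) L f"
    have h: "h x = G (r (set L)) x" if "x \<in> S" for x
      using Cons that by (simp add: h_def)
    have "n \<le> \<alpha> $ a \<Longrightarrow> \<forall>x\<in>S. (partial_deriv a ^^ n) h x = G (r (set L) + axis a n) x" for n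
    proof (induction n)
      case 0
      have "r (set L) + axis a 0 = r (set L)" by (simp add: axis_def vec_eq_iff)
      with h show ?case by (simp only: funpow_0) simp
    next
      case (Suc n)
      show ?case
      proof
        fix x assume x: "x \<in> S"
        have "(partial_deriv a ^^ Suc n) h x = partial_deriv a (G (r (set L) + axis a n)) x"
          using Suc by (auto intro!: partial_deriv_cong_open[OF \<open>open S\<close> x])
        moreover have e: "r (set L) + axis a n + axis a 1 = r (set L) + axis a (Suc n)"
          by (auto simp: vec_eq_iff axis_def)
        have ee: "r (set (a # L)) = r (set L) + axis a (\<alpha> $ a)"
          using Cons.prems by (auto simp: vec_eq_iff axis_def r_def)
        \<comment> \<open>One more derivative in coordinate a still leads to an index below
          \<alpha>, so the family has a derivative to offer.\<close>
        have "mi_order (r (set L) + axis a n) < k"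
          using r_le[of "set (a # L)"] Suc.prems assms(4) unfolding ee by (simp add: mi_order_add)
        then have "((\<lambda>t. G (r (set L) + axis a n) (x + t *\<^sub>R axis a 1)) has_real_derivative
                   G (r (set L) + axis a (Suc n)) x) (at 0)"
          using G x unfolding deriv_family_def e[symmetric] by blast
        then have "partial_deriv a (G (r (set L) + axis a n)) x = G (r (set L) + axis a (Suc n)) x"
          unfolding partial_deriv_def by (rule DERIV_imp_deriv)
        ultimately show "(partial_deriv a ^^ Suc n) h x = G (r (set L) + axis a (Suc n)) x"
          by simp
      qed
    qed
    from this[of "\<alpha> $ a"] have "\<forall>x\<in>S. (partial_deriv a ^^ (\<alpha> $ a)) h x = G (r (set L) + axis a (\<alpha> $ a)) x"
      by simp
    moreover have "r (set (a # L)) = r (set L) + axis a (\<alpha> $ a)"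
      using Cons.prems by (auto simp: vec_eq_iff axis_def r_def)
    ultimately show ?case by (simp add: h_def)
  qed
  have "r UNIV = \<alpha>" by (simp add: r_def vec_eq_iff)
  then show ?thesis
    using *[of coords] coords[where 'd='d] assms(5) by (simp add: cderiv_def)
qed

lemma derivs_exist_on_familyI:
  fixes f :: "real ^ 'd::finite \<Rightarrow> real"
  assumes "open S" and "\<And>x. x \<in> S \<Longrightarrow> G 0 x = f x" and G: "deriv_family k S G"
  shows "derivs_exist_on k S f"
  unfolding derivs_exist_on_def
proof (intro allI ballI impI)
  fix \<alpha> :: "'d multi_index" and i x assume x: "x \<in> S" and a: "mi_order \<alpha> < k"
  have "((\<lambda>t. G \<alpha> (x + t *\<^sub>R axis i 1)) has_real_derivative G (\<alpha> + axis i 1) x) (at 0)"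
    using G x a by (simp add: deriv_family_def)
  then show "((\<lambda>t. cderiv \<alpha> f (x + t *\<^sub>R axis i 1)) has_real_derivative cderiv (\<alpha> + axis i 1) f x) (at 0)"
    using a x has_real_derivative_cong_line[OF assms(1) x, of "cderiv \<alpha> f" "G \<alpha>"]
    by (subst cderiv_eqI[OF assms]) (auto simp: cderiv_eqI[OF assms] mi_order_add)
qed

lemma Ck_uniform_familyI:
  assumes "open S" and "\<And>x. x \<in> S \<Longrightarrow> G 0 x = f x" and G: "deriv_family k S G"
    and "\<And>\<alpha>. mi_order \<alpha> \<le> k \<Longrightarrow> uniformly_continuous_on S (G \<alpha>)"
  shows "f \<in> Ck_uniform k S"
  unfolding Ck_uniform_def
proof (intro CollectI conjI allI impI)
  show "derivs_exist_on k S f" by (rule derivs_exist_on_familyI[OF assms(1-3)])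
  fix \<alpha> :: "'a multi_index" assume "mi_order \<alpha> \<le> k"
  then show "uniformly_continuous_on S (cderiv \<alpha> f)"
    using assms(4)[of \<alpha>] cderiv_eqI[OF assms(1-3)]
    by (simp add: uniformly_continuous_on_def)
qed

lemma Ck_uniform_cong_open:
  assumes "open S" "f \<in> Ck_uniform k S" "\<And>x. x \<in> S \<Longrightarrow> f x = g x"
  shows "g \<in> Ck_uniform k S"
  by (rule Ck_uniform_familyI[OF assms(1), of "\<lambda>\<alpha>. cderiv \<alpha> f"])
     (use assms(2,3) in \<open>auto simp: Ck_uniform_def derivs_exist_on_iff\<close>)

lemma deriv_family_add:
  assumes "deriv_family k S F" "deriv_family k S G"
  shows "deriv_family k S (\<lambda>\<alpha> x. F \<alpha> x + c * G \<alpha> x)"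
  using assms unfolding deriv_family_def
  by (auto intro!: derivative_eq_intros)

lemma cderiv_add_scale:
  assumes "open S" "f \<in> Ck_uniform k S" "g \<in> Ck_uniform k S" "mi_order \<alpha> \<le> k" "x \<in> S"
  shows "cderiv \<alpha> (\<lambda>x. f x + c * g x) x = cderiv \<alpha> f x + c * cderiv \<alpha> g x"
  by (rule cderiv_eqI[OF assms(1) _ _ assms(4,5)])
     (use assms(2,3) deriv_family_add[of k S "\<lambda>\<alpha>. cderiv \<alpha> f" "\<lambda>\<alpha>. cderiv \<alpha> g" c] in
       \<open>auto simp: Ck_uniform_def derivs_exist_on_iff\<close>)

lemma Ck_uniform_add_scale:
  assumes "open S" "f \<in> Ck_uniform k S" "g \<in> Ck_uniform k S"
  shows "(\<lambda>x. f x + c * g x) \<in> Ck_uniform k S"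
  by (rule Ck_uniform_familyI[OF assms(1), of "\<lambda>\<alpha> x. cderiv \<alpha> f x + c * cderiv \<alpha> g x"])
     (use assms(2,3) deriv_family_add[of k S "\<lambda>\<alpha>. cderiv \<alpha> f" "\<lambda>\<alpha>. cderiv \<alpha> g" c] in
       \<open>auto simp: Ck_uniform_def derivs_exist_on_iff intro!: uniformly_continuous_on_add uniformly_continuous_on_cmul_left\<close>)

lemma cderiv_zero: "cderiv \<alpha> (\<lambda>_. 0) = (\<lambda>_. 0)"
proof
  fix x
  show "cderiv \<alpha> (\<lambda>_. 0) x = 0"
    by (rule cderiv_eqI[of UNIV "\<lambda>_ _. 0" _ "mi_order \<alpha>"]) (auto simp: deriv_family_def)
qed

lemma zero_Ck_uniform: "(\<lambda>_. 0) \<in> Ck_uniform k S"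
  by (simp add: Ck_uniform_def cderiv_zero derivs_exist_on_def uniformly_continuous_on_const)

text \<open>Shifting all indices by \<alpha> turns the derivatives of f into a family for
  \<open>cderiv \<alpha> f\<close>; l counts the orders that remain after the shift.\<close>

lemma
  assumes "open S" "f \<in> Ck_uniform k S" "mi_order \<alpha> + l \<le> k"
  shows cderiv_Ck_uniform: "cderiv \<alpha> f \<in> Ck_uniform l S"
    and cderiv_cderiv: "mi_order \<beta> \<le> l \<Longrightarrow> x \<in> S \<Longrightarrow> cderiv \<beta> (cderiv \<alpha> f) x = cderiv (\<alpha> + \<beta>) f x"
proof -
  have fam: "deriv_family l S (\<lambda>\<beta>. cderiv (\<alpha> + \<beta>) f)"
    using assms(2,3) unfolding Ck_uniform_def derivs_exist_on_def deriv_family_def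
    by (auto simp: mi_order_add add.assoc[symmetric])
  show "cderiv \<alpha> f \<in> Ck_uniform l S"
    by (rule Ck_uniform_familyI[OF assms(1) _ fam])
       (use assms(2,3) in \<open>auto simp: Ck_uniform_def mi_order_add\<close>)
  show "mi_order \<beta> \<le> l \<Longrightarrow> x \<in> S \<Longrightarrow> cderiv \<beta> (cderiv \<alpha> f) x = cderiv (\<alpha> + \<beta>) f x"
    by (rule cderiv_eqI[OF assms(1) _ fam]) auto
qed

section \<open>Smooth bump functions\<close>

text \<open>For fixed c and q this class of functions is closed under differentiation, whatever the sign changes of q.\<close>

definition bump1 :: "real \<Rightarrow> real poly \<Rightarrow> real poly \<Rightarrow> nat \<Rightarrow> real \<Rightarrow> real" where
  "bump1 c q p m t = (if poly q t > 0 then poly p t / poly q t ^ m * exp (- c / poly q t) else 0)"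

text \<open>The term of degree n in the exponential series of c / q is at most exp (c / q), which
  gives the bound fact n / c ^ n.\<close>

lemma power_exp_bounded:
  assumes "c > 0"
  obtains K :: real where "K > 0" "\<And>q. q > 0 \<Longrightarrow> exp (- c / q) / q ^ n \<le> K"
proof -
  have le: "y ^ n / fact n \<le> exp y" if "y \<ge> 0" for y :: real
  proof -
    have "(\<Sum>i\<in>{n}. y ^ i /\<^sub>R fact i) \<le> (\<Sum>i. y ^ i /\<^sub>R fact i)"
      by (rule sum_le_suminf[OF summable_exp_generic]) (use that in auto)
    then show ?thesis by (simp add: exp_def divide_inverse mult.commute)
  qed
  have "exp (- c / q) / q ^ n \<le> fact n / c ^ n" if "q > 0" for q
  proof -
    have "(c / q) ^ n / fact n \<le> exp (c / q)" using le[of "c / q"] assms that by simp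
    then have "exp (- (c / q)) * ((c / q) ^ n / fact n) \<le> exp (- (c / q)) * exp (c / q)"
      by (intro mult_left_mono) auto
    then have "exp (- (c / q)) * ((c / q) ^ n / fact n) \<le> 1"
      by (simp add: exp_minus_inverse mult.commute flip: exp_add)
    then show ?thesis
      using assms that by (simp add: field_simps power_divide)
  qed
  then show ?thesis using that[of "fact n / c ^ n"] assms by simp
qed

text \<open>The new numerator is what the quotient and chain rules give where q > 0. At a zero of q
  the exponential is flat to every order, and where q < 0 the function is locally zero, so the same
  formula holds everywhere.\<close>

lemma bump1_deriv:
  assumes "c > 0"
  shows "(bump1 c q p m has_real_derivative
     bump1 c q (pderiv p * q\<^sup>2 - smult (real m) (p * pderiv q * q) + smult c (p * pderiv q)) (m + 2) t) (at t)"
proof (cases "poly q t > 0")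
  case True
  have op: "open {s. poly q s > 0}"
    by (intro open_Collect_less continuous_intros)
  have "((\<lambda>t. poly p t / poly q t ^ m * exp (- c / poly q t)) has_real_derivative
     (poly (pderiv p * q\<^sup>2 - smult (real m) (p * pderiv q * q) + smult c (p * pderiv q)) t / poly q t ^ (m + 2) * exp (- c / poly q t))) (at t)"
  proof -
    define P Q P' Q' where "P = poly p t" and "Q = poly q t" and "P' = poly (pderiv p) t" and "Q' = poly (pderiv q) t"
    note D = P_def Q_def P'_def Q'_def
    have Q: "Q > 0" using True by (simp add: D)
    have dp: "(poly p has_real_derivative P') (at t)" and dq: "(poly q has_real_derivative Q') (at t)"
      unfolding D by (rule poly_DERIV)+
    have e: "((\<lambda>t. exp (- c / poly q t)) has_real_derivative exp (- c / Q) * (c * Q' / Q\<^sup>2)) (at t)"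
      by (rule DERIV_cong[OF DERIV_fun_exp[OF DERIV_divide[OF DERIV_const dq]]])
         (use Q in \<open>auto simp: D power2_eq_square\<close>)
    have pw: "((\<lambda>t. poly q t ^ m) has_real_derivative real m * Q ^ m * Q' / Q) (at t)"
      by (rule DERIV_cong[OF DERIV_power[OF dq]]) (use Q in \<open>cases m; auto simp: Q_def\<close>)
    have "((\<lambda>t. poly p t / poly q t ^ m * exp (- c / poly q t)) has_real_derivative
       (P' * Q ^ m - P * (real m * Q ^ m * Q' / Q)) / (Q ^ m * Q ^ m) * exp (- c / Q) +
       exp (- c / Q) * (c * Q' / Q\<^sup>2) * (P / Q ^ m)) (at t)"
      using DERIV_mult[OF DERIV_divide[OF dp pw] e] Q by (simp add: D)
    moreover have "(P' * Q ^ m - P * (real m * Q ^ m * Q' / Q)) / (Q ^ m * Q ^ m) * exp (- c / Q) +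
       exp (- c / Q) * (c * Q' / Q\<^sup>2) * (P / Q ^ m) =
       (P' * Q\<^sup>2 - real m * (P * Q' * Q) + c * (P * Q')) / Q ^ (m + 2) * exp (- c / Q)"
    proof -
      have "Q ^ m > 0" using Q by simp
      moreover have "Q ^ (m + 2) = Q ^ m * Q * Q" by (simp add: mult_ac)
      ultimately show ?thesis
        using Q by (simp add: divide_simps power2_eq_square) (simp add: algebra_simps)
    qed
    ultimately show ?thesis by (simp add: D)
  qed
  then have "(bump1 c q p m has_real_derivative
     (poly (pderiv p * q\<^sup>2 - smult (real m) (p * pderiv q * q) + smult c (p * pderiv q)) t / poly q t ^ (m + 2) * exp (- c / poly q t))) (at t)"
    by (rule has_field_derivative_transform_within_open[OF _ op])
       (use True in \<open>auto simp: bump1_def\<close>)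
  then show ?thesis using True by (simp add: bump1_def)
next
  case False
  have "(bump1 c q p m has_real_derivative 0) (at t)"
  proof (cases "poly q t = 0")
    case t: True
    \<comment> \<open>Two spare powers of q are taken from the exponential: after division by h one
      of them becomes the difference quotient of q at its zero t, which converges, and the other
      tends to 0.\<close>
    obtain K where K: "K > 0" "\<And>q. q > 0 \<Longrightarrow> exp (- c / q) / q ^ (m + 2) \<le> K"
      using power_exp_bounded[OF assms] by blast
    have bd: "\<bar>bump1 c q p m s\<bar> \<le> K * \<bar>poly p s\<bar> * \<bar>poly q s\<bar>\<^sup>2" for s
    proof (cases "poly q s > 0")
      case True
      have "\<bar>bump1 c q p m s\<bar> = \<bar>poly p s\<bar> * (poly q s)\<^sup>2 * (exp (- c / poly q s) / poly q s ^ (m + 2))"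
        using True by (simp add: bump1_def abs_mult field_simps power2_eq_square)
      also have "\<dots> \<le> \<bar>poly p s\<bar> * (poly q s)\<^sup>2 * K"
        using K(2)[OF True] by (intro mult_left_mono) auto
      finally show ?thesis by (simp add: mult_ac)
    qed (use K in \<open>simp add: bump1_def\<close>)
    have "(\<lambda>h. (bump1 c q p m (t + h) - bump1 c q p m t) / h) \<midarrow>0\<rightarrow> 0"
    proof (rule Lim_null_comparison)
      show "\<forall>\<^sub>F h in at 0. norm ((bump1 c q p m (t + h) - bump1 c q p m t) / h)
        \<le> K * \<bar>poly p (t + h)\<bar> * \<bar>poly q (t + h)\<bar> * \<bar>(poly q (t + h) - poly q t) / h\<bar>"
      proof (intro always_eventually allI)
        fix h
        have "bump1 c q p m t = 0" using t by (simp add: bump1_def)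
        then have "norm ((bump1 c q p m (t + h) - bump1 c q p m t) / h) = \<bar>bump1 c q p m (t + h)\<bar> / \<bar>h\<bar>"
          by simp
        also have "\<dots> \<le> K * \<bar>poly p (t + h)\<bar> * \<bar>poly q (t + h)\<bar>\<^sup>2 / \<bar>h\<bar>"
          by (intro divide_right_mono bd) simp
        also have "\<dots> = K * \<bar>poly p (t + h)\<bar> * \<bar>poly q (t + h)\<bar> * \<bar>(poly q (t + h) - poly q t) / h\<bar>"
          using t by (simp add: abs_divide power2_eq_square)
        finally show "norm ((bump1 c q p m (t + h) - bump1 c q p m t) / h)
          \<le> K * \<bar>poly p (t + h)\<bar> * \<bar>poly q (t + h)\<bar> * \<bar>(poly q (t + h) - poly q t) / h\<bar>" .
      qed
      have q: "((\<lambda>h. (poly q (t + h) - poly q t) / h) \<longlongrightarrow> poly (pderiv q) t) (at 0)"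
        using poly_DERIV[of q t] by (simp add: DERIV_def)
      have pc: "((\<lambda>h. poly r (t + h)) \<longlongrightarrow> poly r (t + 0)) (at 0)" for r
        by (intro tendsto_intros)
      have "((\<lambda>h. K * \<bar>poly p (t + h)\<bar> * \<bar>poly q (t + h)\<bar> * \<bar>(poly q (t + h) - poly q t) / h\<bar>)
        \<longlongrightarrow> K * \<bar>poly p (t + 0)\<bar> * \<bar>poly q (t + 0)\<bar> * \<bar>poly (pderiv q) t\<bar>) (at 0)"
        by (intro tendsto_mult tendsto_rabs tendsto_const q pc)
      then show "((\<lambda>h. K * \<bar>poly p (t + h)\<bar> * \<bar>poly q (t + h)\<bar> * \<bar>(poly q (t + h) - poly q t) / h\<bar>) \<longlongrightarrow> 0) (at 0)"
        using t by simp
    qed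
    then show ?thesis by (simp add: DERIV_def)
  next
    case t: False
    have op: "open {s. poly q s < 0}"
      by (intro open_Collect_less continuous_intros)
    show ?thesis
      by (rule has_field_derivative_transform_within_open[OF DERIV_const[of 0] op])
         (use t False in \<open>auto simp: bump1_def\<close>)
  qed
  then show ?thesis using False by (simp add: bump1_def)
qed

lemma bump1_deriv_iterate:
  assumes "c > 0"
  shows "\<exists>p' m'. (deriv ^^ n) (bump1 c q p m) = bump1 c q p' m'"
proof (induction n)
  case (Suc n)
  then obtain p' m' where "(deriv ^^ n) (bump1 c q p m) = bump1 c q p' m'" by auto
  moreover have "deriv (bump1 c q p' m') = bump1 c q (pderiv p' * q\<^sup>2 - smult (real m') (p' * pderiv q * q) + smult c (p' * pderiv q)) (m' + 2)"
    by (intro ext DERIV_imp_deriv bump1_deriv assms)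
  ultimately show ?case by auto
qed auto

lemma bump1_iterate_DERIV:
  assumes "c > 0"
  shows "((deriv ^^ n) (bump1 c q p m) has_real_derivative (deriv ^^ Suc n) (bump1 c q p m) t) (at t)"
proof -
  obtain p' m' where *: "(deriv ^^ n) (bump1 c q p m) = bump1 c q p' m'"
    using bump1_deriv_iterate[OF assms] by metis
  show ?thesis
    using bump1_deriv[OF assms, of q p' m' t] by (simp add: * DERIV_imp_deriv[OF bump1_deriv[OF assms]])
qed

text \<open>On the open box this is the product of the functions exp (- c / ((x_i - a_i) (b_i -
  x_i))). The parameter c is kept so that it can be sent to 0, where the indicator of the box
  appears.\<close>

definition box_bump :: "real \<Rightarrow> real ^ 'd::finite \<Rightarrow> real ^ 'd \<Rightarrow> real ^ 'd \<Rightarrow> real" where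
  "box_bump c a b x = (\<Prod>i\<in>UNIV. bump1 c ([:- a $ i, 1:] * [:b $ i, -1:]) 1 0 (x $ i))"

lemma deriv_family_UNIV_Ck:
  fixes f :: "real ^ 'd::finite \<Rightarrow> real"
  assumes "G 0 = f" "\<And>k. deriv_family k UNIV G" "\<And>\<alpha>. continuous_on UNIV (G \<alpha>)"
  shows "f \<in> Ck k UNIV"
proof -
  have eq: "cderiv \<alpha> f = G \<alpha>" for \<alpha>
    using cderiv_eqI[of UNIV G f "mi_order \<alpha>" \<alpha>] assms by auto
  show ?thesis
    using assms derivs_exist_on_familyI[of UNIV G f k] by (simp add: Ck_def eq)
qed

lemma box_bump_test_function:
  fixes a b :: "real ^ 'd::finite"
  assumes "c > 0" "cbox a b \<subseteq> S" "\<And>i. a $ i < b $ i"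
  shows "box_bump c a b \<in> test_functions S"
proof -
  define D where "D i n = (deriv ^^ n) (bump1 c ([:- a $ i, 1:] * [:b $ i, -1:]) 1 0)" for i n
  \<comment> \<open>Differentiation acts on each factor separately: factor i is replaced by its
    derivative of order \<open>\<alpha> $ i\<close>.\<close>
  define G where "G \<alpha> x = (\<Prod>i\<in>UNIV. D i (\<alpha> $ i) (x $ i))" for \<alpha> and x :: "real ^ 'd"
  have D: "(D i n has_real_derivative D i (Suc n) t) (at t)" for i n t
    unfolding D_def by (rule bump1_iterate_DERIV[OF assms(1)])
  have Dc: "continuous_on UNIV (D i n)" for i n
    by (rule DERIV_continuous_on) (rule has_field_derivative_at_within[OF D])
  have G_deriv: "((\<lambda>t. G \<alpha> (x + t *\<^sub>R axis i 1)) has_real_derivative G (\<alpha> + axis i 1) x) (at 0)" for \<alpha> i x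
  proof -
    have split: "(\<Prod>j\<in>UNIV. f j) = f i * (\<Prod>j\<in>UNIV-{i}. f j)" for f :: "'d \<Rightarrow> real"
      by (simp add: prod.remove)
    have "((\<lambda>t. D i (\<alpha> $ i) (x $ i + t) * (\<Prod>j\<in>UNIV-{i}. D j (\<alpha> $ j) (x $ j))) has_real_derivative
       D i (Suc (\<alpha> $ i)) (x $ i) * (\<Prod>j\<in>UNIV-{i}. D j (\<alpha> $ j) (x $ j))) (at 0)"
    proof (rule DERIV_cmult_right)
      have "(D i (\<alpha> $ i) has_real_derivative D i (Suc (\<alpha> $ i)) (x $ i)) (at (0 + x $ i))"
        using D[of i "\<alpha> $ i" "x $ i"] by simp
      then show "((\<lambda>t. D i (\<alpha> $ i) (x $ i + t)) has_real_derivative D i (Suc (\<alpha> $ i)) (x $ i)) (at 0)"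
        by (subst (asm) DERIV_shift) (simp add: add.commute)
    qed
    moreover have "G \<alpha> (x + t *\<^sub>R axis i 1) = D i (\<alpha> $ i) (x $ i + t) * (\<Prod>j\<in>UNIV-{i}. D j (\<alpha> $ j) (x $ j))" for t
      unfolding G_def split by (auto simp: axis_def intro!: prod.cong)
    moreover have "G (\<alpha> + axis i 1) x = D i (Suc (\<alpha> $ i)) (x $ i) * (\<Prod>j\<in>UNIV-{i}. D j (\<alpha> $ j) (x $ j))"
      unfolding G_def split by (auto simp: axis_def intro!: prod.cong)
    ultimately show ?thesis by simp
  qed
  have "box_bump c a b \<in> Ck k UNIV" for k
  proof (rule deriv_family_UNIV_Ck)
    show "G 0 = box_bump c a b"
      by (auto simp: G_def D_def box_bump_def fun_eq_iff)
    show "deriv_family k UNIV G" for k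
      using G_deriv by (simp add: deriv_family_def)
    show "continuous_on UNIV (G \<alpha>)" for \<alpha>
      unfolding G_def
      by (intro continuous_on_prod continuous_on_compose2[OF Dc] continuous_intros) auto
  qed
  moreover have "box_bump c a b x = 0" if "x \<notin> cbox a b" for x
  proof -
    from that obtain i where i: "x $ i < a $ i \<or> b $ i < x $ i"
      by (auto simp: mem_box_cart not_le)
    \<comment> \<open>Because a_i < b_i, the two factors are never negative at the same
      time.\<close>
    then have "(x $ i - a $ i) * (b $ i - x $ i) \<le> 0"
      using assms(3)[of i] by (auto intro: mult_nonpos_nonneg mult_nonneg_nonpos)
    then have "bump1 c ([:- a $ i, 1:] * [:b $ i, -1:]) 1 0 (x $ i) = 0"
      by (auto simp: bump1_def algebra_simps)
    then show ?thesis unfolding box_bump_def by (intro prod_zero) auto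
  qed
  ultimately show ?thesis
    using assms(2) compact_cbox[of a b] unfolding test_functions_def by blast
qed

lemma box_bump_tendsto:
  fixes a b x :: "real ^ 'd::finite"
  assumes "\<And>i. a $ i < b $ i"
  shows "(\<lambda>n. box_bump (1 / real (Suc n)) a b x) \<longlonglongrightarrow> indicator (box a b) x"
proof -
  have ind: "indicator (box a b) x = (\<Prod>i\<in>UNIV. if 0 < (x $ i - a $ i) * (b $ i - x $ i) then 1 else (0::real))"
  proof -
    have "0 < (x $ i - a $ i) * (b $ i - x $ i) \<longleftrightarrow> a $ i < x $ i \<and> x $ i < b $ i" for i
      using assms[of i] by (auto simp: zero_less_mult_iff)
    then have eq: "(if 0 < (x $ i - a $ i) * (b $ i - x $ i) then 1 else (0::real)) =
      (if a $ i < x $ i \<and> x $ i < b $ i then 1 else 0)" for i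
      by simp
    show ?thesis
    proof (cases "x \<in> box a b")
      case True
      then have "(\<Prod>i\<in>UNIV. if 0 < (x $ i - a $ i) * (b $ i - x $ i) then 1 else (0::real)) = 1"
        unfolding eq by (intro prod.neutral) (auto simp: mem_box_cart)
      then show ?thesis using True by simp
    next
      case False
      then obtain i where "\<not> (a $ i < x $ i \<and> x $ i < b $ i)" by (auto simp: mem_box_cart)
      then have "(\<Prod>i\<in>UNIV. if 0 < (x $ i - a $ i) * (b $ i - x $ i) then 1 else (0::real)) = 0"
        unfolding eq by (intro prod_zero bexI[of _ i]) auto
      then show ?thesis using False by simp
    qed
  qed
  have poly_eq: "poly ([:- p, 1:] * [:q, -1:]) t = (t - p) * (q - t)" for p q t :: real
    by (simp add: algebra_simps)
  show ?thesis
    unfolding ind box_bump_def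
  proof (intro tendsto_prod)
    fix i
    have "(\<lambda>n. exp (- (1 / real (Suc n)) / y)) \<longlonglongrightarrow> 1" for y
    proof -
      have "(\<lambda>n. exp (inverse (real (Suc n)) * (- 1 / y))) \<longlonglongrightarrow> exp (0 * (- 1 / y))"
        by (intro tendsto_exp tendsto_mult tendsto_const LIMSEQ_inverse_real_of_nat)
      then show ?thesis by (simp add: divide_inverse mult.commute)
    qed
    then show "(\<lambda>n. bump1 (1 / real (Suc n)) ([:- a $ i, 1:] * [:b $ i, -1:]) 1 0 (x $ i))
      \<longlonglongrightarrow> (if 0 < (x $ i - a $ i) * (b $ i - x $ i) then 1 else 0)"
      by (simp only: bump1_def poly_eq) simp
  qed
qed

lemma box_bump_bounds: 
  assumes "c > 0"
  shows "0 \<le> box_bump c a b x" "box_bump c a b x \<le> 1"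
  unfolding box_bump_def
  using assms by (auto intro!: prod_nonneg prod_le_1 simp: bump1_def)

section \<open>Integration by parts and the fundamental lemma\<close>

text \<open>By translation invariance the difference quotients of u have integral zero.\<close>

lemma integral_directional_deriv_eq_0:
  fixes u u' :: "'a::euclidean_space \<Rightarrow> real"
  assumes u: "continuous_on UNIV u" and u': "continuous_on UNIV u'"
    and K: "bounded K" and uK: "\<And>x. x \<notin> K \<Longrightarrow> u x = 0" and u'K: "\<And>x. x \<notin> K \<Longrightarrow> u' x = 0"
    and der: "\<And>x. ((\<lambda>t. u (x + t *\<^sub>R v)) has_real_derivative u' x) (at 0)"
  shows "(LINT x|lborel. u' x) = 0"
proof -
  obtain R where R: "K \<subseteq> cball 0 R"
    using bounded_subset_ballD[OF K, of 0] ball_subset_cball by blast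
  obtain B where B: "B > 0" "\<And>x. \<bar>u' x\<bar> \<le> B"
  proof -
    have "compact (u' ` cball 0 R)"
      by (intro compact_continuous_image compact_cball) (use u' in \<open>auto intro: continuous_on_subset\<close>)
    then obtain B where B: "B > 0" "\<And>x. x \<in> cball 0 R \<Longrightarrow> \<bar>u' x\<bar> \<le> B"
      by (auto dest!: compact_imp_bounded simp: bounded_pos)
    have "\<bar>u' x\<bar> \<le> B" for x
    proof (cases "x \<in> cball 0 R")
      case False
      then have "x \<notin> K" using R by blast
      then show ?thesis using u'K B by simp
    qed (use B in blast)
    with B(1) show ?thesis using that by blast
  qed
  have [measurable]: "u \<in> borel_measurable borel" "u' \<in> borel_measurable borel"
    using u u' by (auto intro: borel_measurable_continuous_onI)
  have der_t: "((\<lambda>t. u (x + t *\<^sub>R v)) has_real_derivative u' (x + t *\<^sub>R v)) (at t)" for x t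
  proof -
    have "((\<lambda>s. u ((x + t *\<^sub>R v) + s *\<^sub>R v)) has_real_derivative u' (x + t *\<^sub>R v)) (at 0)"
      by (rule der)
    then have "((\<lambda>s. u (x + (t + s) *\<^sub>R v)) has_real_derivative u' (x + t *\<^sub>R v)) (at 0)"
      by (simp add: algebra_simps)
    then show ?thesis
      using DERIV_shift[of "\<lambda>t. u (x + t *\<^sub>R v)" "u' (x + t *\<^sub>R v)" 0 t] by (simp add: add.commute)
  qed
  define d where "d n x = real (Suc n) * (u (x + (1 / real (Suc n)) *\<^sub>R v) - u x)" for n x
  \<comment> \<open>The steps 1 / (n + 1) are at most 1, so every difference quotient vanishes
    farther than R + norm v from the origin; inside, the mean value theorem bounds it by B. One
    majorant serves all n.\<close>
  have d_bound: "\<bar>d n x\<bar> \<le> B * indicator (cball 0 (R + norm v)) x" for n x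
  proof -
    define h where "h = 1 / real (Suc n)"
    have h: "0 < h" "h \<le> 1" by (auto simp: h_def)
    obtain z where "u (x + h *\<^sub>R v) - u (x + 0 *\<^sub>R v) = (h - 0) * u' (x + z *\<^sub>R v)"
      using MVT2[of 0 h "\<lambda>t. u (x + t *\<^sub>R v)" "\<lambda>t. u' (x + t *\<^sub>R v)"] der_t h by auto
    then have "d n x = u' (x + z *\<^sub>R v)"
      using h(1) by (simp add: d_def h_def field_simps)
    then have le: "\<bar>d n x\<bar> \<le> B" using B by simp
    show ?thesis
    proof (cases "x \<in> cball 0 (R + norm v)")
      case False
      then have x: "norm x > R + norm v" by auto
      have "norm (h *\<^sub>R v) \<le> norm v" using h by (simp add: mult_left_le_one_le)
      moreover have "norm x \<le> norm (x + h *\<^sub>R v) + norm (h *\<^sub>R v)"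
        by (metis add_diff_cancel norm_triangle_ineq4)
      ultimately have "norm (x + h *\<^sub>R v) > R" using x by linarith
      moreover have "norm x > R" using x norm_ge_zero[of v] by linarith
      ultimately have "x + h *\<^sub>R v \<notin> K" "x \<notin> K" using R by force+
      then have "d n x = 0" using uK by (simp add: d_def h_def)
      then show ?thesis using False by simp
    qed (use le in simp)
  qed
    obtain A where A: "\<And>x. x \<in> cball 0 R \<Longrightarrow> \<bar>u x\<bar> \<le> A"
    proof -
      have "compact (u ` cball 0 R)"
        by (intro compact_continuous_image compact_cball) (use u in \<open>auto intro: continuous_on_subset\<close>)
      then obtain A where "\<forall>x\<in>cball 0 R. \<bar>u x\<bar> \<le> A" by (auto dest!: compact_imp_bounded simp: bounded_iff)
      then show ?thesis using that by blast
    qed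
  have int_u: "integrable lborel u"
  proof (rule Bochner_Integration.integrable_bound)
    show "integrable lborel (\<lambda>x. \<bar>A\<bar> * indicator (cball 0 R) x :: real)"
      using emeasure_bounded_finite[OF bounded_cball]
      by (intro integrable_mult_right integrable_real_indicator) auto
    show "AE x in lborel. norm (u x) \<le> norm (\<bar>A\<bar> * indicator (cball 0 R) x)"
    proof (intro AE_I2)
      fix x show "norm (u x) \<le> norm (\<bar>A\<bar> * indicator (cball 0 R) x)"
        using A[of x] uK[of x] subsetD[OF R, of x] by (cases "x \<in> cball 0 R") (auto simp: indicator_def)
    qed
  qed simp
  have shift: "integrable lborel (\<lambda>x. u (x + c)) \<and> (LINT x|lborel. u (x + c)) = (LINT x|lborel. u x)" for c
  proof -
    have "integrable (distr lborel borel ((+) c)) u"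
      using int_u by (simp add: lborel_distr_plus)
    then have "integrable lborel (\<lambda>x. u (c + x))"
      by (subst (asm) integrable_distr_eq) auto
    moreover have "(LINT x|distr lborel borel ((+) c). u x) = (LINT x|lborel. u (c + x))"
      by (rule integral_distr) auto
    ultimately show ?thesis
      by (simp add: lborel_distr_plus add.commute)
  qed
  have d0: "(LINT x|lborel. d n x) = 0" for n
    unfolding d_def using shift int_u by simp
  have "(\<lambda>n. LINT x|lborel. d n x) \<longlonglongrightarrow> (LINT x|lborel. u' x)"
  proof (rule integral_dominated_convergence)
    show "integrable lborel (\<lambda>x. B * indicator (cball 0 (R + norm v)) x :: real)"
      using emeasure_bounded_finite[OF bounded_cball]
      by (intro integrable_mult_right integrable_real_indicator) auto
    show "AE x in lborel. norm (d n x) \<le> B * indicator (cball 0 (R + norm v)) x" for n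
      using d_bound by auto
    show "AE x in lborel. (\<lambda>n. d n x) \<longlonglongrightarrow> u' x"
    proof (intro AE_I2)
      fix x
      have "((\<lambda>h. (u (x + h *\<^sub>R v) - u x) / h) \<longlongrightarrow> u' x) (at 0)"
        using der[of x] by (simp add: DERIV_def)
      moreover have "filterlim (\<lambda>n. 1 / real (Suc n)) (at 0) sequentially"
        using LIMSEQ_inverse_real_of_nat by (auto simp: filterlim_at inverse_eq_divide)
      ultimately have "((\<lambda>n. (u (x + (1 / real (Suc n)) *\<^sub>R v) - u x) / (1 / real (Suc n))) \<longlongrightarrow> u' x) sequentially"
        by (rule filterlim_compose)
      then show "(\<lambda>n. d n x) \<longlonglongrightarrow> u' x"
        by (simp add: d_def mult.commute)
    qed
  qed (auto simp: d_def)
  then show ?thesis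
    using d0 by (simp add: LIMSEQ_const_iff)
qed

text \<open>Continuity is local, and S together with the complement of K is an open cover of the
  space; on the second set the function is constantly 0.\<close>

lemma continuous_on_extend_by_zero:
  fixes f :: "'a::topological_space \<Rightarrow> real"
  assumes "open S" "closed K" "K \<subseteq> S" "continuous_on S f" "\<And>x. x \<in> S - K \<Longrightarrow> f x = 0"
  shows "continuous_on UNIV (\<lambda>x. if x \<in> S then f x else 0)"
proof -
  have "continuous_on (S \<union> - K) (\<lambda>x. if x \<in> S then f x else 0)"
  proof (rule continuous_on_open_Un)
    show "continuous_on S (\<lambda>x. if x \<in> S then f x else 0)"
      using assms(4) by (rule continuous_on_eq) auto
    show "continuous_on (- K) (\<lambda>x. if x \<in> S then f x else 0)"
      by (rule continuous_on_eq[OF continuous_on_const[of _ 0]]) (use assms(5) in auto)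
  qed (use assms in auto)
  moreover have "S \<union> - K = UNIV" using assms(3) by auto
  ultimately show ?thesis by simp
qed

text \<open>The Sobolev notions integrate over \<open>lebesgue_on S\<close>, while translations act
  on \<open>lborel\<close>; extension by zero moves compactly supported integrands from one to the
  other.\<close>

lemma LINT_lebesgue_on_continuous:
  fixes f :: "'a::euclidean_space \<Rightarrow> real"
  assumes "open S" "compact K" "K \<subseteq> S" "continuous_on S f" "\<And>x. x \<in> S - K \<Longrightarrow> f x = 0"
  shows "integrable (lebesgue_on S) f"
    and "(LINT x|lebesgue_on S. f x) = (LINT x|lborel. (if x \<in> S then f x else 0))"
proof -
  let ?g = "\<lambda>x. if x \<in> S then f x else 0"
  have c: "continuous_on UNIV ?g"
    using continuous_on_extend_by_zero[OF assms(1) compact_imp_closed[OF assms(2)] assms(3-5)] by auto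
  then have [measurable]: "?g \<in> borel_measurable lborel"
    by (auto intro: borel_measurable_continuous_onI)
  obtain A where A: "\<And>x. x \<in> K \<Longrightarrow> \<bar>f x\<bar> \<le> A"
  proof -
    have "compact (f ` K)"
      by (intro compact_continuous_image assms) (use assms in \<open>auto intro: continuous_on_subset\<close>)
    then obtain A where "\<forall>x\<in>K. \<bar>f x\<bar> \<le> A" by (auto dest!: compact_imp_bounded simp: bounded_iff)
    then show ?thesis using that by blast
  qed
  have int: "integrable lborel ?g"
  proof (rule Bochner_Integration.integrable_bound)
    show "integrable lborel (\<lambda>x. \<bar>A\<bar> * indicator K x :: real)"
      using emeasure_bounded_finite[OF compact_imp_bounded[OF assms(2)]] compact_imp_closed[OF assms(2)]
      by (intro integrable_mult_right integrable_real_indicator) (auto intro: borel_closed)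
    show "AE x in lborel. norm (?g x) \<le> norm (\<bar>A\<bar> * indicator K x)"
    proof (intro AE_I2)
      fix x show "norm (?g x) \<le> norm (\<bar>A\<bar> * indicator K x)"
        using A[of x] assms(5)[of x] by (cases "x \<in> K") (auto simp: indicator_def)
    qed
  qed simp
  have i: "(\<lambda>x. indicator S x *\<^sub>R f x) = ?g"
    by (auto simp: indicator_def)
  have S: "S \<inter> space lebesgue \<in> sets lebesgue"
    using assms(1) by simp
  show "integrable (lebesgue_on S) f"
    unfolding integrable_restrict_space[OF S] i
    using int by (simp add: integrable_completion)
  show "(LINT x|lebesgue_on S. f x) = (LINT x|lborel. (if x \<in> S then f x else 0))"
    unfolding integral_restrict_space[OF S] i
    by (rule integral_completion) simp
qed

text \<open>The product of f and \<phi>, extended by zero, has compact support, so its directional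
  derivative integrates to zero, and the product rule separates the two terms.\<close>

lemma integral_by_parts_open:
  fixes f f' \<phi> \<phi>' :: "real ^ 'd::finite \<Rightarrow> real"
  assumes S: "open S" and K: "compact K" "K \<subseteq> S"
    and f: "continuous_on S f" "continuous_on S f'"
    and \<phi>: "continuous_on UNIV \<phi>" "continuous_on UNIV \<phi>'"
    and df: "\<And>x. x \<in> S \<Longrightarrow> ((\<lambda>t. f (x + t *\<^sub>R v)) has_real_derivative f' x) (at 0)"
    and d\<phi>: "\<And>x. ((\<lambda>t. \<phi> (x + t *\<^sub>R v)) has_real_derivative \<phi>' x) (at 0)"
    and z: "\<And>x. x \<notin> K \<Longrightarrow> \<phi> x = 0"
  shows "(LINT x|lebesgue_on S. f x * \<phi>' x) = - (LINT x|lebesgue_on S. f' x * \<phi> x)"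
proof -
  have cK: "closed K" using K by (simp add: compact_imp_closed)
  have z': "\<phi>' x = 0" if "x \<notin> K" for x
  proof -
    have "((\<lambda>t. 0) has_real_derivative \<phi>' x) (at 0)"
      using has_real_derivative_cong_line[of "- K" x \<phi> "\<lambda>_. 0" v "\<phi>' x"] d\<phi>[of x] that z cK
      by (auto simp: open_Compl)
    then show ?thesis using DERIV_unique DERIV_const by blast
  qed
  note c\<phi> = continuous_on_subset[OF \<phi>(1) subset_UNIV] continuous_on_subset[OF \<phi>(2) subset_UNIV]
  have i1: "integrable (lebesgue_on S) (\<lambda>x. f x * \<phi>' x)"
    by (rule LINT_lebesgue_on_continuous[OF S K]) (auto simp: z' intro!: continuous_on_mult f c\<phi>)
  have i2: "integrable (lebesgue_on S) (\<lambda>x. f' x * \<phi> x)"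
    by (rule LINT_lebesgue_on_continuous[OF S K]) (auto simp: z intro!: continuous_on_mult f c\<phi>)
  let ?u = "\<lambda>x. if x \<in> S then f x * \<phi> x else 0"
  let ?u' = "\<lambda>x. if x \<in> S then f x * \<phi>' x + f' x * \<phi> x else 0"
  have "(LINT x|lborel. ?u' x) = 0"
  proof (rule integral_directional_deriv_eq_0)
    show "continuous_on UNIV ?u" "continuous_on UNIV ?u'"
      by (rule continuous_on_extend_by_zero[OF S cK K(2)]; auto simp: z z' intro!: continuous_on_add continuous_on_mult f c\<phi>)+
    show "bounded K" using K by (simp add: compact_imp_bounded)
    show "((\<lambda>t. ?u (x + t *\<^sub>R v)) has_real_derivative ?u' x) (at 0)" for x
    proof (cases "x \<in> S")
      case True
      have "((\<lambda>t. f (x + t *\<^sub>R v) * \<phi> (x + t *\<^sub>R v)) has_real_derivative f x * \<phi>' x + f' x * \<phi> x) (at 0)"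
        using df[OF True] d\<phi>[of x] by (auto intro!: derivative_eq_intros)
      then show ?thesis
        using has_real_derivative_cong_line[OF S True, of ?u "\<lambda>x. f x * \<phi> x" v] True by simp
    next
      case False
      then have "x \<in> - K" using K by auto
      then have "((\<lambda>t. ?u (x + t *\<^sub>R v)) has_real_derivative 0) (at 0)"
        using z cK by (subst has_real_derivative_cong_line[of "- K" x ?u "\<lambda>x. 0" v 0]) auto
      then show ?thesis using False by simp
    qed
  qed (use z z' in auto)
  moreover have "(LINT x|lebesgue_on S. f x * \<phi>' x + f' x * \<phi> x) = (LINT x|lborel. ?u' x)"
    by (rule LINT_lebesgue_on_continuous[OF S K]) (auto simp: z z' intro!: continuous_on_add continuous_on_mult f c\<phi>)
  ultimately show ?thesis using i1 i2 by simp
qed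

lemma test_function_props:
  assumes "\<phi> \<in> test_functions S"
  obtains K where "compact K" "K \<subseteq> S" "\<And>x \<alpha>. x \<notin> K \<Longrightarrow> cderiv \<alpha> \<phi> x = 0"
    "\<And>\<alpha>. continuous_on UNIV (cderiv \<alpha> \<phi>)"
    "\<And>\<alpha> i x. ((\<lambda>t. cderiv \<alpha> \<phi> (x + t *\<^sub>R axis i 1)) has_real_derivative cderiv (\<alpha> + axis i 1) \<phi> x) (at 0)"
proof -
  obtain K where K: "compact K" "K \<subseteq> S" "\<And>x. x \<notin> K \<Longrightarrow> \<phi> x = 0"
    and Ck: "\<And>k. \<phi> \<in> Ck k UNIV"
    using assms by (auto simp: test_functions_def)
  show ?thesis
  proof
    show "cderiv \<alpha> \<phi> x = 0" if "x \<notin> K" for x \<alpha>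
      using cderiv_cong_open[of "- K" \<phi> "\<lambda>_. 0" x \<alpha>] K that by (auto simp: cderiv_zero compact_imp_closed open_Compl)
    show "continuous_on UNIV (cderiv \<alpha> \<phi>)" for \<alpha>
      using Ck[of "mi_order \<alpha>"] by (auto simp: Ck_def)
    show "((\<lambda>t. cderiv \<alpha> \<phi> (x + t *\<^sub>R axis i 1)) has_real_derivative cderiv (\<alpha> + axis i 1) \<phi> x) (at 0)" for \<alpha> i x
      using Ck[of "Suc (mi_order \<alpha>)"] by (auto simp: Ck_def derivs_exist_on_def)
  qed (use K in auto)
qed

lemma Ck_has_weak_deriv:
  fixes f :: "real ^ 'd::finite \<Rightarrow> real"
  assumes S: "open S" and f: "f \<in> Ck k S" and "mi_order \<alpha> \<le> k"
  shows "has_weak_deriv S \<alpha> f (cderiv \<alpha> f)"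
  unfolding has_weak_deriv_def
proof
  fix \<phi> assume "\<phi> \<in> test_functions S"
  then obtain K where K: "compact K" "K \<subseteq> S" "\<And>x \<alpha>. x \<notin> K \<Longrightarrow> cderiv \<alpha> \<phi> x = 0"
    "\<And>\<alpha>. continuous_on UNIV (cderiv \<alpha> \<phi>)"
    "\<And>\<alpha> i x. ((\<lambda>t. cderiv \<alpha> \<phi> (x + t *\<^sub>R axis i 1)) has_real_derivative cderiv (\<alpha> + axis i 1) \<phi> x) (at 0)"
    by (rule test_function_props) blast
  \<comment> \<open>One derivative is moved at a time. The index \<gamma> that stays on the test
    function must be arbitrary, because the induction hypothesis is applied with
    \<open>\<gamma> + axis i 1\<close> in its place.\<close>
  have "mi_order \<beta> = n \<Longrightarrow> n \<le> k \<Longrightarrow>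
    (LINT x|lebesgue_on S. f x * cderiv (\<beta> + \<gamma>) \<phi> x) = (- 1) ^ mi_order \<beta> * (LINT x|lebesgue_on S. cderiv \<beta> f x * cderiv \<gamma> \<phi> x)"
    for \<beta> \<gamma> n
  proof (induction n arbitrary: \<beta> \<gamma>)
    case 0
    then have "\<beta> = 0" by (simp add: mi_order_def vec_eq_iff)
    then show ?case by simp
  next
    case (Suc n)
    then obtain \<delta> i where \<beta>: "\<beta> = \<delta> + axis i 1" "mi_order \<delta> = n"
      using mi_cases_axis by blast
    have "(LINT x|lebesgue_on S. f x * cderiv (\<beta> + \<gamma>) \<phi> x) = (LINT x|lebesgue_on S. f x * cderiv (\<delta> + (\<gamma> + axis i 1)) \<phi> x)"
      by (simp add: \<beta> add_ac)
    also have "\<dots> = (- 1) ^ n * (LINT x|lebesgue_on S. cderiv \<delta> f x * cderiv (\<gamma> + axis i 1) \<phi> x)"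
      using Suc \<beta> by simp
    also have "(LINT x|lebesgue_on S. cderiv \<delta> f x * cderiv (\<gamma> + axis i 1) \<phi> x) =
       - (LINT x|lebesgue_on S. cderiv (\<delta> + axis i 1) f x * cderiv \<gamma> \<phi> x)"
      by (rule integral_by_parts_open[OF S K(1,2), where v = "axis i 1"])
         (use f Suc.prems \<beta> K in \<open>auto simp: Ck_def derivs_exist_on_def mi_order_add\<close>)
    finally show ?case using \<beta> by (simp add: mi_order_add)
  qed
  from this[of \<alpha> "mi_order \<alpha>" 0] show "(LINT x|lebesgue_on S. f x * cderiv \<alpha> \<phi> x) =
         (- 1) ^ mi_order \<alpha> * (LINT x|lebesgue_on S. cderiv \<alpha> f x * \<phi> x)"
    using assms(3) by simp
qed

lemma borel_measurable_test_function:
  assumes "\<phi> \<in> test_functions S"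
  shows "\<phi> \<in> borel_measurable borel"
proof -
  have "\<phi> \<in> Ck 0 UNIV" using assms by (auto simp: test_functions_def)
  then have "continuous_on UNIV (cderiv 0 \<phi>)" unfolding Ck_def by (auto simp del: cderiv_0)
  then show ?thesis by (auto intro: borel_measurable_continuous_onI)
qed

text \<open>Boxes generate the Borel sets and are stable under intersection, so the zero integrals
  spread to all Borel sets by Dynkin induction; the integral over the whole space supplies the step
  to complements.\<close>

lemma AE_zero_boxes:
  fixes h :: "'a::euclidean_space \<Rightarrow> real"
  assumes h: "integrable lborel h" and b: "\<And>c d. (LINT x:box c d|lborel. h x) = 0"
    and U: "(LINT x|lborel. h x) = 0"
  shows "AE x in lborel. h x = 0"
proof (rule sigma_finite_measure.density_zero[OF sigma_finite_lborel h])
  fix A :: "'a set" assume "A \<in> sets lborel"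
  define \<G> where "\<G> = range (\<lambda>(a, b). box a b :: 'a set)"
  have bs: "sets borel = sigma_sets UNIV \<G>"
    by (subst borel_eq_box) (simp add: \<G>_def)
  have A: "A \<in> sigma_sets UNIV \<G>"
    using \<open>A \<in> sets lborel\<close> by (simp add: bs)
  have si: "set_integrable lborel B h" if "B \<in> sigma_sets UNIV \<G>" for B
  proof -
    have "B \<in> sets borel" using that by (simp add: bs)
    then show ?thesis
      unfolding set_integrable_def using integrable_mult_indicator[OF _ h] by simp
  qed
  have sb: "B \<in> sets lborel" if "B \<in> sigma_sets UNIV \<G>" for B
    using that by (simp add: bs)
  have "Int_stable \<G>"
    by (auto simp: Int_stable_def \<G>_def Int_interval[symmetric] box_Int_box)
  moreover have "\<G> \<subseteq> Pow UNIV" by simp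
  ultimately show "set_lebesgue_integral lborel A h = 0"
    using A
  proof (induction rule: sigma_sets_induct_disjoint)
    case (basic B)
    then show ?case using b by (auto simp: \<G>_def)
  next
    case empty
    then show ?case by (simp add: set_lebesgue_integral_def)
  next
    case (compl B)
    have "(LINT x:UNIV|lborel. h x) = (LINT x:B|lborel. h x) + (LINT x:UNIV - B|lborel. h x)"
      using set_integral_Un[of B "UNIV - B" lborel h] si[OF compl(1)] si[OF sigma_sets.Compl[OF compl(1)]] by simp
    then show ?case using U compl(2) by (simp add: set_lebesgue_integral_def)
  next
    case (union B)
    have "(LINT x:(\<Union>i. B i)|lborel. h x) = (\<Sum>i. LINT x:B i|lborel. h x)"
    proof (rule lebesgue_integral_countable_add)
      have B: "B i \<in> sigma_sets UNIV \<G>" for i using union(2) by blast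
      show "B i \<in> sets lborel" for i using sb[OF B] .
      show "B i \<inter> B j = {}" if "i \<noteq> j" for i j
        using union(1) that by (auto simp: disjoint_family_on_def)
      show "set_integrable lborel (\<Union>i. B i) h"
        by (intro si sigma_sets.Union B)
    qed
    then show ?case using union by simp
  qed
qed

text \<open>Bumps on a box tend to its indicator, so g integrates to zero over every box whose
  closure lies in S, and hence vanishes almost everywhere on each of countably many closed boxes
  that fill S.\<close>

lemma fundamental_lemma:
  fixes g :: "real ^ 'd::finite \<Rightarrow> real"
  assumes S: "open S" and int: "integrable (lebesgue_on S) g"
    and z: "\<And>\<phi>. \<phi> \<in> test_functions S \<Longrightarrow> (LINT x|lebesgue_on S. g x * \<phi> x) = 0"
  shows "AE x in lebesgue_on S. g x = 0"
proof -
  have S': "S \<inter> space lebesgue \<in> sets lebesgue" using S by simp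
  define G where "G x = indicator S x *\<^sub>R g x" for x
  have G: "integrable lebesgue G"
    using int unfolding integrable_restrict_space[OF S'] G_def .
  \<comment> \<open>g is only Lebesgue measurable; the argument with boxes takes place in
    \<open>lborel\<close> and therefore uses a Borel version of its extension by zero.\<close>
  obtain G' where [measurable]: "G' \<in> borel_measurable lborel" and "AE x in lborel. G x = G' x"
    using completion_ex_borel_measurable_real[of G lborel] G by auto
  then have GG: "AE x in lebesgue. G x = G' x" by (simp add: AE_completion)
  have "G' \<in> borel_measurable lebesgue" by (simp add: measurable_completion)
  then have "integrable lebesgue G'"
    using G GG integrable_cong_AE[of G lebesgue G'] by auto
  then have G': "integrable lborel G'" by (simp add: integrable_completion)
  have z': "(LINT x|lborel. G' x * \<phi> x) = 0" if "\<phi> \<in> test_functions S" for \<phi>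
  proof -
    note [measurable] = borel_measurable_test_function[OF that]
    have \<phi>l: "\<phi> \<in> borel_measurable lebesgue" by (simp add: measurable_completion)
    have "(LINT x|lborel. G' x * \<phi> x) = (LINT x|lebesgue. G' x * \<phi> x)"
      by (rule integral_completion[symmetric]) simp
    also have "\<dots> = (LINT x|lebesgue. G x * \<phi> x)"
    proof (rule integral_cong_AE)
      show "(\<lambda>x. G' x * \<phi> x) \<in> borel_measurable lebesgue" by (simp add: measurable_completion)
      show "(\<lambda>x. G x * \<phi> x) \<in> borel_measurable lebesgue" using G \<phi>l by auto
      show "AE x in lebesgue. G' x * \<phi> x = G x * \<phi> x" using GG by auto
    qed
    also have "\<dots> = (LINT x|lebesgue_on S. g x * \<phi> x)"
      unfolding integral_restrict_space[OF S'] by (simp add: G_def mult.assoc)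
    also have "\<dots> = 0" by (rule z[OF that])
    finally show ?thesis .
  qed
  have box0: "(LINT x|lborel. indicator (box a b) x * G' x) = 0" if "cbox a b \<subseteq> S \<or> box a b = {}" for a b
  proof (cases "box a b = {}")
    case False
    then have lt: "a $ i < b $ i" for i by (simp add: interval_ne_empty_cart)
    have "(\<lambda>n. LINT x|lborel. G' x * box_bump (1 / real (Suc n)) a b x) \<longlonglongrightarrow> (LINT x|lborel. indicator (box a b) x * G' x)"
    proof (rule integral_dominated_convergence)
      show "integrable lborel (\<lambda>x. \<bar>G' x\<bar>)" using G' by simp
      show "(\<lambda>x. G' x * box_bump (1 / real (Suc n)) a b x) \<in> borel_measurable lborel" for n
        using borel_measurable_test_function[OF box_bump_test_function[of "1 / real (Suc n)" a b S]] that False lt by simp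
      show "AE x in lborel. (\<lambda>n. G' x * box_bump (1 / real (Suc n)) a b x) \<longlonglongrightarrow> indicator (box a b) x * G' x"
        using tendsto_mult[OF tendsto_const box_bump_tendsto[OF lt]] by (simp add: mult.commute)
      show "AE x in lborel. norm (G' x * box_bump (1 / real (Suc n)) a b x) \<le> \<bar>G' x\<bar>" for n
        using box_bump_bounds[of "1 / real (Suc n)" a b] by (auto simp: abs_mult intro!: mult_left_le)
    qed simp
    moreover have "(LINT x|lborel. G' x * box_bump (1 / real (Suc n)) a b x) = 0" for n
      by (rule z'[OF box_bump_test_function]) (use that False lt in auto)
    ultimately show ?thesis by (simp add: LIMSEQ_const_iff)
  qed simp
  have AE_box: "AE x in lebesgue. x \<in> cbox a b \<longrightarrow> G' x = 0" if ab: "cbox a b \<subseteq> S" for a b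
  proof -
    have "AE x in lborel. indicator (box a b) x * G' x = 0"
    proof (rule AE_zero_boxes)
      show "integrable lborel (\<lambda>x. indicator (box a b) x * G' x)"
        using integrable_mult_indicator[of "box a b" lborel G'] G' by simp
      show "(LINT x|lborel. indicator (box a b) x * G' x) = 0"
        by (rule box0) (use ab in auto)
      fix c d :: "real ^ 'd"
      \<comment> \<open>Two boxes meet in the box with componentwise maximum and minimum as corners,
        and the closed version of it stays inside S.\<close>
      define c' d' where "c' = (\<chi> i. max (a $ i) (c $ i))" and "d' = (\<chi> i. min (b $ i) (d $ i))"
      have "box c d \<inter> box a b = box c' d'"
        by (auto simp: mem_box_cart c'_def d'_def)
      then have "(LINT x:box c d|lborel. indicator (box a b) x * G' x) = (LINT x|lborel. indicator (box c' d') x * G' x)"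
        unfolding set_lebesgue_integral_def by (simp add: indicator_inter_arith[symmetric] flip: mult.assoc)
      moreover have "cbox c' d' \<subseteq> cbox a b"
        by (auto simp: mem_box_cart c'_def d'_def)
      ultimately show "(LINT x:box c d|lborel. indicator (box a b) x * G' x) = 0"
        using box0[of c' d'] ab by auto
    qed
    then have 1: "AE x in lebesgue. indicator (box a b) x * G' x = 0" by (simp add: AE_completion)
    \<comment> \<open>Open boxes were tested; the boundary is negligible, which extends the
      conclusion to the closed boxes of the covering.\<close>
    have "cbox a b - box a b \<in> null_sets lebesgue"
      using negligible_frontier_interval[of a b] by (simp add: negligible_iff_null_sets)
    then have "AE x in lebesgue. x \<notin> cbox a b - box a b" by (rule AE_not_in)
    with 1 show ?thesis by eventually_elim (auto simp: indicator_def)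
  qed
  obtain \<D> where \<D>: "countable \<D>" "\<D> \<subseteq> Pow S" "\<And>X. X \<in> \<D> \<Longrightarrow> \<exists>a b. X = cbox a b" "\<Union>\<D> = S"
    by (rule open_countable_Union_open_cbox[OF S]) blast
  have "AE x in lebesgue. x \<in> X \<longrightarrow> G' x = 0" if X: "X \<in> \<D>" for X
  proof -
    obtain a b where ab: "X = cbox a b" using \<D>(3)[OF X] by blast
    then have "cbox a b \<subseteq> S" using \<D>(2) X by blast
    from AE_box[OF this] show ?thesis unfolding ab .
  qed
  then have "AE x in lebesgue. \<forall>X\<in>\<D>. x \<in> X \<longrightarrow> G' x = 0"
    by (subst AE_ball_countable[OF \<D>(1)]) blast
  with GG have "AE x in lebesgue. x \<in> S \<longrightarrow> g x = 0"
  proof eventually_elim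
    case (elim x)
    show ?case
    proof
      assume "x \<in> S"
      then have "G' x = 0" using elim(2) \<D>(4) by blast
      then show "g x = 0" using elim(1) \<open>x \<in> S\<close> by (simp add: G_def)
    qed
  qed
  then show ?thesis using S' by (simp add: AE_restrict_space_iff)
qed

section \<open>Square integrable functions\<close>

text \<open>Formulated for any measure, as the same facts are used on \<Theta>, on the space of
  jets, on the probability space and on the product of the last two. Elements are functions, so null
  functions have to be carried along.\<close>

definition l2 :: "'a measure \<Rightarrow> ('a \<Rightarrow> real) set" where
  "l2 N = {f \<in> borel_measurable N. integrable N (\<lambda>x. (f x)\<^sup>2)}"

lemma L2_eq_l2: "L2 S = l2 (lebesgue_on S)"
  by (simp add: L2_def l2_def)

lemma l2_integrable_mult:
  assumes "f \<in> l2 N" "g \<in> l2 N"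
  shows "integrable N (\<lambda>x. f x * g x)"
proof (rule Bochner_Integration.integrable_bound)
  show "integrable N (\<lambda>x. (f x)\<^sup>2 + (g x)\<^sup>2)" using assms by (simp add: l2_def)
  show "(\<lambda>x. f x * g x) \<in> borel_measurable N" using assms by (auto simp: l2_def)
  have "\<bar>a * b\<bar> \<le> a\<^sup>2 + b\<^sup>2" for a b :: real
  proof -
    have "2 * (\<bar>a\<bar> * \<bar>b\<bar>) \<le> a\<^sup>2 + b\<^sup>2"
      using sum_squares_bound[of "\<bar>a\<bar>" "\<bar>b\<bar>"] by (simp add: mult.assoc)
    moreover have "0 \<le> \<bar>a\<bar> * \<bar>b\<bar>" by simp
    ultimately show ?thesis unfolding abs_mult by linarith
  qed
  then show "AE x in N. norm (f x * g x) \<le> norm ((f x)\<^sup>2 + (g x)\<^sup>2)" by auto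
qed

lemma l2_add_scale:
  assumes "f \<in> l2 N" "g \<in> l2 N"
  shows "(\<lambda>x. f x + c * g x) \<in> l2 N"
proof -
  have "(f x + c * g x)\<^sup>2 = (f x)\<^sup>2 + 2 * c * (f x * g x) + c\<^sup>2 * (g x)\<^sup>2" for x
    by (simp add: power2_eq_square algebra_simps)
  then show ?thesis
    using assms l2_integrable_mult[OF assms] by (auto simp: l2_def)
qed

lemma l2_zero: "(\<lambda>_. 0) \<in> l2 N"
  by (simp add: l2_def)

lemma l2_scale: "f \<in> l2 N \<Longrightarrow> (\<lambda>x. c * f x) \<in> l2 N"
  using l2_add_scale[OF l2_zero, of f N c] by simp

lemma l2_sum:
  assumes "\<And>j. j \<in> F \<Longrightarrow> f j \<in> l2 N"
  shows "(\<lambda>x. \<Sum>j\<in>F. c j * f j x) \<in> l2 N"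
  using assms
proof (induction F rule: infinite_finite_induct)
  case (insert a F)
  have "(\<lambda>x. (\<Sum>j\<in>F. c j * f j x) + c a * f a x) \<in> l2 N"
    by (rule l2_add_scale) (use insert in auto)
  then show ?case using insert by (simp add: add.commute)
qed (simp_all add: l2_zero)

lemma l2_diff_sum:
  assumes "f \<in> l2 N" "\<And>j. j \<in> F \<Longrightarrow> g j \<in> l2 N"
  shows "(\<lambda>x. f x - (\<Sum>j\<in>F. c j * g j x)) \<in> l2 N"
proof -
  have "(\<lambda>x. f x + (- 1) * (\<Sum>j\<in>F. c j * g j x)) \<in> l2 N"
    by (intro l2_add_scale l2_sum assms)
  then show ?thesis by simp
qed

text \<open>The discriminant of a non-negative quadratic polynomial. It is stated abstractly because
  it serves the L2 inner product and, later, the semidefinite form of an operator.\<close>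

lemma quadratic_form_cauchy_schwarz:
  fixes a b c :: real
  assumes "\<And>t. 0 \<le> a + 2 * t * b + t\<^sup>2 * c" "0 \<le> c"
  shows "b\<^sup>2 \<le> a * c"
proof (cases "c = 0")
  case True
  have "b = 0"
  proof (rule ccontr)
    assume "b \<noteq> 0"
    then show False
      \<comment> \<open>At this t the polynomial, now linear, takes the value -1.\<close>
      using assms(1)[of "- (a + 1) / (2 * b)"] True by (simp add: field_simps)
  qed
  then show ?thesis using True by simp
next
  case False
  then have "c > 0" using assms by simp
  moreover have "0 \<le> a - b\<^sup>2 / c"
    using assms(1)[of "- b / c"] False by (simp add: power2_eq_square field_simps)
  ultimately show ?thesis by (simp add: field_simps)
qed

lemma l2_cauchy_schwarz:
  assumes "f \<in> l2 N" "g \<in> l2 N"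
  shows "(LINT x|N. f x * g x)\<^sup>2 \<le> (LINT x|N. (f x)\<^sup>2) * (LINT x|N. (g x)\<^sup>2)"
proof (rule quadratic_form_cauchy_schwarz)
  fix t :: real
  have "(f x + t * g x)\<^sup>2 = (f x)\<^sup>2 + 2 * t * (f x * g x) + t\<^sup>2 * (g x)\<^sup>2" for x
    by (simp add: power2_eq_square algebra_simps)
  then have "(LINT x|N. (f x + t * g x)\<^sup>2) = (LINT x|N. (f x)\<^sup>2) + 2 * t * (LINT x|N. f x * g x) + t\<^sup>2 * (LINT x|N. (g x)\<^sup>2)"
    using assms l2_integrable_mult[OF assms] by (simp add: l2_def)
  moreover have "0 \<le> (LINT x|N. (f x + t * g x)\<^sup>2)" by simp
  ultimately show "0 \<le> (LINT x|N. (f x)\<^sup>2) + 2 * t * (LINT x|N. f x * g x) + t\<^sup>2 * (LINT x|N. (g x)\<^sup>2)"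
    by simp
qed simp

lemma l2_bounded:
  assumes "finite_measure N" "f \<in> borel_measurable N" "\<And>x. x \<in> space N \<Longrightarrow> \<bar>f x\<bar> \<le> B"
  shows "f \<in> l2 N"
proof -
  interpret finite_measure N by fact
  have "(f x)\<^sup>2 \<le> B\<^sup>2" if "x \<in> space N" for x
    using power_mono[OF assms(3)[OF that], of 2] by simp
  then have "integrable N (\<lambda>x. (f x)\<^sup>2)"
    by (intro integrable_const_bound[where B = "B\<^sup>2"]) (use assms(2) in auto)
  then show ?thesis using assms by (simp add: l2_def)
qed

lemma (in finite_measure) l2_integrable: "f \<in> l2 M \<Longrightarrow> integrable M f"
  using l2_integrable_mult[of f M "\<lambda>_. 1"] l2_bounded[of M "\<lambda>_. 1" 1]
  by (simp add: finite_measure_axioms)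

lemma l2_cong_AE:
  assumes "f \<in> l2 N" "g \<in> borel_measurable N" "AE x in N. f x = g x"
  shows "g \<in> l2 N"
proof -
  have "integrable N (\<lambda>x. (g x)\<^sup>2)"
    by (subst integrable_cong_AE[of _ _ "\<lambda>x. (f x)\<^sup>2"]) (use assms in \<open>auto simp: l2_def\<close>)
  then show ?thesis using assms by (simp add: l2_def)
qed

text \<open>Dominated convergence for the difference quotients along sequences; the mean value
  inequality turns the bound w on the derivatives into a bound on the quotients.\<close>

lemma DERIV_integral:
  fixes f f' :: "real \<Rightarrow> 'a \<Rightarrow> real"
  assumes t0: "t0 \<in> {a<..<b}"
    and int: "\<And>t. t \<in> {a<..<b} \<Longrightarrow> integrable N (f t)"
    and der: "\<And>t y. t \<in> {a<..<b} \<Longrightarrow> y \<in> space N \<Longrightarrow> ((\<lambda>t. f t y) has_real_derivative f' t y) (at t)"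
    and meas: "f' t0 \<in> borel_measurable N"
    and bd: "\<And>t y. t \<in> {a<..<b} \<Longrightarrow> y \<in> space N \<Longrightarrow> \<bar>f' t y\<bar> \<le> w y"
    and w: "integrable N w"
  shows "((\<lambda>t. LINT y|N. f t y) has_real_derivative (LINT y|N. f' t0 y)) (at t0)"
proof -
  have "((\<lambda>t. LINT y|N. f t y) has_real_derivative (LINT y|N. f' t0 y)) (at t0 within {a<..<b})"
    unfolding has_field_derivative_iff tendsto_at_iff_sequentially comp_def
  proof (intro allI impI)
    fix X :: "nat \<Rightarrow> real"
    assume X: "\<forall>i. X i \<in> {a<..<b} - {t0}" and lim: "X \<longlonglongrightarrow> t0"
    have "(\<lambda>i. LINT y|N. (f (X i) y - f t0 y) / (X i - t0)) \<longlonglongrightarrow> (LINT y|N. f' t0 y)"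
    proof (rule integral_dominated_convergence[OF meas _ w])
      show "(\<lambda>y. (f (X i) y - f t0 y) / (X i - t0)) \<in> borel_measurable N" for i
        using int[of "X i"] int[of t0] X t0 by (intro borel_measurable_divide borel_measurable_diff) auto
      show "AE y in N. (\<lambda>i. (f (X i) y - f t0 y) / (X i - t0)) \<longlonglongrightarrow> f' t0 y"
      proof (intro AE_I2)
        fix y assume y: "y \<in> space N"
        have "((\<lambda>t. (f t y - f t0 y) / (t - t0)) \<longlongrightarrow> f' t0 y) (at t0)"
          using der[OF t0 y] by (simp add: has_field_derivative_iff)
        moreover have "filterlim X (at t0) sequentially"
          using X lim by (auto simp: filterlim_at)
        ultimately show "(\<lambda>i. (f (X i) y - f t0 y) / (X i - t0)) \<longlonglongrightarrow> f' t0 y"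
          by (rule filterlim_compose)
      qed
      show "AE y in N. norm ((f (X i) y - f t0 y) / (X i - t0)) \<le> w y" for i
      proof (intro AE_I2)
        fix y assume y: "y \<in> space N"
        have Xi: "X i \<in> {a<..<b}" "X i \<noteq> t0" using X by auto
        have "norm (f (X i) y - f t0 y) \<le> w y * norm (X i - t0)"
        proof (rule field_differentiable_bound[where S = "{a<..<b}" and f' = "\<lambda>t. f' t y"])
          show "((\<lambda>t. f t y) has_field_derivative f' t y) (at t within {a<..<b})" if "t \<in> {a<..<b}" for t
            using der[OF that y] by (rule has_field_derivative_at_within)
        qed (use bd y Xi t0 in auto)
        then show "norm ((f (X i) y - f t0 y) / (X i - t0)) \<le> w y"
          using Xi by (simp add: abs_divide field_simps)
      qed
    qed
    moreover have eq: "(LINT y|N. (f (X i) y - f t0 y) / (X i - t0)) =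
       ((LINT y|N. f (X i) y) - (LINT y|N. f t0 y)) / (X i - t0)" for i
      using int[of "X i"] int[of t0] X t0 by simp
    ultimately show "(\<lambda>i. ((LINT y|N. f (X i) y) - (LINT y|N. f t0 y)) / (X i - t0)) \<longlonglongrightarrow> (LINT y|N. f' t0 y)"
      by (simp only: eq)
  qed
  then show ?thesis by (simp only: at_within_open[OF t0 open_greaterThanLessThan])
qed

section \<open>Weak derivatives\<close>

lemma finite_measure_lebesgue_on_open:
  fixes S :: "'a::euclidean_space set"
  assumes "open S" "bounded S"
  shows "finite_measure (lebesgue_on S)"
  using assms by (intro finite_measure_lebesgue_on bounded_set_imp_lmeasurable) auto

lemma test_function_L2:
  assumes "open S" "bounded S" "\<phi> \<in> test_functions S"
  shows "cderiv \<alpha> \<phi> \<in> L2 S"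
proof -
  obtain K where K: "compact K" "K \<subseteq> S" "\<And>x \<alpha>. x \<notin> K \<Longrightarrow> cderiv \<alpha> \<phi> x = 0"
    "\<And>\<alpha>. continuous_on UNIV (cderiv \<alpha> \<phi>)"
    by (rule test_function_props[OF assms(3)]) blast
  have "compact (cderiv \<alpha> \<phi> ` K)"
    by (intro compact_continuous_image K) (use K(4) in \<open>auto intro: continuous_on_subset\<close>)
  then obtain B where B: "\<forall>x\<in>K. \<bar>cderiv \<alpha> \<phi> x\<bar> \<le> B"
    by (auto dest!: compact_imp_bounded simp: bounded_iff)
  have "cderiv \<alpha> \<phi> \<in> borel_measurable borel"
    using K(4) by (intro borel_measurable_continuous_onI)
  then have m: "cderiv \<alpha> \<phi> \<in> borel_measurable (lebesgue_on S)"
    by (intro measurable_restrict_space1 measurable_completion) simp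
  have "\<bar>cderiv \<alpha> \<phi> x\<bar> \<le> \<bar>B\<bar>" for x
    using B K(3)[of x \<alpha>] by (cases "x \<in> K") auto
  then show ?thesis
    unfolding L2_eq_l2 by (intro l2_bounded[OF finite_measure_lebesgue_on_open[OF assms(1,2)] m])
qed

text \<open>The difference of two weak derivatives is orthogonal to all test functions; on a bounded
  set it is also integrable, as the fundamental lemma requires.\<close>

lemma has_weak_deriv_unique:
  assumes S: "open S" "bounded S" and g: "g \<in> L2 S" "h \<in> L2 S"
    and "has_weak_deriv S \<alpha> f g" "has_weak_deriv S \<alpha> f h"
  shows "AE x in lebesgue_on S. g x = h x"
proof -
  interpret finite_measure "lebesgue_on S" by (rule finite_measure_lebesgue_on_open[OF S])
  have "AE x in lebesgue_on S. g x + (-1) * h x = 0"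
  proof (rule fundamental_lemma[OF S(1)])
    show "integrable (lebesgue_on S) (\<lambda>x. g x + (- 1) * h x)"
      using g unfolding L2_eq_l2 by (intro l2_integrable l2_add_scale)
    fix \<phi> assume \<phi>: "\<phi> \<in> test_functions S"
    then have \<phi>2: "\<phi> \<in> l2 (lebesgue_on S)" using test_function_L2[OF S, of \<phi> 0] by (simp add: L2_eq_l2)
    have "integrable (lebesgue_on S) (\<lambda>x. g x * \<phi> x)" "integrable (lebesgue_on S) (\<lambda>x. h x * \<phi> x)"
      by (rule l2_integrable_mult[OF _ \<phi>2], use g in \<open>simp add: L2_eq_l2\<close>)+
    moreover have "(LINT x|lebesgue_on S. g x * \<phi> x) = (LINT x|lebesgue_on S. h x * \<phi> x)"
    proof -
      have "(- 1) ^ mi_order \<alpha> * (LINT x|lebesgue_on S. g x * \<phi> x) = (- 1) ^ mi_order \<alpha> * (LINT x|lebesgue_on S. h x * \<phi> x)"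
        using bspec[OF assms(5)[unfolded has_weak_deriv_def] \<phi>] bspec[OF assms(6)[unfolded has_weak_deriv_def] \<phi>]
        by (rule trans[OF sym])
      then show ?thesis by simp
    qed
    ultimately show "(LINT x|lebesgue_on S. (g x + - 1 * h x) * \<phi> x) = 0"
      by (simp add: algebra_simps)
  qed
  then show ?thesis by eventually_elim simp
qed

lemma wderiv_works:
  assumes "g \<in> L2 S" "has_weak_deriv S \<alpha> f g"
  shows "wderiv S \<alpha> f \<in> L2 S" "has_weak_deriv S \<alpha> f (wderiv S \<alpha> f)"
proof -
  have "wderiv S \<alpha> f \<in> L2 S \<and> has_weak_deriv S \<alpha> f (wderiv S \<alpha> f)"
    unfolding wderiv_def by (rule someI[of _ g]) (use assms in auto)
  then show "wderiv S \<alpha> f \<in> L2 S" "has_weak_deriv S \<alpha> f (wderiv S \<alpha> f)" by auto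
qed

lemma wderiv_AE:
  assumes "open S" "bounded S" "g \<in> L2 S" "has_weak_deriv S \<alpha> f g"
  shows "AE x in lebesgue_on S. wderiv S \<alpha> f x = g x"
  by (rule has_weak_deriv_unique[OF assms(1,2) wderiv_works(1)[OF assms(3,4)] assms(3) wderiv_works(2)[OF assms(3,4)] assms(4)])

lemma wderiv_Hk:
  assumes "f \<in> Hk k S" "mi_order \<alpha> \<le> k"
  shows "wderiv S \<alpha> f \<in> L2 S" "has_weak_deriv S \<alpha> f (wderiv S \<alpha> f)"
proof -
  have "\<exists>g\<in>L2 S. has_weak_deriv S \<alpha> f g" using assms unfolding Hk_def by blast
  then obtain g where "g \<in> L2 S" "has_weak_deriv S \<alpha> f g" by blast
  from wderiv_works[OF this]
  show "wderiv S \<alpha> f \<in> L2 S" "has_weak_deriv S \<alpha> f (wderiv S \<alpha> f)" .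
qed

lemma uniformly_continuous_L2:
  assumes "open S" "bounded S" "uniformly_continuous_on S f"
  shows "f \<in> L2 S"
proof -
  have "bounded (f ` S)"
    by (rule bounded_uniformly_continuous_image) (use assms in auto)
  then obtain B where "\<forall>x\<in>S. \<bar>f x\<bar> \<le> B" by (auto simp: bounded_iff)
  moreover have "f \<in> borel_measurable (lebesgue_on S)"
    using assms by (intro continuous_imp_measurable_on_sets_lebesgue uniformly_continuous_imp_continuous) auto
  ultimately show ?thesis
    unfolding L2_eq_l2 by (intro l2_bounded[OF finite_measure_lebesgue_on_open[OF assms(1,2)]]) auto
qed

lemma Ck_uniform_imp_Ck: "f \<in> Ck_uniform k S \<Longrightarrow> f \<in> Ck k S"
  by (auto simp: Ck_def Ck_uniform_def uniformly_continuous_imp_continuous)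

lemma
  assumes S: "open S" "bounded S" and f: "f \<in> Ck_uniform k S" and \<alpha>: "mi_order \<alpha> \<le> k"
  shows cderiv_L2: "cderiv \<alpha> f \<in> L2 S"
    and wderiv_eq_cderiv: "AE x in lebesgue_on S. wderiv S \<alpha> f x = cderiv \<alpha> f x"
proof -
  show L2: "cderiv \<alpha> f \<in> L2 S"
    by (rule uniformly_continuous_L2[OF S]) (use f \<alpha> in \<open>auto simp: Ck_uniform_def\<close>)
  show "AE x in lebesgue_on S. wderiv S \<alpha> f x = cderiv \<alpha> f x"
    by (rule wderiv_AE[OF S L2]) (use S Ck_uniform_imp_Ck[OF f] \<alpha> in \<open>auto intro: Ck_has_weak_deriv\<close>)
qed

lemma Ck_uniform_Hk:
  assumes S: "open S" "bounded S" and f: "f \<in> Ck_uniform k S"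
  shows "f \<in> Hk k S"
proof -
  have "f \<in> L2 S" using cderiv_L2[OF S f, of 0] by simp
  moreover have "\<exists>g\<in>L2 S. has_weak_deriv S \<alpha> f g" if "mi_order \<alpha> \<le> k" for \<alpha>
    using cderiv_L2[OF S f that] Ck_has_weak_deriv[OF S(1) Ck_uniform_imp_Ck[OF f] that] by blast
  ultimately show ?thesis by (simp add: Hk_def)
qed

text \<open>\<open>wderiv\<close> is an arbitrary choice among almost everywhere equal functions,
  unrelated to any explicit derivative at hand; the inner product does not see the
  difference.\<close>

lemma Hk_inner_eqI:
  assumes F: "\<And>\<alpha>. mi_order \<alpha> \<le> k \<Longrightarrow> F \<alpha> \<in> L2 S" "\<And>\<alpha>. mi_order \<alpha> \<le> k \<Longrightarrow> AE x in lebesgue_on S. wderiv S \<alpha> f x = F \<alpha> x"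
    and G: "\<And>\<alpha>. mi_order \<alpha> \<le> k \<Longrightarrow> G \<alpha> \<in> L2 S" "\<And>\<alpha>. mi_order \<alpha> \<le> k \<Longrightarrow> AE x in lebesgue_on S. wderiv S \<alpha> g x = G \<alpha> x"
    and "f \<in> Hk k S" "g \<in> Hk k S"
  shows "Hk_inner k S f g = (\<Sum>\<alpha> | mi_order \<alpha> \<le> k. LINT x|lebesgue_on S. F \<alpha> x * G \<alpha> x)"
  unfolding Hk_inner_def
proof (rule sum.cong[OF refl])
  fix \<alpha> assume "\<alpha> \<in> {\<alpha> :: 'a multi_index. mi_order \<alpha> \<le> k}"
  then have \<alpha>: "mi_order \<alpha> \<le> k" by simp
  note m = F(1)[OF \<alpha>] G(1)[OF \<alpha>] wderiv_Hk(1)[OF assms(5) \<alpha>] wderiv_Hk(1)[OF assms(6) \<alpha>]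
  show "(LINT x|lebesgue_on S. wderiv S \<alpha> f x * wderiv S \<alpha> g x) = (LINT x|lebesgue_on S. F \<alpha> x * G \<alpha> x)"
  proof (rule integral_cong_AE)
    show "AE x in lebesgue_on S. wderiv S \<alpha> f x * wderiv S \<alpha> g x = F \<alpha> x * G \<alpha> x"
      using F(2)[OF \<alpha>] G(2)[OF \<alpha>] by eventually_elim simp
  qed (use m in \<open>auto simp: L2_def\<close>)
qed

section \<open>A Sobolev inequality on domains with the cone property\<close>

text \<open>The chain rule from continuous partial derivatives: the direction is built up one
  coordinate at a time, and the extra increment along a coordinate is controlled by the mean value
  inequality, since \<open>W a\<close> is nearly constant close to x.\<close>

lemma DERIV_direction:
  fixes w :: "real ^ 'd::finite \<Rightarrow> real"
  assumes S: "open S" and W: "\<And>i. continuous_on S (W i)"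
    and der: "\<And>x i. x \<in> S \<Longrightarrow> ((\<lambda>t. w (x + t *\<^sub>R axis i 1)) has_real_derivative W i x) (at 0)"
    and x: "x \<in> S"
  shows "((\<lambda>t. w (x + t *\<^sub>R v)) has_real_derivative (\<Sum>i\<in>UNIV. v $ i * W i x)) (at 0)"
proof -
  define vs where "vs I = (\<Sum>i\<in>I. (v $ i) *\<^sub>R (axis i 1 :: real ^ 'd))" for I
  have der_s: "((\<lambda>s. w (y + s *\<^sub>R axis i 1)) has_real_derivative W i (y + s *\<^sub>R axis i 1)) (at s)"
    if "y + s *\<^sub>R axis i 1 \<in> S" for y s i
  proof -
    have "((\<lambda>t. w ((y + s *\<^sub>R axis i 1) + t *\<^sub>R axis i 1)) has_real_derivative W i (y + s *\<^sub>R axis i 1)) (at 0)"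
      by (rule der[OF that])
    then have "((\<lambda>t. w (y + (t + s) *\<^sub>R axis i 1)) has_real_derivative W i (y + s *\<^sub>R axis i 1)) (at 0)"
      by (simp add: algebra_simps)
    then show ?thesis
      using DERIV_shift[of "\<lambda>t. w (y + t *\<^sub>R axis i 1)" "W i (y + s *\<^sub>R axis i 1)" 0 s] by simp
  qed
  have "((\<lambda>t. w (x + t *\<^sub>R vs I)) has_real_derivative (\<Sum>i\<in>I. v $ i * W i x)) (at 0)" if "finite I" for I
    using that
  proof induction
    case empty
    then show ?case by (simp add: vs_def)
  next
    case (insert a I)
    \<comment> \<open>The increment due to the new coordinate alone, starting from the point already
      displaced along \<open>vs I\<close>; \<open>W a\<close> is therefore met near x, not at
      x.\<close>
    define D where "D t = w (x + t *\<^sub>R vs I + (t * v $ a) *\<^sub>R axis a 1) - w (x + t *\<^sub>R vs I)" for t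
    have "(D has_real_derivative v $ a * W a x) (at 0)"
      unfolding DERIV_def
    proof (rule LIM_I)
      fix r :: real assume r: "0 < r"
      \<comment> \<open>The tolerance for \<open>W a\<close>: multiplied by
        \<open>\<bar>v $ a\<bar>\<close> it stays below r, and the added 1 keeps the denominator
        positive.\<close>
      define e where "e = r / (2 * (\<bar>v $ a\<bar> + 1))"
      have e: "e > 0" using r by (simp add: e_def)
      obtain \<delta>1 where \<delta>1: "\<delta>1 > 0" "\<And>y. y \<in> S \<Longrightarrow> dist y x < \<delta>1 \<Longrightarrow> dist (W a y) (W a x) < e"
        using W[of a] x e unfolding continuous_on_iff by blast
      obtain \<delta>2 where \<delta>2: "\<delta>2 > 0" "ball x \<delta>2 \<subseteq> S"
        using S x openE by blast
      define \<delta> where "\<delta> = min \<delta>1 \<delta>2"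
      define L where "L = norm (vs I) + \<bar>v $ a\<bar> + 1"
      have L: "L > 0" unfolding L_def by (smt (verit) norm_ge_zero)
      have "norm ((D (0 + t) - D 0) / t - v $ a * W a x) < r" if t: "t \<noteq> 0" "norm (t - 0) < \<delta> / L" for t
      proof -
        define y where "y = x + t *\<^sub>R vs I"
        have tL: "\<bar>t\<bar> * L < \<delta>" using t L by (simp add: field_simps)
        have in_ball: "y + s *\<^sub>R axis a 1 \<in> S \<and> \<bar>W a (y + s *\<^sub>R axis a 1) - W a x\<bar> \<le> e" if "\<bar>s\<bar> \<le> \<bar>t * v $ a\<bar>" for s
        proof -
          have "norm (y + s *\<^sub>R axis a 1 - x) \<le> norm (t *\<^sub>R vs I) + norm (s *\<^sub>R axis a (1::real))"
            unfolding y_def by (metis add.assoc add_diff_cancel_left' norm_triangle_ineq)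
          also have "\<dots> \<le> \<bar>t\<bar> * norm (vs I) + \<bar>t\<bar> * \<bar>v $ a\<bar>"
            using that by (simp add: norm_axis_1 abs_mult)
          also have "\<dots> \<le> \<bar>t\<bar> * L" by (simp add: L_def algebra_simps)
          finally have "dist (y + s *\<^sub>R axis a 1) x < \<delta>" using tL by (simp add: dist_norm)
          then show ?thesis using \<delta>1(2)[of "y + s *\<^sub>R axis a 1"] \<delta>2(2)
            unfolding \<delta>_def by (auto simp: dist_commute dist_real_def subset_iff less_imp_le)
        qed
        define T where "T = t * v $ a"
        \<comment> \<open>Subtracting the linear function of slope \<open>W a x\<close> leaves a
          function whose derivative is at most e in absolute value.\<close>
        have "norm ((w (y + T *\<^sub>R axis a 1) - T * W a x) - (w (y + 0 *\<^sub>R axis a 1) - 0 * W a x)) \<le> e * norm (T - 0)"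
        proof (rule field_differentiable_bound[where S = "{- \<bar>T\<bar> .. \<bar>T\<bar>}" and f = "\<lambda>s. w (y + s *\<^sub>R axis a 1) - s * W a x"
              and f' = "\<lambda>s. W a (y + s *\<^sub>R axis a 1) - W a x"])
          fix s assume "s \<in> {- \<bar>T\<bar> .. \<bar>T\<bar>}"
          then have s: "y + s *\<^sub>R axis a 1 \<in> S \<and> \<bar>W a (y + s *\<^sub>R axis a 1) - W a x\<bar> \<le> e"
            using in_ball[of s] by (auto simp: T_def)
          show "((\<lambda>s. w (y + s *\<^sub>R axis a 1) - s * W a x) has_field_derivative W a (y + s *\<^sub>R axis a 1) - W a x)
            (at s within {- \<bar>T\<bar> .. \<bar>T\<bar>})"
            by (rule has_field_derivative_at_within[OF DERIV_cong[OF DERIV_diff[OF der_s DERIV_cmult_right[OF DERIV_ident]]]])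
               (use s in auto)
          show "norm (W a (y + s *\<^sub>R axis a 1) - W a x) \<le> e" using s by simp
        qed auto
        then have "\<bar>D t - T * W a x\<bar> \<le> e * \<bar>T\<bar>"
          by (simp add: D_def T_def y_def algebra_simps)
        moreover have "(D (0 + t) - D 0) / t - v $ a * W a x = (D t - T * W a x) / t"
          using t by (simp add: D_def T_def field_simps)
        ultimately have "norm ((D (0 + t) - D 0) / t - v $ a * W a x) \<le> e * \<bar>T\<bar> / \<bar>t\<bar>"
          by (simp add: divide_right_mono)
        also have "\<dots> = e * \<bar>v $ a\<bar>" using t by (simp add: T_def abs_mult)
        also have "\<dots> < r"
        proof -
          have "e * \<bar>v $ a\<bar> \<le> e * (\<bar>v $ a\<bar> + 1)" using e by simp
          also have "\<dots> = r / 2" by (simp add: e_def field_simps)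
          finally show ?thesis using r by simp
        qed
        finally show ?thesis .
      qed
      moreover have "\<delta> / L > 0" using L \<delta>1 \<delta>2 by (simp add: \<delta>_def)
      ultimately show "\<exists>s>0. \<forall>t. t \<noteq> 0 \<and> norm (t - 0) < s \<longrightarrow> norm ((D (0 + t) - D 0) / t - v $ a * W a x) < r"
        by blast
    qed
    then have "((\<lambda>t. D t + w (x + t *\<^sub>R vs I)) has_real_derivative v $ a * W a x + (\<Sum>i\<in>I. v $ i * W i x)) (at 0)"
      by (rule DERIV_add) (rule insert.IH)
    moreover have "D t + w (x + t *\<^sub>R vs I) = w (x + t *\<^sub>R vs (insert a I))" for t
      using insert(1,2) by (simp add: D_def vs_def algebra_simps)
    ultimately show ?case using insert(1,2) by simp
  qed
  moreover have "vs UNIV = v" by (simp add: vs_def vec_eq_iff axis_def if_distrib cong: if_cong)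
  ultimately show ?thesis by (metis finite_class.finite_UNIV)
qed

section \<open>Derivatives and Taylor expansion along rays\<close>

lemma DERIV_ray:
  fixes u :: "real ^ 'd::finite \<Rightarrow> real"
  assumes S: "open S" and u: "u \<in> Ck k S" and \<beta>: "mi_order \<beta> < k" and x: "x + t *\<^sub>R v \<in> S"
  shows "((\<lambda>t. cderiv \<beta> u (x + t *\<^sub>R v)) has_real_derivative
     (\<Sum>i\<in>UNIV. v $ i * cderiv (\<beta> + axis i 1) u (x + t *\<^sub>R v))) (at t)"
proof -
  have "((\<lambda>s. cderiv \<beta> u ((x + t *\<^sub>R v) + s *\<^sub>R v)) has_real_derivative
     (\<Sum>i\<in>UNIV. v $ i * cderiv (\<beta> + axis i 1) u (x + t *\<^sub>R v))) (at 0)"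
    by (rule DERIV_direction[OF S _ _ x]) (use u \<beta> in \<open>auto simp: Ck_def derivs_exist_on_def mi_order_add\<close>)
  moreover have "(x + t *\<^sub>R v) + s *\<^sub>R v = x + (s + t) *\<^sub>R v" for s by (simp add: algebra_simps)
  ultimately show ?thesis
    using DERIV_shift[of "\<lambda>t. cderiv \<beta> u (x + t *\<^sub>R v)" "\<Sum>i\<in>UNIV. v $ i * cderiv (\<beta> + axis i 1) u (x + t *\<^sub>R v)" 0 t] by simp
qed

text \<open>Directional derivatives are expanded over words of coordinates, so each multi-index
  occurs as often as its multinomial coefficient and all words have weight 1.\<close>

definition mi_of_list :: "'d::finite list \<Rightarrow> 'd multi_index" where
  "mi_of_list js = (\<Sum>j\<leftarrow>js. axis j 1)"

lemma mi_of_list_simps [simp]: "mi_of_list [] = 0" "mi_of_list (j # js) = axis j 1 + mi_of_list js"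
  by (simp_all add: mi_of_list_def)

lemma mi_order_mi_of_list [simp]: "mi_order (mi_of_list js) = length js"
  by (induction js) (auto simp: mi_order_add)

lemma sum_lists_Suc:
  fixes f :: "'d::finite list \<Rightarrow> real"
  shows "(\<Sum>js | length js = Suc n. f js) = (\<Sum>js | length js = n. \<Sum>j\<in>UNIV. f (j # js))"
proof -
  have eq: "{js. length js = Suc n} = (\<lambda>(js, j). j # js) ` ({js :: 'd list. length js = n} \<times> UNIV)"
    by (auto simp: length_Suc_conv image_iff)
  have "(\<Sum>js | length js = Suc n. f js) = (\<Sum>(js, j)\<in>{js. length js = n} \<times> UNIV. f (j # js))"
    unfolding eq by (subst sum.reindex) (auto simp: inj_on_def intro!: sum.cong)
  also have "\<dots> = (\<Sum>js | length js = n. \<Sum>j\<in>UNIV. f (j # js))"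
    by (rule sum.cartesian_product[symmetric])
  finally show ?thesis .
qed

lemma card_lists_length: "card {js :: 'd::finite list. length js = n} = CARD('d) ^ n"
  using card_lists_length_eq[of "UNIV :: 'd set" n] by simp

text \<open>The n-th derivative of t \<mapsto> u (x + t (y - x)): the n-th power of the directional
  derivative along y - x, expanded over words.\<close>

definition ray_deriv :: "(real ^ 'd::finite \<Rightarrow> real) \<Rightarrow> real ^ 'd \<Rightarrow> nat \<Rightarrow> real ^ 'd \<Rightarrow> real \<Rightarrow> real" where
  "ray_deriv u x n y t = (\<Sum>js | length js = n. (\<Prod>j\<leftarrow>js. (y - x) $ j) * cderiv (mi_of_list js) u (x + t *\<^sub>R (y - x)))"

lemma ray_deriv_0: "ray_deriv u x 0 y t = u (x + t *\<^sub>R (y - x))"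
  by (simp add: ray_deriv_def)

lemma DERIV_ray_deriv:
  assumes "open S" "u \<in> Ck k S" "n < k" "x + t *\<^sub>R (y - x) \<in> S"
  shows "(ray_deriv u x n y has_real_derivative ray_deriv u x (Suc n) y t) (at t)"
proof -
  define v where "v = y - x"
  have "((\<lambda>t. \<Sum>js | length js = n. (\<Prod>j\<leftarrow>js. (y - x) $ j) * cderiv (mi_of_list js) u (x + t *\<^sub>R (y - x)))
    has_real_derivative (\<Sum>js | length js = n. (\<Prod>j\<leftarrow>js. (y - x) $ j) *
      (\<Sum>i\<in>UNIV. (y - x) $ i * cderiv (mi_of_list js + axis i 1) u (x + t *\<^sub>R (y - x))))) (at t)"
    by (intro DERIV_sum DERIV_cmult DERIV_ray[OF assms(1,2) _ assms(4)]) (use assms(3) in simp)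
  moreover have "(\<Sum>js | length js = n. (\<Prod>j\<leftarrow>js. (y - x) $ j) *
      (\<Sum>i\<in>UNIV. (y - x) $ i * cderiv (mi_of_list js + axis i 1) u (x + t *\<^sub>R (y - x)))) = ray_deriv u x (Suc n) y t"
    unfolding ray_deriv_def sum_lists_Suc v_def[symmetric]
    by (auto simp: sum_distrib_left mult_ac add.commute intro!: sum.cong)
  ultimately show ?thesis unfolding ray_deriv_def[abs_def] by (simp only:)
qed

text \<open>The Taylor polynomial along the ray from x through y, expanded at the parameter t and evaluated at the
  vertex; all but the highest-order term of its derivative in t cancel.\<close>

definition taylor_back :: "(real ^ 'd::finite \<Rightarrow> real) \<Rightarrow> real ^ 'd \<Rightarrow> nat \<Rightarrow> real ^ 'd \<Rightarrow> real \<Rightarrow> real" where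
  "taylor_back u x n y t = (\<Sum>i<n. (- t) ^ i / fact i * ray_deriv u x i y t)"

lemma DERIV_taylor_back:
  assumes "open S" "u \<in> Ck k S" "n < k" "x + t *\<^sub>R (y - x) \<in> S"
  shows "(taylor_back u x (Suc n) y has_real_derivative (- t) ^ n / fact n * ray_deriv u x (Suc n) y t) (at t)"
  using assms(3)
proof (induction n)
  case 0
  then show ?case
    using DERIV_ray_deriv[OF assms(1,2) _ assms(4), of 0] by (simp add: taylor_back_def[abs_def])
next
  case (Suc n)
  have "((\<lambda>t. (- t) ^ Suc n / fact (Suc n)) has_real_derivative - ((- t) ^ n / fact n)) (at t)"
    by (rule derivative_eq_intros refl | simp)+
  then have "((\<lambda>t. (- t) ^ Suc n / fact (Suc n) * ray_deriv u x (Suc n) y t) has_real_derivative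
     - ((- t) ^ n / fact n) * ray_deriv u x (Suc n) y t + ray_deriv u x (Suc (Suc n)) y t * ((- t) ^ Suc n / fact (Suc n))) (at t)"
    by (rule DERIV_mult) (use DERIV_ray_deriv[OF assms(1,2) _ assms(4)] Suc in auto)
  from DERIV_add[OF Suc.IH this] Suc.prems
  show ?case by (simp add: taylor_back_def[abs_def] mult.commute)
qed


text \<open>The dilation about x by the factor t multiplies volumes by t ^ d, so the pulled-back L2
  norm is at most t powr (- d / 2); Cauchy-Schwarz against the constant 1 on A turns this into an L1
  bound and contributes sqrt v.\<close>

lemma scaled_L1_bound:
  fixes F :: "real ^ 'd::finite \<Rightarrow> real"
  assumes S: "open S" "bounded S" and A: "open A" "emeasure lborel A = ennreal v" "v \<ge> 0"
    and F: "uniformly_continuous_on S F" "(\<integral>\<^sup>+z\<in>S. ennreal ((F z)\<^sup>2) \<partial>lborel) \<le> 1"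
    and t: "t > 0" and star: "\<And>y. y \<in> A \<Longrightarrow> x + t *\<^sub>R (y - x) \<in> S"
  defines "N \<equiv> restrict_space lborel A"
  shows "integrable N (\<lambda>y. F (x + t *\<^sub>R (y - x)))"
    and "(LINT y|N. \<bar>F (x + t *\<^sub>R (y - x))\<bar>) \<le> sqrt v * t powr (- (real CARD('d) / 2))"
proof -
  let ?h = "\<lambda>y. x + t *\<^sub>R (y - x)"
  define f where "f y = F (?h y)" for y
  have [measurable]: "A \<in> sets borel" "S \<in> sets borel" using A S by auto
  have emN: "emeasure N (space N) = ennreal v"
    unfolding N_def using A(2) by (simp add: emeasure_restrict_space space_restrict_space)
  have fin: "finite_measure N"
    by (rule finite_measureI) (simp add: emN)
  interpret finite_measure N by (rule fin)
  have Fc: "continuous_on S F" using F(1) by (rule uniformly_continuous_imp_continuous)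
  have fm: "f \<in> borel_measurable N"
  proof -
    have "continuous_on A f" unfolding f_def
      by (rule continuous_on_compose2[OF Fc]) (use star in \<open>auto intro!: continuous_intros\<close>)
    then have "f \<in> borel_measurable (restrict_space borel A)"
      by (rule borel_measurable_continuous_on_restrict)
    then show ?thesis unfolding N_def
      by (subst measurable_cong_sets[of _ "restrict_space borel A"]) (auto simp: sets_restrict_space)
  qed
  obtain B where B: "\<forall>z\<in>S. \<bar>F z\<bar> \<le> B"
  proof -
    have "bounded (F ` S)" by (rule bounded_uniformly_continuous_image[OF F(1) S(2)])
    then show ?thesis using that by (auto simp: bounded_iff)
  qed
  have f2: "f \<in> l2 N"
    by (rule l2_bounded[OF fin fm, of B]) (use B star in \<open>auto simp: f_def N_def space_restrict_space\<close>)
  show "integrable N (\<lambda>y. F (?h y))"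
    using l2_integrable[OF f2] unfolding f_def[abs_def] .
  define H where "H z = indicator S z * ennreal ((F z)\<^sup>2)" for z
  have Hm [measurable]: "H \<in> borel_measurable borel"
  proof -
    have "(\<lambda>z. indicator S z *\<^sub>R F z) \<in> borel_measurable borel"
      using borel_measurable_continuous_on_restrict[OF Fc] borel_measurable_restrict_space_iff[of S borel F] by simp
    then have "(\<lambda>z. ennreal ((indicator S z *\<^sub>R F z)\<^sup>2)) \<in> borel_measurable borel" by measurable
    moreover have "(\<lambda>z. ennreal ((indicator S z *\<^sub>R F z)\<^sup>2)) = H"
      by (auto simp: H_def indicator_def)
    ultimately show ?thesis by (simp only:)
  qed
  have HS: "(\<integral>\<^sup>+z. H z \<partial>lborel) \<le> 1"
    using F(2) by (simp add: H_def mult.commute)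
  \<comment> \<open>Chosen so that c + t y = x + t (y - x), the affine form expected by the change
    of variables.\<close>
  define c where "c = x - t *\<^sub>R x"
  have sc: "(\<integral>\<^sup>+z. H z \<partial>lborel) = ennreal (t ^ CARD('d)) * (\<integral>\<^sup>+y. H (c + t *\<^sub>R y) \<partial>lborel)"
    using t by (subst lborel_affine[of t c]) (simp_all add: nn_integral_density nn_integral_distr nn_integral_cmult)
  have "(\<integral>\<^sup>+y. H (c + t *\<^sub>R y) \<partial>lborel) \<le> ennreal (1 / t ^ CARD('d))"
  proof -
    have "ennreal (1 / t ^ CARD('d)) * (ennreal (t ^ CARD('d)) * (\<integral>\<^sup>+y. H (c + t *\<^sub>R y) \<partial>lborel)) \<le> ennreal (1 / t ^ CARD('d)) * 1"
      using HS unfolding sc by (rule mult_left_mono) simp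
    moreover have "ennreal (1 / t ^ CARD('d)) * ennreal (t ^ CARD('d)) = 1"
      using t by (simp flip: ennreal_mult'')
    ultimately show ?thesis by (simp flip: mult.assoc)
  qed
  moreover have "(\<integral>\<^sup>+y. ennreal ((f y)\<^sup>2) \<partial>N) \<le> (\<integral>\<^sup>+y. H (c + t *\<^sub>R y) \<partial>lborel)"
    unfolding N_def
    by (subst nn_integral_restrict_space)
       (use star in \<open>auto simp: f_def H_def c_def indicator_def algebra_simps intro!: nn_integral_mono\<close>)
  moreover have "(\<integral>\<^sup>+y. ennreal ((f y)\<^sup>2) \<partial>N) = ennreal (LINT y|N. (f y)\<^sup>2)"
    using f2 by (intro nn_integral_eq_integral) (auto simp: l2_def)
  ultimately have f2le: "(LINT y|N. (f y)\<^sup>2) \<le> 1 / t ^ CARD('d)"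
    using t by (metis (no_types, lifting) divide_nonneg_nonneg ennreal_le_iff less_imp_le order_trans zero_le_one zero_le_power)
  have "(LINT y|N. \<bar>f y\<bar>)\<^sup>2 \<le> (LINT y|N. (f y)\<^sup>2) * v"
  proof -
    have m: "measure N (space N) = v" using emN A(3) by (simp add: measure_def)
    have "(\<lambda>y. \<bar>f y\<bar>) \<in> l2 N" using f2 by (auto simp: l2_def)
    moreover have "(\<lambda>y. 1) \<in> l2 N" by (rule l2_bounded[OF fin, of _ 1]) auto
    ultimately show ?thesis
      using l2_cauchy_schwarz[of "\<lambda>y. \<bar>f y\<bar>" N "\<lambda>y. 1"] m by simp
  qed
  also have "\<dots> \<le> 1 / t ^ CARD('d) * v" using f2le A(3) by (rule mult_right_mono)
  also have "\<dots> = (sqrt v * t powr (- (real CARD('d) / 2)))\<^sup>2"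
  proof -
    have "(t powr (- (real CARD('d) / 2)))\<^sup>2 = t powr (- real CARD('d))"
      by (simp add: power2_eq_square flip: powr_add)
    also have "\<dots> = 1 / t ^ CARD('d)" using t by (simp add: powr_minus_divide powr_realpow)
    finally show ?thesis using A(3) by (simp add: power_mult_distrib)
  qed
  finally show "(LINT y|N. \<bar>F (?h y)\<bar>) \<le> sqrt v * t powr (- (real CARD('d) / 2))"
    unfolding f_def by (rule power2_le_imp_le) (use A(3) in simp)
qed


text \<open>In (d R) ^ i there are d ^ i words of length i, each with a product of components at
  most R ^ i. The sum bounds the Taylor polynomial at t = 1, the division by l - d / 2 is the
  integral of t powr (l - 1 - d / 2) over (0, 1), and 1 / sqrt v remains when the sqrt v from
  Cauchy-Schwarz is divided by the volume v.\<close>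

definition sobolev_const :: "nat \<Rightarrow> real \<Rightarrow> real \<Rightarrow> nat \<Rightarrow> real" where
  "sobolev_const d R v l =
     ((\<Sum>i<l. (real d * R) ^ i) + (real d * R) ^ l / (real l - real d / 2)) / sqrt v"

text \<open>The integral over A of the backward Taylor polynomial equals v u(x) at t = 0, is bounded
  through the L2 norms at t = 1, and has in between a derivative of order t powr (l - 1 - d / 2),
  which is integrable down to 0.\<close>

lemma sobolev_inequality_star:
  fixes u :: "real ^ 'd::finite \<Rightarrow> real"
  assumes S: "open S" "bounded S" and u: "u \<in> Ck_uniform l S" and l: "real l > real CARD('d) / 2"
    and norm1: "\<And>\<beta>. mi_order \<beta> \<le> l \<Longrightarrow> (\<integral>\<^sup>+z\<in>S. ennreal ((cderiv \<beta> u z)\<^sup>2) \<partial>lborel) \<le> 1"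
    and x: "x \<in> S" and R: "R \<ge> 1" "\<And>y. y \<in> S \<Longrightarrow> norm (y - x) \<le> R"
    and A: "open A" "A \<subseteq> S" "emeasure lborel A = ennreal v" "v > 0"
    and star: "\<And>y t. y \<in> A \<Longrightarrow> 0 < t \<Longrightarrow> t \<le> 1 \<Longrightarrow> x + t *\<^sub>R (y - x) \<in> A"
  shows "\<bar>u x\<bar> \<le> sobolev_const CARD('d) R v l"
proof -
  let ?d = "CARD('d)"
  have l0: "l > 0" using l by (cases l) (auto simp: field_simps)
  then obtain l' where l': "l = Suc l'" by (cases l) auto
  have uCk: "u \<in> Ck l S" using u by (rule Ck_uniform_imp_Ck)
  define N where "N = restrict_space lborel A"
  have [measurable]: "A \<in> sets borel" using A by auto
  have spN [simp]: "space N = A" by (simp add: N_def space_restrict_space)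
  have emN: "emeasure N (space N) = ennreal v"
    unfolding N_def using A(3) by (simp add: emeasure_restrict_space space_restrict_space)
  have fin: "finite_measure N" by (rule finite_measureI) (simp only: emN, simp)
  interpret finite_measure N by (rule fin)
  have mN: "measure N A = v" using emN[unfolded spN] A(4) by (simp add: measure_def)
  have inS: "x + t *\<^sub>R (y - x) \<in> S" if "y \<in> A" "0 \<le> t" "t \<le> 1" for y t
    using star[OF that(1), of t] that A(2) x by (cases "t = 0") auto
  have uc: "uniformly_continuous_on S (cderiv \<beta> u)" if "mi_order \<beta> \<le> l" for \<beta>
    using u that by (simp add: Ck_uniform_def)
  have L1: "integrable N (\<lambda>y. cderiv \<beta> u (x + t *\<^sub>R (y - x)))"
    "(LINT y|N. \<bar>cderiv \<beta> u (x + t *\<^sub>R (y - x))\<bar>) \<le> sqrt v * t powr (- (real ?d / 2))"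
    if "mi_order \<beta> \<le> l" "0 < t" "t \<le> 1" for \<beta> t
    unfolding N_def
    using scaled_L1_bound[OF S A(1,3) _ uc[OF that(1)] norm1[OF that(1)] that(2), of x] inS that A(4)
    by auto
  have pb: "\<bar>\<Prod>j\<leftarrow>js. (y - x) $ j\<bar> \<le> R ^ length js" if "y \<in> S" for y js
  proof (induction js)
    case (Cons j js)
    have "\<bar>(y - x) $ j\<bar> \<le> R"
      using component_le_norm_cart[of "y - x" j] R(2)[OF that] by linarith
    then show ?case using Cons R(1) by (auto simp: abs_mult simp del: vector_minus_component intro!: mult_mono)
  qed simp
  have ray_cont: "continuous_on A (\<lambda>y. ray_deriv u x n y t)" if "n \<le> l" "0 \<le> t" "t \<le> 1" for n t
  proof -
    have 1: "continuous_on A (\<lambda>y. \<Prod>j\<leftarrow>js. (y - x) $ j)" for js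
      by (induction js) (auto intro!: continuous_intros)
    have 2: "continuous_on A (\<lambda>y. cderiv (mi_of_list js) u (x + t *\<^sub>R (y - x)))" if "length js = n" for js
      by (rule continuous_on_compose2[OF uniformly_continuous_imp_continuous[OF uc]])
         (use that \<open>n \<le> l\<close> inS \<open>0 \<le> t\<close> \<open>t \<le> 1\<close> in \<open>auto intro!: continuous_intros\<close>)
    show ?thesis unfolding ray_deriv_def
      by (intro continuous_on_sum continuous_on_mult 1 2) auto
  qed
  have meas: "f \<in> borel_measurable N" if "continuous_on A f" for f :: "real ^ 'd \<Rightarrow> real"
  proof -
    have "f \<in> borel_measurable (restrict_space borel A)"
      by (rule borel_measurable_continuous_on_restrict[OF that])
    then show ?thesis unfolding N_def
      by (subst measurable_cong_sets[of _ "restrict_space borel A"]) (auto simp: sets_restrict_space)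
  qed
  \<comment> \<open>A crude bound that depends on u; it justifies integrability and dominated
    convergence and does not enter the final estimate.\<close>
  obtain B where B: "B \<ge> 0" "\<And>n y t. n \<le> l \<Longrightarrow> y \<in> A \<Longrightarrow> 0 \<le> t \<Longrightarrow> t \<le> 1 \<Longrightarrow> \<bar>ray_deriv u x n y t\<bar> \<le> B"
  proof -
    have "\<exists>b. \<forall>z\<in>S. \<bar>cderiv \<beta> u z\<bar> \<le> b" if "mi_order \<beta> \<le> l" for \<beta>
      using bounded_uniformly_continuous_image[OF uc[OF that] S(2)] by (auto simp: bounded_iff)
    then obtain b where b: "\<And>\<beta> z. mi_order \<beta> \<le> l \<Longrightarrow> z \<in> S \<Longrightarrow> \<bar>cderiv \<beta> u z\<bar> \<le> b \<beta>" by metis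
    have b0: "0 \<le> b \<beta>" if "mi_order \<beta> \<le> l" for \<beta> using b[OF that x] by linarith
    define B where "B = (\<Sum>n\<le>l. \<Sum>js | length js = n. R ^ length js * b (mi_of_list js))"
    have nn: "0 \<le> (\<Sum>js | length js = n. R ^ length js * b (mi_of_list js))" if "n \<le> l" for n
      by (intro sum_nonneg mult_nonneg_nonneg b0) (use R(1) that in auto)
    have "\<bar>ray_deriv u x n y t\<bar> \<le> B" if "n \<le> l" "y \<in> A" "0 \<le> t" "t \<le> 1" for n y t
    proof -
      have "\<bar>ray_deriv u x n y t\<bar> \<le> (\<Sum>js | length js = n. R ^ length js * b (mi_of_list js))"
        unfolding ray_deriv_def
      proof (rule order_trans[OF sum_abs sum_mono])
        fix js :: "'d list" assume "js \<in> {js. length js = n}"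
        then show "\<bar>(\<Prod>j\<leftarrow>js. (y - x) $ j) * cderiv (mi_of_list js) u (x + t *\<^sub>R (y - x))\<bar> \<le> R ^ length js * b (mi_of_list js)"
          unfolding abs_mult
          by (intro mult_mono pb b inS) (use that A(2) R(1) in auto)
      qed
      also have "\<dots> \<le> B" unfolding B_def
        by (rule member_le_sum) (use nn that in auto)
      finally show ?thesis .
    qed
    moreover have "B \<ge> 0" unfolding B_def by (intro sum_nonneg nn) auto
    ultimately show ?thesis using that by blast
  qed
  have ray_int: "(LINT y|N. \<bar>ray_deriv u x n y t\<bar>) \<le> (real ?d * R) ^ n * (sqrt v * t powr (- (real ?d / 2)))"
    if "n \<le> l" "0 < t" "t \<le> 1" for n t
  proof -
    have i: "integrable N (\<lambda>y. \<bar>cderiv (mi_of_list js) u (x + t *\<^sub>R (y - x))\<bar>)" if "length js = n" for js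
      using L1(1)[of "mi_of_list js" t] that \<open>n \<le> l\<close> \<open>0 < t\<close> \<open>t \<le> 1\<close> by simp
    have "(LINT y|N. \<bar>ray_deriv u x n y t\<bar>) \<le>
       (LINT y|N. (\<Sum>js | length js = n. R ^ n * \<bar>cderiv (mi_of_list js) u (x + t *\<^sub>R (y - x))\<bar>))"
    proof (rule integral_mono_AE)
      show "integrable N (\<lambda>y. \<bar>ray_deriv u x n y t\<bar>)"
        by (rule integrable_const_bound[where B = B])
           (use B that meas[OF ray_cont[OF that(1), of t]] in auto)
      show "integrable N (\<lambda>y. \<Sum>js | length js = n. R ^ n * \<bar>cderiv (mi_of_list js) u (x + t *\<^sub>R (y - x))\<bar>)"
        by (intro Bochner_Integration.integrable_sum integrable_mult_right i) auto
      show "AE y in N. \<bar>ray_deriv u x n y t\<bar> \<le> (\<Sum>js | length js = n. R ^ n * \<bar>cderiv (mi_of_list js) u (x + t *\<^sub>R (y - x))\<bar>)"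
      proof (intro AE_I2)
        fix y assume "y \<in> space N"
        then have y: "y \<in> S" using A(2) by auto
        show "\<bar>ray_deriv u x n y t\<bar> \<le> (\<Sum>js | length js = n. R ^ n * \<bar>cderiv (mi_of_list js) u (x + t *\<^sub>R (y - x))\<bar>)"
          unfolding ray_deriv_def
          by (rule order_trans[OF sum_abs sum_mono])
             (use pb[OF y] in \<open>auto simp: abs_mult simp del: vector_minus_component intro!: mult_right_mono\<close>)
      qed
    qed
    also have "\<dots> = (\<Sum>js | length js = n. R ^ n * (LINT y|N. \<bar>cderiv (mi_of_list js) u (x + t *\<^sub>R (y - x))\<bar>))"
      by (subst Bochner_Integration.integral_sum) (auto intro!: integrable_mult_right i simp del: integrable_abs_iff)
    also have "\<dots> \<le> (\<Sum>js\<in>{js :: 'd list. length js = n}. R ^ n * (sqrt v * t powr (- (real ?d / 2))))"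
      by (intro sum_mono mult_left_mono L1(2)) (use that R(1) in auto)
    also have "\<dots> = (real ?d * R) ^ n * (sqrt v * t powr (- (real ?d / 2)))"
      by (simp add: card_lists_length power_mult_distrib mult_ac)
    finally show ?thesis .
  qed
  define P where "P y t = taylor_back u x l y t" for y t
  define P' where "P' y t = (- t) ^ l' / fact l' * ray_deriv u x l y t" for y t
  define M where "M t = (LINT y|N. P y t)" for t
  have dP: "(P y has_real_derivative P' y t) (at t)" if "y \<in> A" "0 \<le> t" "t \<le> 1" for y t
    using DERIV_taylor_back[OF S(1) uCk _ inS[OF that], of l'] by (simp add: P_def[abs_def] P'_def l')
  have P_cont: "continuous_on A (\<lambda>y. P y t)" if "0 \<le> t" "t \<le> 1" for t
    unfolding P_def taylor_back_def
    by (intro continuous_on_sum continuous_on_mult continuous_on_const ray_cont) (use that in auto)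
  have P'_bd: "\<bar>P' y t\<bar> \<le> B" if "y \<in> A" "0 \<le> t" "t \<le> 1" for y t
  proof -
    have "\<bar>(- t) ^ l' / fact l'\<bar> \<le> 1"
    proof -
      have "t ^ l' \<le> 1" using that by (simp add: power_le_one)
      also have "(1::real) \<le> fact l'" by simp
      finally show ?thesis using that by (simp add: power_abs)
    qed
    then have "\<bar>(- t) ^ l' / fact l'\<bar> * \<bar>ray_deriv u x l y t\<bar> \<le> 1 * B"
      by (rule mult_mono) (use B that in auto)
    then show ?thesis unfolding P'_def abs_mult by simp
  qed
  define B1 where "B1 = real l * B"
  have P_bd: "\<bar>P y t\<bar> \<le> B1" if "y \<in> A" "0 \<le> t" "t \<le> 1" for y t
  proof -
    have "\<bar>P y t\<bar> \<le> (\<Sum>i<l. B)"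
      unfolding P_def taylor_back_def
    proof (rule order_trans[OF sum_abs sum_mono])
      fix i assume i: "i \<in> {..<l}"
      have "t ^ i \<le> 1" using that by (simp add: power_le_one)
      also have "(1::real) \<le> fact i" by simp
      finally have "\<bar>(- t) ^ i / fact i\<bar> \<le> 1" using that by (simp add: power_abs)
      then have "\<bar>(- t) ^ i / fact i * ray_deriv u x i y t\<bar> \<le> 1 * B"
        unfolding abs_mult by (intro mult_mono B) (use that i in auto)
      then show "\<bar>(- t) ^ i / fact i * ray_deriv u x i y t\<bar> \<le> B" by simp
    qed
    then show ?thesis by (simp add: B1_def)
  qed
  have P_int: "integrable N (\<lambda>y. P y t)" if "0 \<le> t" "t \<le> 1" for t
    by (rule integrable_const_bound[where B = B1]) (use P_bd that meas[OF P_cont[OF that]] in auto)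
  \<comment> \<open>The derivative of M is controlled only for 0 < t < 1, by a bound that may be
    singular at 0; the endpoints are reached by continuity.\<close>
  have M_cont: "continuous_on {0..1} M"
    unfolding continuous_on_sequentially comp_def
  proof (intro allI impI ballI)
    fix X :: "nat \<Rightarrow> real" and a assume "a \<in> {0..1}" and X: "(\<forall>n. X n \<in> {0..1}) \<and> X \<longlonglongrightarrow> a"
    then have a: "0 \<le> a" "a \<le> 1" and Xn: "0 \<le> X n" "X n \<le> 1" for n by auto
    show "(\<lambda>n. M (X n)) \<longlonglongrightarrow> M a"
      unfolding M_def
    proof (rule integral_dominated_convergence[where w = "\<lambda>_. B1"])
      show "AE y in N. (\<lambda>n. P y (X n)) \<longlonglongrightarrow> P y a"
      proof (intro AE_I2)
        fix y assume "y \<in> space N"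
        then have "isCont (P y) a" using dP[of y a] a by (auto intro: DERIV_isCont)
        then show "(\<lambda>n. P y (X n)) \<longlonglongrightarrow> P y a" using X by (auto intro: isCont_tendsto_compose)
      qed
    qed (use P_bd a Xn meas[OF P_cont] in auto)
  qed
  define \<kappa> where "\<kappa> = (real ?d * R) ^ l * sqrt v"
  define q where "q = real l - real ?d / 2"
  have q: "q > 0" using l by (simp add: q_def)
  have \<kappa>: "\<kappa> \<ge> 0" using R(1) A(4) by (simp add: \<kappa>_def)
  have dM: "(M has_real_derivative (LINT y|N. P' y t)) (at t)" if "0 < t" "t < 1" for t
    unfolding M_def
  proof (rule DERIV_integral[where a = 0 and b = 1 and w = "\<lambda>_. B"])
    show "(\<lambda>y. P' y t) \<in> borel_measurable N"
      unfolding P'_def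
      by (intro meas continuous_on_mult continuous_on_const ray_cont) (use that in auto)
  qed (use that P_int dP P'_bd in auto)
  have M'_bd: "\<bar>LINT y|N. P' y t\<bar> \<le> \<kappa> * t powr (q - 1)" if "0 < t" "t < 1" for t
  proof -
    have "\<bar>LINT y|N. P' y t\<bar> \<le> (LINT y|N. \<bar>P' y t\<bar>)" by (rule integral_abs_bound)
    also have "\<dots> = t ^ l' / fact l' * (LINT y|N. \<bar>ray_deriv u x l y t\<bar>)"
      using that by (simp add: P'_def abs_mult power_abs)
    also have "\<dots> \<le> t ^ l' * ((real ?d * R) ^ l * (sqrt v * t powr (- (real ?d / 2))))"
    proof (rule mult_mono)
      show "t ^ l' / fact l' \<le> t ^ l'" using that by (simp add: divide_le_eq mult_le_cancel_left1)
    qed (use that ray_int[of l t] in auto)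
    also have "\<dots> = \<kappa> * (t powr real l' * t powr (- (real ?d / 2)))"
      using that by (simp add: \<kappa>_def powr_realpow)
    also have "t powr real l' * t powr (- (real ?d / 2)) = t powr (q - 1)"
      by (simp add: q_def l' flip: powr_add)
    finally show ?thesis .
  qed
  \<comment> \<open>The comparison function \<open>\<kappa> / q * t powr q\<close> has the
    derivative \<open>\<kappa> * t powr (q - 1)\<close> and vanishes at t = 0.\<close>
  have "norm (M 1 - M 0) \<le> \<kappa> / q * 1 powr q - \<kappa> / q * 0 powr q"
  proof (rule differentiable_bound_general[where f' = "\<lambda>t. LINT y|N. P' y t" and \<phi>' = "\<lambda>t. \<kappa> * t powr (q - 1)"])
    show "continuous_on {0..1} (\<lambda>t. \<kappa> / q * t powr q)"
      using q by (intro continuous_on_mult continuous_on_const continuous_on_powr') (auto intro!: continuous_intros)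
    fix t :: real assume t: "0 < t" "t < 1"
    show "(M has_vector_derivative (LINT y|N. P' y t)) (at t)"
      using dM[OF t] by (simp add: has_real_derivative_iff_has_vector_derivative)
    have "((\<lambda>t. \<kappa> / q * t powr q) has_real_derivative \<kappa> / q * (q * t powr (q - 1))) (at t)"
      by (intro DERIV_cmult has_real_derivative_powr) (use t in auto)
    then show "((\<lambda>t. \<kappa> / q * t powr q) has_vector_derivative \<kappa> * t powr (q - 1)) (at t)"
      using q by (simp add: has_real_derivative_iff_has_vector_derivative)
  qed (use M_cont M'_bd in auto)
  then have M10: "\<bar>M 1 - M 0\<bar> \<le> \<kappa> / q" by simp
  have M0: "M 0 = v * u x"
  proof -
    have "P y 0 = u x" for y
    proof -
      \<comment> \<open>The factor (- t) ^ i removes every term at t = 0 except the one with i =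
        0.\<close>
      have "(- 0) ^ i / fact i * ray_deriv u x i y 0 = (if i = 0 then u x else 0)" for i
        by (simp add: ray_deriv_0)
      then show ?thesis using l0 by (simp add: P_def taylor_back_def)
    qed
    then show ?thesis by (simp add: M_def mN)
  qed
  have M1: "\<bar>M 1\<bar> \<le> (\<Sum>i<l. (real ?d * R) ^ i) * sqrt v"
  proof -
    have ri: "integrable N (\<lambda>y. ray_deriv u x i y 1)" if "i < l" for i
      by (rule integrable_const_bound[where B = B]) (use B that meas[OF ray_cont[of i 1]] in auto)
    have "M 1 = (\<Sum>i<l. (- 1) ^ i / fact i * (LINT y|N. ray_deriv u x i y 1))"
      unfolding M_def P_def taylor_back_def
      by (subst Bochner_Integration.integral_sum) (auto intro!: integrable_mult_right ri)
    also have "\<bar>\<dots>\<bar> \<le> (\<Sum>i<l. (real ?d * R) ^ i * sqrt v)"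
    proof (rule order_trans[OF sum_abs sum_mono])
      fix i assume "i \<in> {..<l}"
      then have "\<bar>LINT y|N. ray_deriv u x i y 1\<bar> \<le> (real ?d * R) ^ i * sqrt v"
        using ray_int[of i 1] by (intro order_trans[OF integral_abs_bound]) simp
      moreover have "\<bar>(- 1) ^ i / fact i :: real\<bar> \<le> 1" by (simp add: power_abs)
      ultimately have "\<bar>(- 1) ^ i / fact i\<bar> * \<bar>LINT y|N. ray_deriv u x i y 1\<bar> \<le> 1 * ((real ?d * R) ^ i * sqrt v)"
        by (intro mult_mono) auto
      then show "\<bar>(- 1) ^ i / fact i * (LINT y|N. ray_deriv u x i y 1)\<bar> \<le> (real ?d * R) ^ i * sqrt v"
        by (simp add: abs_mult)
    qed
    finally show ?thesis by (simp add: sum_distrib_right)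
  qed
  have "v * \<bar>u x\<bar> \<le> (\<Sum>i<l. (real ?d * R) ^ i) * sqrt v + \<kappa> / q"
    using M10 M1 A(4) unfolding M0 by (simp add: abs_mult abs_if split: if_splits)
  also have "\<dots> = v * sobolev_const ?d R v l"
  proof -
    have "v = sqrt v * sqrt v" using A(4) by simp
    then have "v * sobolev_const ?d R v l = sqrt v * (sqrt v * sobolev_const ?d R v l)" by (metis mult.assoc)
    also have "sqrt v * sobolev_const ?d R v l = (\<Sum>i<l. (real ?d * R) ^ i) + (real ?d * R) ^ l / q"
      using A(4) by (simp add: sobolev_const_def q_def)
    finally show ?thesis by (simp add: \<kappa>_def algebra_simps)
  qed
  finally show ?thesis using A(4) by simp
qed

section \<open>Cones: star shape and a uniform lower bound for the volume\<close>

lemma finite_cone_at_props: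
  fixes x :: "real ^ 'd::finite"
  assumes "finite_cone_at x A"
  shows "open A" "A \<noteq> {}" "bounded A"
    and "\<And>y t. y \<in> A \<Longrightarrow> 0 < t \<Longrightarrow> t \<le> 1 \<Longrightarrow> x + t *\<^sub>R (y - x) \<in> A"
proof -
  obtain \<epsilon> \<tau> z where \<epsilon>: "\<epsilon> > 0" and \<tau>: "\<tau> > 0"
    and A: "A = ball x \<epsilon> \<inter> {x + l *\<^sub>R (y - x) | y l. y \<in> ball z \<tau> \<and> l > 0}"
    using assms by (auto simp: finite_cone_at_def)
  \<comment> \<open>As a union of scaled and translated balls, one for each l > 0, the infinite cone
    is visibly open.\<close>
  have eq: "{x + l *\<^sub>R (y - x) | y l. y \<in> ball z \<tau> \<and> l > 0} = (\<Union>l\<in>{0<..}. (\<lambda>w. x + w) ` (\<lambda>w. l *\<^sub>R w) ` (\<lambda>w. - x + w) ` ball z \<tau>)"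
    by (auto simp: image_iff) blast
  have op: "open ((\<lambda>w. x + w) ` (\<lambda>w. l *\<^sub>R w) ` (\<lambda>w. - x + w) ` ball z \<tau>)" if "l > 0" for l
    using that by (intro open_translation open_scaling) auto
  show "open A" unfolding A eq using op by (intro open_Int open_UN) auto
  show "bounded A" unfolding A by (rule bounded_subset[OF bounded_ball]) auto
  \<comment> \<open>Small enough that the point of parameter l on the axis lies in the ball of
    radius \<epsilon>; the added 1 keeps the denominator positive.\<close>
  define l where "l = \<epsilon> / (2 * (norm (z - x) + 1))"
  have l: "l > 0" using \<epsilon> by (simp add: l_def add_nonneg_pos)
  have "l * norm (z - x) < \<epsilon>"
  proof -
    define n where "n = norm (z - x) + 1"
    have "n > 0" by (simp add: n_def add_nonneg_pos)
    have "l * norm (z - x) \<le> l * n" using l by (simp add: n_def)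
    also have "\<dots> = \<epsilon> / 2" using \<open>n > 0\<close> by (simp add: l_def flip: n_def)
    finally show ?thesis using \<epsilon> by simp
  qed
  then have "x + l *\<^sub>R (z - x) \<in> A" using l \<tau> by (auto simp: A dist_norm intro!: exI[of _ z] exI[of _ l])
  then show "A \<noteq> {}" by auto
  fix y t assume "y \<in> A" and t: "0 < (t::real)" "t \<le> 1"
  then obtain y' m where y: "y = x + m *\<^sub>R (y' - x)" "y' \<in> ball z \<tau>" "m > 0" and yb: "norm (y - x) < \<epsilon>"
    unfolding A by (auto simp: dist_norm norm_minus_commute)
  have "x + t *\<^sub>R (y - x) = x + (t * m) *\<^sub>R (y' - x)" using y by simp
  moreover have "norm (t *\<^sub>R (y - x)) < \<epsilon>"
  proof -
    have "norm (t *\<^sub>R (y - x)) \<le> norm (y - x)" using t by (simp add: mult_left_le_one_le)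
    then show ?thesis using yb by simp
  qed
  then have "x + t *\<^sub>R (y - x) \<in> ball x \<epsilon>" by (simp add: dist_norm)
  ultimately show "x + t *\<^sub>R (y - x) \<in> A"
    unfolding A using y t by (auto intro!: exI[of _ "t * m"] exI[of _ y'])
qed

text \<open>Star shape about x holds because A is itself a cone with vertex x. Congruence with C0
  contributes the volume: a ball inside C0 is carried to a ball of the same radius inside A, and all
  such balls have volume v0.\<close>

lemma cone_property_star:
  fixes S :: "(real ^ 'd::finite) set"
  assumes "cone_property S"
  obtains v0 where "v0 > 0"
    "\<And>x. x \<in> S \<Longrightarrow> \<exists>A v. open A \<and> A \<subseteq> S \<and> emeasure lborel A = ennreal v \<and> v0 \<le> v \<and>
       (\<forall>y\<in>A. \<forall>t. 0 < t \<and> t \<le> 1 \<longrightarrow> x + t *\<^sub>R (y - x) \<in> A)"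
proof -
  obtain p C0 where C0: "finite_cone_at p C0"
    and cone: "\<And>x. x \<in> S \<Longrightarrow> \<exists>A. finite_cone_at x A \<and> A \<subseteq> S \<and> congruent_sets A C0"
    using assms unfolding cone_property_def by blast
  note C = finite_cone_at_props[OF C0]
  obtain c where "c \<in> C0" using C(2) by blast
  then obtain r where r: "r > 0" "ball c r \<subseteq> C0" using C(1) openE by blast
  define v0 where "v0 = measure lborel (ball (0 :: real ^ 'd) r)"
  have ball: "measure lborel (ball q r) = v0" for q :: "real ^ 'd"
    using r(1) by (simp add: v0_def content_ball)
  have "v0 > 0" using r(1) by (simp add: v0_def content_ball_pos)
  moreover have "\<exists>A v. open A \<and> A \<subseteq> S \<and> emeasure lborel A = ennreal v \<and> v0 \<le> v \<and>
       (\<forall>y\<in>A. \<forall>t. 0 < t \<and> t \<le> 1 \<longrightarrow> x + t *\<^sub>R (y - x) \<in> A)" if x: "x \<in> S" for x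
  proof -
    obtain A where A: "finite_cone_at x A" "A \<subseteq> S" "congruent_sets A C0" using cone[OF x] by blast
    note P = finite_cone_at_props[OF A(1)]
    obtain Q a where Q: "orthogonal_transformation Q" "A = (\<lambda>x. a + Q x) ` C0"
      using A(3) by (auto simp: congruent_sets_def)
    have "ball (a + Q c) r = (+) a ` (Q ` ball c r)"
      unfolding image_orthogonal_transformation_ball[OF Q(1)] by (rule ball_translation)
    also have "\<dots> = (\<lambda>x. a + Q x) ` ball c r" by (simp add: image_image)
    finally have sub: "ball (a + Q c) r \<subseteq> A" using r(2) Q(2) by auto
    have fin: "emeasure lborel A < \<infinity>" using P(3) by (rule emeasure_bounded_finite)
    have "v0 \<le> measure lborel A"
      unfolding ball[of "a + Q c", symmetric] using sub P(1) fin
      by (intro measure_mono_fmeasurable) (auto simp: fmeasurable_def)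
    moreover have "emeasure lborel A = ennreal (measure lborel A)"
      using fin by (intro emeasure_eq_ennreal_measure) auto
    ultimately show ?thesis using P A(2) by (intro exI[of _ A] exI[of _ "measure lborel A"]) auto
  qed
  ultimately show ?thesis using that by blast
qed

lemma sobolev_const_antimono:
  assumes "0 < v0" "v0 \<le> v" "0 \<le> R" "real l > real d / 2"
  shows "sobolev_const d R v l \<le> sobolev_const d R v0 l"
  unfolding sobolev_const_def
  using assms by (intro divide_left_mono add_nonneg_nonneg sum_nonneg divide_nonneg_pos) auto

text \<open>A derivative of order j is bounded by applying the inequality to that derivative with
  the remaining l = k - j orders; l > d / 2 follows from j \<le> s < k - d / 2. The constant is
  fixed before u, s and \<alpha>.\<close>

lemma sobolev_inequality:
  fixes S :: "(real ^ 'd::finite) set"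
  assumes S: "open S" "bounded S" "cone_property S"
  obtains C where "C > 0"
    "\<And>u s x \<alpha>. u \<in> Ck_uniform k S \<Longrightarrow> real k - real CARD('d) / 2 > real s \<Longrightarrow> mi_order \<alpha> \<le> s \<Longrightarrow>
       (\<And>\<beta>. mi_order \<beta> \<le> k \<Longrightarrow> (LINT z|lebesgue_on S. (cderiv \<beta> u z)\<^sup>2) \<le> 1) \<Longrightarrow> x \<in> S \<Longrightarrow> \<bar>cderiv \<alpha> u x\<bar> \<le> C"
proof -
  obtain v0 where v: "v0 > 0" "\<And>x. x \<in> S \<Longrightarrow> \<exists>A v. open A \<and> A \<subseteq> S \<and> emeasure lborel A = ennreal v \<and> v0 \<le> v \<and>
       (\<forall>y\<in>A. \<forall>t. 0 < t \<and> t \<le> 1 \<longrightarrow> x + t *\<^sub>R (y - x) \<in> A)"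
    using cone_property_star[OF S(3)] by metis
  obtain R0 where R0: "\<And>x. x \<in> S \<Longrightarrow> norm x \<le> R0" using S(2) by (auto simp: bounded_iff)
  \<comment> \<open>2 R0 bounds all distances between points of S, and the maximum with 1 secures R
    \<ge> 1.\<close>
  define R where "R = max 1 (2 * R0)"
  have R: "R \<ge> 1" "\<And>x y. x \<in> S \<Longrightarrow> y \<in> S \<Longrightarrow> norm (y - x) \<le> R"
  proof -
    show "norm (y - x) \<le> R" if "x \<in> S" "y \<in> S" for x y
      using R0[OF that(1)] R0[OF that(2)] norm_triangle_ineq4[of y x] by (simp add: R_def)
  qed (simp add: R_def)
  \<comment> \<open>The order l varies with \<alpha>, so all orders up to k are summed; absolute
    values make the terms with l \<le> d / 2 harmless, and the 1 makes C positive.\<close>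
  define C where "C = 1 + (\<Sum>l\<le>k. \<bar>sobolev_const CARD('d) R v0 l\<bar>)"
  have "C > 0" unfolding C_def by (rule add_pos_nonneg) (auto intro: sum_nonneg)
  moreover have "\<bar>cderiv \<alpha> u x\<bar> \<le> C"
    if u: "u \<in> Ck_uniform k S" and s: "real k - real CARD('d) / 2 > real s" and \<alpha>: "mi_order \<alpha> \<le> s"
      and n: "\<And>\<beta>. mi_order \<beta> \<le> k \<Longrightarrow> (LINT z|lebesgue_on S. (cderiv \<beta> u z)\<^sup>2) \<le> 1" and x: "x \<in> S"
    for u s x \<alpha>
  proof -
    define l where "l = k - mi_order \<alpha>"
    have sk: "s < k" using s by (simp add: field_simps)
    have \<alpha>l: "mi_order \<alpha> + l \<le> k" using \<alpha> sk by (simp add: l_def)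
    have l: "real l > real CARD('d) / 2" using s \<alpha> sk by (simp add: l_def of_nat_diff)
    obtain A v where A: "open A" "A \<subseteq> S" "emeasure lborel A = ennreal v" and vv: "v0 \<le> v" and A':
      "\<And>y t. y \<in> A \<Longrightarrow> 0 < t \<Longrightarrow> t \<le> 1 \<Longrightarrow> x + t *\<^sub>R (y - x) \<in> A"
      using v(2)[OF x] by blast
    have S': "S \<inter> space lebesgue \<in> sets lebesgue" using S by simp
    have "v > 0" using v(1) vv by simp
    have "\<bar>cderiv \<alpha> u x\<bar> \<le> sobolev_const CARD('d) R v l"
    proof (rule sobolev_inequality_star[OF S(1,2) cderiv_Ck_uniform[OF S(1) u \<alpha>l] l _ x R(1) R(2)[OF x] A _ A'])
      fix \<beta> :: "'d multi_index" assume \<beta>: "mi_order \<beta> \<le> l"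
      have "mi_order (\<alpha> + \<beta>) \<le> k" using \<alpha>l \<beta> by (simp add: mi_order_add)
      note \<gamma> = n[OF this] cderiv_L2[OF S(1,2) u this]
      have "uniformly_continuous_on S (cderiv (\<alpha> + \<beta>) u)"
        using u \<open>mi_order (\<alpha> + \<beta>) \<le> k\<close> by (simp add: Ck_uniform_def)
      then have "continuous_on S (cderiv (\<alpha> + \<beta>) u)" by (rule uniformly_continuous_imp_continuous)
      from borel_measurable_continuous_on_restrict[OF this]
      have "(\<lambda>z. indicator S z *\<^sub>R cderiv (\<alpha> + \<beta>) u z) \<in> borel_measurable borel"
        by (subst (asm) borel_measurable_restrict_space_iff) (use S(1) in simp_all)
      then have m: "(\<lambda>z. ennreal ((indicator S z *\<^sub>R cderiv (\<alpha> + \<beta>) u z)\<^sup>2)) \<in> borel_measurable lborel" by measurable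
      have "(\<integral>\<^sup>+z\<in>S. ennreal ((cderiv \<beta> (cderiv \<alpha> u) z)\<^sup>2) \<partial>lborel) = (\<integral>\<^sup>+z. ennreal ((indicator S z *\<^sub>R cderiv (\<alpha> + \<beta>) u z)\<^sup>2) \<partial>lborel)"
        by (rule nn_integral_cong) (auto simp: indicator_def cderiv_cderiv[OF S(1) u \<alpha>l \<beta>])
      also have "\<dots> = (\<integral>\<^sup>+z. ennreal ((indicator S z *\<^sub>R cderiv (\<alpha> + \<beta>) u z)\<^sup>2) \<partial>lebesgue)"
        by (simp only: nn_integral_completion)
      also have "\<dots> = (\<integral>\<^sup>+z. ennreal ((cderiv (\<alpha> + \<beta>) u z)\<^sup>2) \<partial>lebesgue_on S)"
        by (subst nn_integral_restrict_space[OF S']) (auto simp: indicator_def intro!: nn_integral_cong)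
      also have "\<dots> = ennreal (LINT z|lebesgue_on S. (cderiv (\<alpha> + \<beta>) u z)\<^sup>2)"
        by (rule nn_integral_eq_integral) (use \<gamma>(2) in \<open>auto simp: L2_def\<close>)
      also have "\<dots> \<le> 1" using \<gamma>(1) by (simp add: ennreal_le_1)
      finally show "(\<integral>\<^sup>+z\<in>S. ennreal ((cderiv \<beta> (cderiv \<alpha> u) z)\<^sup>2) \<partial>lborel) \<le> 1" .
    qed (use \<open>v > 0\<close> in auto)
    also have "\<dots> \<le> sobolev_const CARD('d) R v0 l"
      by (rule sobolev_const_antimono[OF v(1) vv _ l]) (use R(1) in simp)
    also have "\<dots> \<le> (\<Sum>l\<le>k. \<bar>sobolev_const CARD('d) R v0 l\<bar>)"
    proof (rule order_trans[OF abs_ge_self])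
      show "\<bar>sobolev_const CARD('d) R v0 l\<bar> \<le> (\<Sum>l\<le>k. \<bar>sobolev_const CARD('d) R v0 l\<bar>)"
        by (rule member_le_sum) (auto simp: l_def)
    qed
    finally show ?thesis by (simp add: C_def)
  qed
  ultimately show ?thesis using that by blast
qed

section \<open>Compact positive operators on square integrable functions\<close>

text \<open>Functions that agree almost everywhere are not identified, so linearity is demanded
  pointwise on the space. Compactness is sequential and in mean square, with a limit that is again
  in \<open>l2 N\<close>.\<close>

locale compact_psd_operator =
  fixes N :: "'z measure" and T :: "('z \<Rightarrow> real) \<Rightarrow> 'z \<Rightarrow> real" and B :: real
  assumes T_l2: "f \<in> l2 N \<Longrightarrow> T f \<in> l2 N"
    and T_add: "f \<in> l2 N \<Longrightarrow> g \<in> l2 N \<Longrightarrow> z \<in> space N \<Longrightarrow> T (\<lambda>z. f z + c * g z) z = T f z + c * T g z"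
    and T_sym: "f \<in> l2 N \<Longrightarrow> g \<in> l2 N \<Longrightarrow> (LINT z|N. T f z * g z) = (LINT z|N. T g z * f z)"
    and T_pos: "f \<in> l2 N \<Longrightarrow> 0 \<le> (LINT z|N. T f z * f z)"
    and T_bd: "f \<in> l2 N \<Longrightarrow> (LINT z|N. (T f z)\<^sup>2) \<le> B\<^sup>2 * (LINT z|N. (f z)\<^sup>2)"
    and B_nonneg: "0 \<le> B"
    and T_compact: "(\<And>n. fs n \<in> l2 N) \<Longrightarrow> (\<And>n. (LINT z|N. (fs n z)\<^sup>2) \<le> 1) \<Longrightarrow>
      \<exists>r g. strict_mono (r :: nat \<Rightarrow> nat) \<and> g \<in> l2 N \<and> (\<lambda>i. LINT z|N. (T (fs (r i)) z - g z)\<^sup>2) \<longlonglongrightarrow> 0"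
begin

definition ip :: "('z \<Rightarrow> real) \<Rightarrow> ('z \<Rightarrow> real) \<Rightarrow> real" where
  "ip f g = (LINT z|N. f z * g z)"

lemma ip_commute: "ip f g = ip g f"
  by (simp add: ip_def mult.commute)

lemma ip_self: "ip f f = (LINT z|N. (f z)\<^sup>2)"
  by (simp add: ip_def power2_eq_square)

lemma ip_nonneg: "0 \<le> ip f f"
  by (simp add: ip_self)

lemma ip_cong: "(\<And>z. z \<in> space N \<Longrightarrow> f z = f' z) \<Longrightarrow> (\<And>z. z \<in> space N \<Longrightarrow> g z = g' z) \<Longrightarrow> ip f g = ip f' g'"
  unfolding ip_def by (rule Bochner_Integration.integral_cong) auto

lemma ip_add: "f \<in> l2 N \<Longrightarrow> g \<in> l2 N \<Longrightarrow> h \<in> l2 N \<Longrightarrow> ip (\<lambda>z. f z + c * g z) h = ip f h + c * ip g h"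
proof -
  assume "f \<in> l2 N" "g \<in> l2 N" "h \<in> l2 N"
  note i = l2_integrable_mult[OF this(1,3)] l2_integrable_mult[OF this(2,3)]
  have "(\<lambda>z. (f z + c * g z) * h z) = (\<lambda>z. f z * h z + c * (g z * h z))"
    by (simp add: distrib_right mult.assoc)
  then show ?thesis using i by (simp add: ip_def)
qed

lemma ip_add_right: "f \<in> l2 N \<Longrightarrow> g \<in> l2 N \<Longrightarrow> h \<in> l2 N \<Longrightarrow> ip h (\<lambda>z. f z + c * g z) = ip h f + c * ip h g"
  using ip_add[of f g h c] by (simp only: ip_commute[of h])

lemma ip_square_add:
  assumes "f \<in> l2 N" "g \<in> l2 N"
  shows "ip (\<lambda>z. f z + c * g z) (\<lambda>z. f z + c * g z) = ip f f + 2 * c * ip f g + c\<^sup>2 * ip g g"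
  using ip_add[OF assms l2_add_scale[OF assms], of c c] ip_add_right[OF assms assms(1), of c] ip_add_right[OF assms assms(2), of c]
    ip_commute[of g f]
  by (simp add: power2_eq_square algebra_simps)

lemma T_ip_add:
  assumes "f \<in> l2 N" "g \<in> l2 N" "h \<in> l2 N"
  shows "ip (T (\<lambda>z. f z + c * g z)) h = ip (T f) h + c * ip (T g) h"
proof -
  have "ip (T (\<lambda>z. f z + c * g z)) h = ip (\<lambda>z. T f z + c * T g z) h"
    by (rule ip_cong) (use T_add assms in auto)
  then show ?thesis by (simp add: ip_add T_l2 assms)
qed

lemma ip_cauchy_schwarz: "f \<in> l2 N \<Longrightarrow> g \<in> l2 N \<Longrightarrow> (ip f g)\<^sup>2 \<le> ip f f * ip g g"
  unfolding ip_self unfolding ip_def by (rule l2_cauchy_schwarz)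

text \<open>A semidefinite form obeys Cauchy-Schwarz. With g = T f it bounds the norm of T f by
  values of the form, and that is its use below.\<close>

lemma form_cauchy_schwarz:
  assumes f: "f \<in> l2 N" and g: "g \<in> l2 N"
  shows "(ip (T f) g)\<^sup>2 \<le> ip (T f) f * ip (T g) g"
proof (rule quadratic_form_cauchy_schwarz)
  fix t :: real
  let ?h = "\<lambda>z. f z + t * g z"
  have h: "?h \<in> l2 N" by (rule l2_add_scale[OF f g])
  have s: "ip (T g) f = ip (T f) g" using T_sym[OF f g] by (simp add: ip_def)
  have "ip (T ?h) ?h = ip (T f) ?h + t * ip (T g) ?h" by (rule T_ip_add[OF f g h])
  also have "\<dots> = ip (T f) f + 2 * t * ip (T f) g + t\<^sup>2 * ip (T g) g"
    using ip_add_right[OF f g T_l2[OF f], of t] ip_add_right[OF f g T_l2[OF g], of t] s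
    by (simp add: power2_eq_square algebra_simps)
  finally show "0 \<le> ip (T f) f + 2 * t * ip (T f) g + t\<^sup>2 * ip (T g) g"
    using T_pos[OF h] by (simp add: ip_def)
qed (use T_pos[OF g] in \<open>simp add: ip_def\<close>)

lemma form_le:
  assumes "f \<in> l2 N"
  shows "ip (T f) f \<le> B * ip f f"
proof -
  have "(ip (T f) f)\<^sup>2 \<le> ip (T f) (T f) * ip f f"
    by (rule ip_cauchy_schwarz[OF T_l2[OF assms] assms])
  also have "\<dots> \<le> (B\<^sup>2 * ip f f) * ip f f"
    using T_bd[OF assms] by (intro mult_right_mono ip_nonneg) (simp add: ip_self)
  also have "\<dots> = (B * ip f f)\<^sup>2" by (simp add: power2_eq_square)
  finally show ?thesis
    by (rule power2_le_imp_le) (simp add: B_nonneg ip_nonneg)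
qed

text \<open>A triangle inequality for squared norms, at the price of the factor 3.\<close>

lemma ip_tri3:
  assumes "f \<in> l2 N" "g \<in> l2 N" "h \<in> l2 N"
  shows "ip (\<lambda>z. f z + g z + h z) (\<lambda>z. f z + g z + h z) \<le> 3 * (ip f f + ip g g + ip h h)"
proof -
  have sq: "(a + b + c)\<^sup>2 \<le> 3 * (a\<^sup>2 + b\<^sup>2 + c\<^sup>2)" for a b c :: real
    using zero_le_power2[of "a - b"] zero_le_power2[of "b - c"] zero_le_power2[of "a - c"]
    by (simp add: power2_eq_square algebra_simps)
  have i: "integrable N (\<lambda>z. (f z)\<^sup>2)" "integrable N (\<lambda>z. (g z)\<^sup>2)" "integrable N (\<lambda>z. (h z)\<^sup>2)"
    using assms by (auto simp: l2_def)
  have "(\<lambda>z. f z + g z + h z) \<in> l2 N"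
    using l2_add_scale[OF l2_add_scale[OF assms(1,2), of 1] assms(3), of 1] by simp
  then have "integrable N (\<lambda>z. (f z + g z + h z)\<^sup>2)" by (simp add: l2_def)
  then have "(LINT z|N. (f z + g z + h z)\<^sup>2) \<le> (LINT z|N. 3 * ((f z)\<^sup>2 + (g z)\<^sup>2 + (h z)\<^sup>2))"
    by (rule integral_mono) (use i sq in auto)
  then show ?thesis using i by (simp add: ip_self)
qed

text \<open>The supremum of the quadratic form over the unit ball of an invariant closed subspace is an
  eigenvalue: by compactness the images of a maximising sequence have a limit point, which
  turns out to be an eigenvector.\<close>

lemma form_bounded_by_eigenvalues:
  assumes W: "W \<subseteq> l2 N" and W_lin: "\<And>f g c. f \<in> W \<Longrightarrow> g \<in> W \<Longrightarrow> (\<lambda>z. f z + c * g z) \<in> W"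
    and W_T: "\<And>f. f \<in> W \<Longrightarrow> T f \<in> W"
    and W_closed: "\<And>f g. (\<And>i::nat. f i \<in> W) \<Longrightarrow> g \<in> l2 N \<Longrightarrow> (\<lambda>i. LINT z|N. (f i z - g z)\<^sup>2) \<longlonglongrightarrow> 0 \<Longrightarrow> g \<in> W"
    and r: "0 \<le> r"
    and no_eigen: "\<And>f \<mu>. f \<in> W \<Longrightarrow> \<mu> > r \<Longrightarrow> (LINT z|N. (T f z - \<mu> * f z)\<^sup>2) = 0 \<Longrightarrow> (LINT z|N. (f z)\<^sup>2) = 0"
    and f: "f \<in> W"
  shows "ip (T f) f \<le> r * ip f f"
proof (rule ccontr)
  assume "\<not> ?thesis"
  then have gt: "ip (T f) f > r * ip f f" by simp
  have Wl: "g \<in> l2 N" if "g \<in> W" for g using W that by blast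
  \<comment> \<open>The multiple c g is written as g + (c - 1) g, the shape of the closure
    assumption.\<close>
  have W_sc: "(\<lambda>z. c * g z) \<in> W" if "g \<in> W" for c g
    using W_lin[OF that that, of "c - 1"] by (simp add: algebra_simps)
  have sc: "ip (T (\<lambda>z. c * g z)) (\<lambda>z. c * g z) = c\<^sup>2 * ip (T g) g"
    "ip (\<lambda>z. c * g z) (\<lambda>z. c * g z) = c\<^sup>2 * ip g g" if g: "g \<in> W" for c g
  proof -
    have gl: "g \<in> l2 N" using Wl[OF g] .
    have "ip (T (\<lambda>z. c * g z)) (\<lambda>z. c * g z) = ip (T (\<lambda>z. g z + (c - 1) * g z)) (\<lambda>z. c * g z)"
      by (simp add: algebra_simps)
    also have "\<dots> = c * ip (T g) (\<lambda>z. c * g z)"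
      using T_ip_add[OF gl gl l2_scale[OF gl], of "c - 1" c] by (simp add: algebra_simps)
    also have "\<dots> = c\<^sup>2 * ip (T g) g"
      by (simp add: ip_def power2_eq_square mult.assoc mult.left_commute)
    finally show "ip (T (\<lambda>z. c * g z)) (\<lambda>z. c * g z) = c\<^sup>2 * ip (T g) g" .
    show "ip (\<lambda>z. c * g z) (\<lambda>z. c * g z) = c\<^sup>2 * ip g g"
      by (simp add: ip_self power_mult_distrib)
  qed
  define \<A> where "\<A> = {ip (T g) g | g. g \<in> W \<and> ip g g \<le> 1}"
  define \<rho> where "\<rho> = Sup \<A>"
  have bdd: "bdd_above \<A>"
  proof (rule bdd_aboveI)
    fix x assume "x \<in> \<A>"
    then obtain g where g: "g \<in> W" "ip g g \<le> 1" "x = ip (T g) g" by (auto simp: \<A>_def)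
    have "x \<le> B * ip g g" using form_le[OF Wl[OF g(1)]] g(3) by simp
    also have "\<dots> \<le> B * 1" using g(2) B_nonneg by (rule mult_left_mono)
    finally show "x \<le> B" by simp
  qed
  \<comment> \<open>If f were null, the bound by B would force the form to be at most 0 at f,
    against the assumed strict inequality.\<close>
  have fpos: "ip f f > 0"
  proof (rule ccontr)
    assume "\<not> ?thesis"
    then have "ip f f = 0" using ip_nonneg[of f] by linarith
    then show False using form_le[OF Wl[OF f]] gt by simp
  qed
  have \<rho>r: "\<rho> > r"
  proof -
    let ?c = "1 / sqrt (ip f f)"
    have c2: "?c\<^sup>2 = 1 / ip f f" using fpos by (simp add: power_divide)
    have "ip (T (\<lambda>z. ?c * f z)) (\<lambda>z. ?c * f z) \<in> \<A>"
      unfolding \<A>_def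
    proof (intro CollectI exI conjI)
      show "(\<lambda>z. ?c * f z) \<in> W" by (rule W_sc[OF f])
      show "ip (\<lambda>z. ?c * f z) (\<lambda>z. ?c * f z) \<le> 1" unfolding sc(2)[OF f] c2 using fpos by simp
    qed simp
    then have "1 / ip f f * ip (T f) f \<in> \<A>" unfolding sc(1)[OF f] c2 .
    then have "1 / ip f f * ip (T f) f \<le> \<rho>" unfolding \<rho>_def using bdd by (rule cSup_upper)
    moreover have "r < 1 / ip f f * ip (T f) f" using gt fpos by (simp add: field_simps)
    ultimately show ?thesis by simp
  qed
  then have \<rho>0: "\<rho> > 0" using r by simp
  have le\<rho>1: "ip (T g) g \<le> \<rho>" if "g \<in> W" "ip g g \<le> 1" for g
    unfolding \<rho>_def by (rule cSup_upper[OF _ bdd]) (use that in \<open>auto simp: \<A>_def\<close>)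
  have le\<rho>: "ip (T g) g \<le> \<rho> * ip g g" if g: "g \<in> W" for g
  proof (cases "ip g g = 0")
    case True
    then show ?thesis using form_le[OF Wl[OF g]] by simp
  next
    case False
    then have gp: "ip g g > 0" using ip_nonneg[of g] by linarith
    let ?c = "1 / sqrt (ip g g)"
    have c2: "?c\<^sup>2 = 1 / ip g g" using gp by (simp add: power_divide)
    have "ip (T (\<lambda>z. ?c * g z)) (\<lambda>z. ?c * g z) \<le> \<rho>"
      by (rule le\<rho>1[OF W_sc[OF g]]) (unfold sc(2)[OF g] c2, use gp in simp)
    then show ?thesis unfolding sc(1)[OF g] c2 using gp by (simp add: field_simps)
  qed
  \<comment> \<open>Cauchy-Schwarz for the form between g and T g, divided by the squared norm of T
    g. It makes near-maximisers near-eigenvectors below.\<close>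
  have T\<rho>: "ip (T g) (T g) \<le> \<rho> * ip (T g) g" if g: "g \<in> W" for g
  proof (cases "ip (T g) (T g) = 0")
    case True
    then show ?thesis using T_pos[OF Wl[OF g]] \<rho>0 by (simp add: ip_def)
  next
    case False
    then have p: "ip (T g) (T g) > 0" using ip_nonneg[of "T g"] by linarith
    have "(ip (T g) (T g))\<^sup>2 \<le> ip (T g) g * ip (T (T g)) (T g)"
      by (rule form_cauchy_schwarz[OF Wl[OF g] T_l2[OF Wl[OF g]]])
    also have "\<dots> \<le> ip (T g) g * (\<rho> * ip (T g) (T g))"
      using le\<rho>[OF W_T[OF g]] T_pos[OF Wl[OF g]] by (intro mult_left_mono) (auto simp: ip_def)
    finally show ?thesis using p by (simp add: power2_eq_square mult_ac)
  qed
  have "\<exists>g. g \<in> W \<and> ip g g \<le> 1 \<and> ip (T g) g > \<rho> - 1 / real (Suc n)" for n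
  proof -
    have "\<A> \<noteq> {}"
      using W_sc[OF f, of 0] by (auto simp: \<A>_def ip_def intro!: exI[of _ "\<lambda>_. 0"])
    moreover have "\<rho> - 1 / real (Suc n) < Sup \<A>" by (simp add: \<rho>_def)
    ultimately obtain x where "x \<in> \<A>" "\<rho> - 1 / real (Suc n) < x"
      using less_cSup_iff[OF _ bdd] by blast
    then show ?thesis by (auto simp: \<A>_def)
  qed
  then obtain h where h: "\<And>n. h n \<in> W" "\<And>n. ip (h n) (h n) \<le> 1" "\<And>n. ip (T (h n)) (h n) > \<rho> - 1 / real (Suc n)"
    by metis
  note hl = Wl[OF h(1)]
  have "\<exists>s g. strict_mono (s :: nat \<Rightarrow> nat) \<and> g \<in> l2 N \<and> (\<lambda>i. LINT z|N. (T (h (s i)) z - g z)\<^sup>2) \<longlonglongrightarrow> 0"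
    by (rule T_compact[OF hl]) (use h(2) in \<open>simp add: ip_self\<close>)
  then obtain s g where s: "strict_mono s" and g: "g \<in> l2 N"
    and lim: "(\<lambda>i. LINT z|N. (T (h (s i)) z - g z)\<^sup>2) \<longlonglongrightarrow> 0" by blast
  have gW: "g \<in> W" by (rule W_closed[OF _ g lim]) (rule W_T[OF h(1)])
  have Thl: "T (h n) \<in> l2 N" for n by (rule T_l2[OF hl])
  \<comment> \<open>The defect of \<open>h n\<close> as an eigenvector for \<rho>. Expanding the
    square and using \<open>T\<rho>\<close> bounds it by \<rho> times the gap between \<rho> and the
    value of the form.\<close>
  define e where "e n = ip (\<lambda>z. T (h n) z + (- \<rho>) * h n z) (\<lambda>z. T (h n) z + (- \<rho>) * h n z)" for n
  have e_le: "e n \<le> \<rho> / real (Suc n)" for n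
  proof -
    have "e n = ip (T (h n)) (T (h n)) - 2 * \<rho> * ip (T (h n)) (h n) + \<rho>\<^sup>2 * ip (h n) (h n)"
      unfolding e_def by (subst ip_square_add[OF Thl hl]) simp
    also have "\<dots> \<le> \<rho> * ip (T (h n)) (h n) - 2 * \<rho> * ip (T (h n)) (h n) + \<rho>\<^sup>2 * 1"
      by (intro add_mono diff_mono mult_left_mono T\<rho> h order_refl) auto
    also have "\<dots> = \<rho> * (\<rho> - ip (T (h n)) (h n))" by (simp add: power2_eq_square algebra_simps)
    also have "\<dots> \<le> \<rho> * (1 / real (Suc n))"
      using h(3)[of n] \<rho>0 by (intro mult_left_mono) auto
    finally show ?thesis by simp
  qed
  have e0: "(\<lambda>i. e (s i)) \<longlonglongrightarrow> 0"
  proof -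
    have "(\<lambda>n. \<rho> * inverse (real (Suc n))) \<longlonglongrightarrow> \<rho> * 0"
      by (intro tendsto_mult tendsto_const LIMSEQ_inverse_real_of_nat)
    then have "(\<lambda>n. \<rho> / real (Suc n)) \<longlonglongrightarrow> 0" by (simp add: divide_inverse)
    then have up: "(\<lambda>n. \<rho> / real (Suc n)) \<longlonglongrightarrow> 0" .
    have "e \<longlonglongrightarrow> 0"
    proof (rule tendsto_sandwich[OF _ _ tendsto_const up])
      show "\<forall>\<^sub>F n in sequentially. 0 \<le> e n" unfolding e_def by (intro always_eventually allI ip_nonneg)
      show "\<forall>\<^sub>F n in sequentially. e n \<le> \<rho> / real (Suc n)" by (intro always_eventually allI e_le)
    qed
    then show ?thesis using LIMSEQ_subseq_LIMSEQ[OF _ s, of e] by (simp add: comp_def)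
  qed
  define d where "d i = ip (\<lambda>z. T (h (s i)) z + (- 1) * g z) (\<lambda>z. T (h (s i)) z + (- 1) * g z)" for i
  have d0: "d \<longlonglongrightarrow> 0" using lim by (simp add: d_def[abs_def] ip_self)
  \<comment> \<open>The splitting is T g - \<rho> g = T (g - T h) + T (T h - \<rho> h) + \<rho> (T h
    - g): the outer terms are small by the choice of g, the middle one by the eigenvector
    defect.\<close>
  have "ip (\<lambda>z. T g z - \<rho> * g z) (\<lambda>z. T g z - \<rho> * g z) \<le> 3 * (B\<^sup>2 * d i + B\<^sup>2 * e (s i) + \<rho>\<^sup>2 * d i)" for i
  proof -
    let ?Th = "T (h (s i))"
    let ?u = "\<lambda>z. g z + (- 1) * ?Th z" and ?v = "\<lambda>z. ?Th z + (- \<rho>) * h (s i) z"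
    have ul: "?u \<in> l2 N" and vl: "?v \<in> l2 N" by (intro l2_add_scale g Thl hl)+
    have wl: "(\<lambda>z. ?Th z + (- 1) * g z) \<in> l2 N" by (intro l2_add_scale g Thl hl)
    have u: "ip ?u ?u = d i"
      unfolding d_def ip_self by (rule Bochner_Integration.integral_cong) (auto simp: power2_commute)
    have "ip (\<lambda>z. T g z - \<rho> * g z) (\<lambda>z. T g z - \<rho> * g z) =
      ip (\<lambda>z. T ?u z + T ?v z + \<rho> * (?Th z + (- 1) * g z)) (\<lambda>z. T ?u z + T ?v z + \<rho> * (?Th z + (- 1) * g z))"
    proof (rule ip_cong; rule sym)
      fix z assume z: "z \<in> space N"
      show "T ?u z + T ?v z + \<rho> * (?Th z + (- 1) * g z) = T g z - \<rho> * g z"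
        unfolding T_add[OF g Thl z] T_add[OF Thl hl z] by (simp add: algebra_simps)
      then show "T ?u z + T ?v z + \<rho> * (?Th z + (- 1) * g z) = T g z - \<rho> * g z" .
    qed
    also have "\<dots> \<le> 3 * (ip (T ?u) (T ?u) + ip (T ?v) (T ?v) + ip (\<lambda>z. \<rho> * (?Th z + (- 1) * g z)) (\<lambda>z. \<rho> * (?Th z + (- 1) * g z)))"
      by (intro ip_tri3 T_l2 ul vl l2_scale wl)
    also have "\<dots> \<le> 3 * (B\<^sup>2 * d i + B\<^sup>2 * e (s i) + \<rho>\<^sup>2 * d i)"
    proof (intro mult_left_mono add_mono)
      show "ip (T ?u) (T ?u) \<le> B\<^sup>2 * d i" using T_bd[OF ul] unfolding ip_self[symmetric] u .
      show "ip (T ?v) (T ?v) \<le> B\<^sup>2 * e (s i)" using T_bd[OF vl] unfolding ip_self[symmetric] e_def .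
      show "ip (\<lambda>z. \<rho> * (?Th z + (- 1) * g z)) (\<lambda>z. \<rho> * (?Th z + (- 1) * g z)) \<le> \<rho>\<^sup>2 * d i"
        unfolding d_def ip_self power_mult_distrib by simp
    qed simp
    finally show ?thesis .
  qed
  moreover have "(\<lambda>i. 3 * (B\<^sup>2 * d i + B\<^sup>2 * e (s i) + \<rho>\<^sup>2 * d i)) \<longlonglongrightarrow> 3 * (B\<^sup>2 * 0 + B\<^sup>2 * 0 + \<rho>\<^sup>2 * 0)"
    by (intro tendsto_intros d0 e0)
  ultimately have "ip (\<lambda>z. T g z - \<rho> * g z) (\<lambda>z. T g z - \<rho> * g z) \<le> 3 * (B\<^sup>2 * 0 + B\<^sup>2 * 0 + \<rho>\<^sup>2 * 0)"
    by (intro LIMSEQ_le_const) auto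
  then have "ip (\<lambda>z. T g z - \<rho> * g z) (\<lambda>z. T g z - \<rho> * g z) = 0"
    using ip_nonneg[of "\<lambda>z. T g z - \<rho> * g z"] by simp
  then have "(LINT z|N. (T g z - \<rho> * g z)\<^sup>2) = 0" by (simp only: ip_self)
  then have g0: "ip g g = 0" unfolding ip_self by (rule no_eigen[OF gW \<rho>r])
  \<comment> \<open>As g is null, T h tends to 0 in mean square along the subsequence. The values of
    the form, which eventually exceed \<rho> / 2, contradict this.\<close>
  have "ip (T (h (s i))) (T (h (s i))) \<le> 3 * (d i + ip g g + 0)" for i
  proof -
    have "ip (\<lambda>z. (T (h (s i)) z + (- 1) * g z) + g z + 0) (\<lambda>z. (T (h (s i)) z + (- 1) * g z) + g z + 0)
      \<le> 3 * (d i + ip g g + ip (\<lambda>_. 0) (\<lambda>_. 0))"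
      unfolding d_def by (intro ip_tri3 l2_add_scale Thl g l2_zero)
    then show ?thesis by (simp add: ip_def)
  qed
  then have Th_le: "ip (T (h (s i))) (T (h (s i))) \<le> 3 * d i" for i using g0 by simp
  have a_le: "(ip (T (h (s i))) (h (s i)))\<^sup>2 \<le> 3 * d i" for i
  proof -
    have "(ip (T (h (s i))) (h (s i)))\<^sup>2 \<le> ip (T (h (s i))) (T (h (s i))) * ip (h (s i)) (h (s i))"
      by (rule ip_cauchy_schwarz[OF Thl hl])
    also have "\<dots> \<le> ip (T (h (s i))) (T (h (s i))) * 1"
      by (intro mult_left_mono h ip_nonneg)
    finally show ?thesis using Th_le[of i] by simp
  qed
  have "\<forall>\<^sub>F i in sequentially. 3 * d i < (\<rho> / 2)\<^sup>2"
  proof -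
    have "(\<lambda>i. 3 * d i) \<longlonglongrightarrow> 3 * 0" by (intro tendsto_intros d0)
    then show ?thesis by (rule order_tendstoD(2)) (use \<rho>0 in simp)
  qed
  moreover have "\<forall>\<^sub>F i in sequentially. 1 / real (Suc (s i)) < \<rho> / 2"
  proof -
    have "(\<lambda>i. inverse (real (Suc (s i)))) \<longlonglongrightarrow> 0"
      using LIMSEQ_subseq_LIMSEQ[OF LIMSEQ_inverse_real_of_nat s] by (simp add: comp_def)
    from order_tendstoD(2)[OF this, of "\<rho> / 2"] show ?thesis using \<rho>0 by (simp add: inverse_eq_divide)
  qed
  ultimately have "\<forall>\<^sub>F i in sequentially. 3 * d i < (\<rho> / 2)\<^sup>2 \<and> 1 / real (Suc (s i)) < \<rho> / 2"
    by (rule eventually_conj)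
  then obtain i where i: "3 * d i < (\<rho> / 2)\<^sup>2" "1 / real (Suc (s i)) < \<rho> / 2"
    using eventually_happens'[OF sequentially_bot] by blast
  have "ip (T (h (s i))) (h (s i)) > \<rho> / 2" using h(3)[of "s i"] i(2) by linarith
  then have "(ip (T (h (s i))) (h (s i)))\<^sup>2 > (\<rho> / 2)\<^sup>2" using \<rho>0 by (intro power_strict_mono) auto
  then show False using a_le[of i] i(1) by linarith
qed

text \<open>Cauchy-Schwarz for the form between f and T f, divided by the squared norm of T f. The
  form bound is asked for at f and T f alone, so the lemma works inside an invariant
  subspace.\<close>

lemma norm_bounded_by_form:
  assumes f: "f \<in> l2 N" and 1: "ip (T f) f \<le> r * ip f f" and 2: "ip (T (T f)) (T f) \<le> r * ip (T f) (T f)"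
  shows "ip (T f) (T f) \<le> r\<^sup>2 * ip f f"
proof (cases "ip (T f) (T f) = 0")
  case False
  then have p: "ip (T f) (T f) > 0" using ip_nonneg[of "T f"] by linarith
  have "(ip (T f) (T f))\<^sup>2 \<le> ip (T f) f * ip (T (T f)) (T f)"
    by (rule form_cauchy_schwarz[OF f T_l2[OF f]])
  also have "\<dots> \<le> (r * ip f f) * (r * ip (T f) (T f))"
    by (rule mult_mono[OF 1 2]) (use T_pos[OF f] 1 T_pos[OF T_l2[OF f]] in \<open>auto simp: ip_def\<close>)
  finally show ?thesis using p by (simp add: power2_eq_square mult_ac)
qed (simp add: ip_nonneg)

end

section \<open>Second-order processes and their covariance operators\<close>

locale second_order_process = N: finite_measure N + M: prob_space M
  for N :: "'z measure" and M :: "'w measure" +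
  fixes Y :: "'z \<Rightarrow> 'w \<Rightarrow> real" and B :: real
  assumes Y_measurable: "(\<lambda>p. Y (fst p) (snd p)) \<in> borel_measurable (N \<Otimes>\<^sub>M M)"
    and Y_square: "z \<in> space N \<Longrightarrow> integrable M (\<lambda>\<omega>. (Y z \<omega>)\<^sup>2)"
    and Y_bound: "z \<in> space N \<Longrightarrow> (LINT \<omega>|M. (Y z \<omega>)\<^sup>2) \<le> B"
begin

sublocale pair_sigma_finite N M ..

definition K :: "'z \<Rightarrow> 'z \<Rightarrow> real" where
  "K w z = (LINT \<omega>|M. Y w \<omega> * Y z \<omega>)"

definition T :: "('z \<Rightarrow> real) \<Rightarrow> 'z \<Rightarrow> real" where
  "T f z = (LINT w|N. K w z * f w)"

text \<open>The pairing of a path with f. T factors as this map into L2 of the probability space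
  followed by its adjoint, which sends \<eta> to z \<mapsto> E[\<eta> Y_z].\<close>

definition coef :: "('z \<Rightarrow> real) \<Rightarrow> 'w \<Rightarrow> real" where
  "coef f \<omega> = (LINT z|N. Y z \<omega> * f z)"

lemma B_nonneg: "z \<in> space N \<Longrightarrow> 0 \<le> B"
  using Y_bound[of z] by (meson Bochner_Integration.integral_nonneg order_trans zero_le_power2)

lemma one_l2_N: "(\<lambda>_. 1) \<in> l2 N"
  by (rule l2_bounded[OF N.finite_measure_axioms, of _ 1]) auto

lemma one_l2_M: "(\<lambda>_. 1) \<in> l2 M"
  by (rule l2_bounded[OF M.finite_measure_axioms, of _ 1]) auto

lemma Y_section_measurable: "z \<in> space N \<Longrightarrow> Y z \<in> borel_measurable M"
  using measurable_compose[OF measurable_Pair1' Y_measurable, of z] by simp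

lemma path_measurable: "\<omega> \<in> space M \<Longrightarrow> (\<lambda>z. Y z \<omega>) \<in> borel_measurable N"
  using measurable_compose[OF measurable_Pair2' Y_measurable, of \<omega>] by simp

lemma Y_l2: "z \<in> space N \<Longrightarrow> Y z \<in> l2 M"
  using Y_section_measurable Y_square by (simp add: l2_def)

lemma Y_product_l2: "(\<lambda>p. Y (fst p) (snd p)) \<in> l2 (N \<Otimes>\<^sub>M M)"
proof -
  have m: "(\<lambda>p. (Y (fst p) (snd p))\<^sup>2) \<in> borel_measurable (N \<Otimes>\<^sub>M M)"
    using Y_measurable by measurable
  have "integrable (N \<Otimes>\<^sub>M M) (\<lambda>p. (Y (fst p) (snd p))\<^sup>2)"
  proof (rule Fubini_integrable[OF m])
    have "(\<lambda>z. LINT \<omega>|M. (Y z \<omega>)\<^sup>2) \<in> borel_measurable N"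
      using M.borel_measurable_lebesgue_integral[of "\<lambda>z \<omega>. (Y z \<omega>)\<^sup>2" N] m by (simp add: split_beta')
    then have "integrable N (\<lambda>z. LINT \<omega>|M. (Y z \<omega>)\<^sup>2)"
      by (intro N.integrable_const_bound[where B = B]) (auto intro!: AE_I2 Y_bound)
    then show "integrable N (\<lambda>z. LINT \<omega>|M. norm ((Y (fst (z, \<omega>)) (snd (z, \<omega>)))\<^sup>2))" by simp
    show "AE z in N. integrable M (\<lambda>\<omega>. (Y (fst (z, \<omega>)) (snd (z, \<omega>)))\<^sup>2)"
      using Y_square by auto
  qed
  then show ?thesis using Y_measurable by (simp add: l2_def)
qed

lemma path_l2: "AE \<omega> in M. (\<lambda>z. Y z \<omega>) \<in> l2 N"
  and path_norm_integrable: "integrable M (\<lambda>\<omega>. LINT z|N. (Y z \<omega>)\<^sup>2)"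
  and path_norm_expectation: "(LINT \<omega>|M. LINT z|N. (Y z \<omega>)\<^sup>2) = (LINT z|N. K z z)"
  and K_diag_integrable: "integrable N (\<lambda>z. K z z)"
proof -
  have i: "integrable (N \<Otimes>\<^sub>M M) (\<lambda>(z, \<omega>). (Y z \<omega>)\<^sup>2)"
    using Y_product_l2 by (simp add: l2_def split_beta')
  show "AE \<omega> in M. (\<lambda>z. Y z \<omega>) \<in> l2 N"
    using AE_integrable_snd[OF i] AE_space
    by eventually_elim (simp add: l2_def path_measurable)
  show "integrable M (\<lambda>\<omega>. LINT z|N. (Y z \<omega>)\<^sup>2)" by (rule integrable_snd[OF i])
  show "(LINT \<omega>|M. LINT z|N. (Y z \<omega>)\<^sup>2) = (LINT z|N. K z z)"
    using Fubini_integral[OF i] by (simp add: K_def power2_eq_square)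
  show "integrable N (\<lambda>z. K z z)"
    using integrable_fst[OF i] by (simp add: K_def power2_eq_square)
qed

lemma tensor_l2:
  assumes "\<eta> \<in> l2 M" "f \<in> l2 N"
  shows "(\<lambda>p. \<eta> (snd p) * f (fst p)) \<in> l2 (N \<Otimes>\<^sub>M M)"
proof -
  have m [measurable]: "\<eta> \<in> borel_measurable M" "f \<in> borel_measurable N" using assms by (auto simp: l2_def)
  have "integrable (N \<Otimes>\<^sub>M M) (\<lambda>p. (\<eta> (snd p) * f (fst p))\<^sup>2)"
  proof (rule Fubini_integrable)
    show "integrable N (\<lambda>z. LINT \<omega>|M. norm ((\<eta> (snd (z, \<omega>)) * f (fst (z, \<omega>)))\<^sup>2))"
      using assms by (simp add: l2_def power_mult_distrib)
    show "AE z in N. integrable M (\<lambda>\<omega>. (\<eta> (snd (z, \<omega>)) * f (fst (z, \<omega>)))\<^sup>2)"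
      using assms by (simp add: l2_def power_mult_distrib)
  qed measurable
  then show ?thesis by (simp add: l2_def)
qed

text \<open>Fubini on the product of both spaces, where the integrand is a product of two square
  integrable functions: Y and the tensor product of \<eta> and f.\<close>

lemma
  assumes "\<eta> \<in> l2 M" "f \<in> l2 N"
  shows integral_coef: "(LINT \<omega>|M. \<eta> \<omega> * coef f \<omega>) = (LINT z|N. f z * (LINT \<omega>|M. \<eta> \<omega> * Y z \<omega>))"
    and integrable_coef: "integrable M (\<lambda>\<omega>. \<eta> \<omega> * coef f \<omega>)"
    and integrable_fubini: "integrable N (\<lambda>z. f z * (LINT \<omega>|M. \<eta> \<omega> * Y z \<omega>))"
proof -
  have i: "integrable (N \<Otimes>\<^sub>M M) (\<lambda>(z, \<omega>). Y z \<omega> * (\<eta> \<omega> * f z))"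
    using l2_integrable_mult[OF Y_product_l2 tensor_l2[OF assms]] by (simp add: split_beta')
  have 1: "(LINT z|N. Y z \<omega> * (\<eta> \<omega> * f z)) = \<eta> \<omega> * coef f \<omega>" for \<omega>
  proof -
    have "(\<lambda>z. Y z \<omega> * (\<eta> \<omega> * f z)) = (\<lambda>z. \<eta> \<omega> * (Y z \<omega> * f z))" by (simp add: mult_ac)
    then show ?thesis by (simp add: coef_def)
  qed
  have 2: "(LINT \<omega>|M. Y z \<omega> * (\<eta> \<omega> * f z)) = f z * (LINT \<omega>|M. \<eta> \<omega> * Y z \<omega>)" for z
  proof -
    have "(\<lambda>\<omega>. Y z \<omega> * (\<eta> \<omega> * f z)) = (\<lambda>\<omega>. f z * (\<eta> \<omega> * Y z \<omega>))" by (simp add: mult_ac)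
    then show ?thesis by simp
  qed
  show "(LINT \<omega>|M. \<eta> \<omega> * coef f \<omega>) = (LINT z|N. f z * (LINT \<omega>|M. \<eta> \<omega> * Y z \<omega>))"
    using Fubini_integral[OF i] unfolding 1 2 .
  show "integrable M (\<lambda>\<omega>. \<eta> \<omega> * coef f \<omega>)" using integrable_snd[OF i] unfolding 1 .
  show "integrable N (\<lambda>z. f z * (LINT \<omega>|M. \<eta> \<omega> * Y z \<omega>))" using integrable_fst[OF i] unfolding 2 .
qed

text \<open>Cauchy-Schwarz path by path, then expectation; the expected squared norm of a path is
  the trace.\<close>

lemma coef_l2: "coef f \<in> l2 M"
  and coef_bound: "(LINT \<omega>|M. (coef f \<omega>)\<^sup>2) \<le> (LINT z|N. K z z) * (LINT z|N. (f z)\<^sup>2)"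
  if f: "f \<in> l2 N"
proof -
  have m: "coef f \<in> borel_measurable M"
    using integrable_coef[OF one_l2_M f] by auto
  have le: "AE \<omega> in M. (coef f \<omega>)\<^sup>2 \<le> (LINT z|N. (Y z \<omega>)\<^sup>2) * (LINT z|N. (f z)\<^sup>2)"
    using path_l2
  proof eventually_elim
    case (elim \<omega>)
    then show ?case unfolding coef_def by (rule l2_cauchy_schwarz[OF _ f])
  qed
  have i: "integrable M (\<lambda>\<omega>. (LINT z|N. (Y z \<omega>)\<^sup>2) * (LINT z|N. (f z)\<^sup>2))"
    using path_norm_integrable by simp
  have i2: "integrable M (\<lambda>\<omega>. (coef f \<omega>)\<^sup>2)"
    by (rule Bochner_Integration.integrable_bound[OF i]) (use m le in auto)
  then show "coef f \<in> l2 M" using m by (simp add: l2_def)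
  have "(LINT \<omega>|M. (coef f \<omega>)\<^sup>2) \<le> (LINT \<omega>|M. (LINT z|N. (Y z \<omega>)\<^sup>2) * (LINT z|N. (f z)\<^sup>2))"
    by (rule integral_mono_AE[OF i2 i le])
  then show "(LINT \<omega>|M. (coef f \<omega>)\<^sup>2) \<le> (LINT z|N. K z z) * (LINT z|N. (f z)\<^sup>2)"
    by (simp add: path_norm_expectation)
qed

lemma T_eq:
  assumes "f \<in> l2 N" "z \<in> space N"
  shows "T f z = (LINT \<omega>|M. Y z \<omega> * coef f \<omega>)"
  unfolding integral_coef[OF Y_l2[OF assms(2)] assms(1)] T_def K_def by (simp add: mult.commute)

text \<open>The form of T is a mixed second moment of coefficients, from which symmetry and
  positivity are read off.\<close>

lemma T_ip:
  assumes f: "f \<in> l2 N" and g: "g \<in> l2 N"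
  shows "(LINT z|N. T f z * g z) = (LINT \<omega>|M. coef f \<omega> * coef g \<omega>)"
  unfolding integral_coef[OF coef_l2[OF f] g]
  by (rule Bochner_Integration.integral_cong) (auto simp: T_eq[OF f] mult.commute)

lemma K_section_l2: "z \<in> space N \<Longrightarrow> (\<lambda>w. K w z) \<in> l2 N"
proof (rule l2_bounded[OF N.finite_measure_axioms])
  assume z: "z \<in> space N"
  show "(\<lambda>w. K w z) \<in> borel_measurable N"
    using integrable_fubini[OF Y_l2[OF z] one_l2_N] by (auto simp: K_def mult.commute)
  fix w assume w: "w \<in> space N"
  have "(K w z)\<^sup>2 \<le> (LINT \<omega>|M. (Y w \<omega>)\<^sup>2) * (LINT \<omega>|M. (Y z \<omega>)\<^sup>2)"
    unfolding K_def by (rule l2_cauchy_schwarz) (intro Y_l2 w z)+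
  also have "\<dots> \<le> B * B" by (intro mult_mono Y_bound w z B_nonneg[OF z]) simp
  finally have "\<bar>K w z\<bar>\<^sup>2 \<le> B\<^sup>2" by (simp add: power2_eq_square)
  then show "\<bar>K w z\<bar> \<le> B" by (rule power2_le_imp_le) (rule B_nonneg[OF z])
qed

lemma T_add:
  assumes "f \<in> l2 N" "g \<in> l2 N" "z \<in> space N"
  shows "T (\<lambda>z. f z + c * g z) z = T f z + c * T g z"
proof -
  have "(\<lambda>w. K w z * (f w + c * g w)) = (\<lambda>w. K w z * f w + c * (K w z * g w))"
    by (simp add: distrib_left mult.left_commute)
  then show ?thesis
    using l2_integrable_mult[OF K_section_l2[OF assms(3)] assms(1)] l2_integrable_mult[OF K_section_l2[OF assms(3)] assms(2)]
    by (simp add: T_def)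
qed

lemma T_pointwise_bound:
  assumes "f \<in> l2 N" "z \<in> space N"
  shows "(T f z)\<^sup>2 \<le> B * (LINT z|N. K z z) * (LINT z|N. (f z)\<^sup>2)"
proof -
  have "(T f z)\<^sup>2 \<le> (LINT \<omega>|M. (Y z \<omega>)\<^sup>2) * (LINT \<omega>|M. (coef f \<omega>)\<^sup>2)"
    unfolding T_eq[OF assms] by (rule l2_cauchy_schwarz[OF Y_l2[OF assms(2)] coef_l2[OF assms(1)]])
  also have "\<dots> \<le> B * ((LINT z|N. K z z) * (LINT z|N. (f z)\<^sup>2))"
    by (intro mult_mono Y_bound coef_bound assms B_nonneg[OF assms(2)]) simp
  finally show ?thesis by (simp add: mult.assoc)
qed

lemma T_measurable: "f \<in> l2 N \<Longrightarrow> T f \<in> borel_measurable N"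
proof -
  assume f: "f \<in> l2 N"
  have "(\<lambda>z. 1 * (LINT \<omega>|M. coef f \<omega> * Y z \<omega>)) \<in> borel_measurable N"
    using integrable_fubini[OF coef_l2[OF f] one_l2_N] by (rule borel_measurable_integrable)
  moreover have "z \<in> space N \<Longrightarrow> T f z = 1 * (LINT \<omega>|M. coef f \<omega> * Y z \<omega>)" for z
    by (simp add: T_eq[OF f] mult.commute)
  ultimately show ?thesis by (simp cong: measurable_cong)
qed

lemma T_l2: "f \<in> l2 N \<Longrightarrow> T f \<in> l2 N"
proof -
  assume f: "f \<in> l2 N"
  define c where "c = B * (LINT z|N. K z z) * (LINT z|N. (f z)\<^sup>2)"
  have "\<bar>T f z\<bar> \<le> sqrt c" if "z \<in> space N" for z
    using T_pointwise_bound[OF f that] by (intro real_le_rsqrt) (simp add: c_def)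
  then show ?thesis by (rule l2_bounded[OF N.finite_measure_axioms T_measurable[OF f]])
qed

lemma coef_square_le: "f \<in> l2 N \<Longrightarrow> (LINT z|N. T f z * f z) = (LINT \<omega>|M. (coef f \<omega>)\<^sup>2)"
  using T_ip[of f f] by (simp add: power2_eq_square)

lemma K_trace_nonneg: "0 \<le> (LINT z|N. K z z)"
  unfolding K_def by (intro Bochner_Integration.integral_nonneg) (auto simp flip: power2_eq_square)

text \<open>With a the squared norm of T f and \<tau> the trace, Cauchy-Schwarz for the coefficients
  bounds a ^ 2 by \<tau> ^ 2 a times the squared norm of f; division by a shows that \<tau> bounds
  the operator norm.\<close>

lemma T_bound:
  assumes f: "f \<in> l2 N"
  shows "(LINT z|N. (T f z)\<^sup>2) \<le> (LINT z|N. K z z)\<^sup>2 * (LINT z|N. (f z)\<^sup>2)"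
proof -
  define \<tau> where "\<tau> = (LINT z|N. K z z)"
  have \<tau>: "\<tau> \<ge> 0" unfolding \<tau>_def by (rule K_trace_nonneg)
  define a where "a = (LINT z|N. (T f z)\<^sup>2)"
  have a: "a \<ge> 0" by (simp add: a_def)
  have "a\<^sup>2 = (LINT \<omega>|M. coef f \<omega> * coef (T f) \<omega>)\<^sup>2"
    unfolding a_def T_ip[OF f T_l2[OF f], symmetric] by (simp add: power2_eq_square)
  also have "\<dots> \<le> (LINT \<omega>|M. (coef f \<omega>)\<^sup>2) * (LINT \<omega>|M. (coef (T f) \<omega>)\<^sup>2)"
    by (rule l2_cauchy_schwarz) (intro coef_l2 f T_l2)+
  also have "\<dots> \<le> (\<tau> * (LINT z|N. (f z)\<^sup>2)) * (\<tau> * a)"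
    unfolding \<tau>_def a_def
    by (intro mult_mono coef_bound f T_l2 mult_nonneg_nonneg K_trace_nonneg) auto
  finally have *: "a * a \<le> (\<tau>\<^sup>2 * (LINT z|N. (f z)\<^sup>2)) * a" by (simp add: power2_eq_square mult_ac)
  show ?thesis
  proof (cases "a = 0")
    case True
    then show ?thesis unfolding a_def by simp
  next
    case False
    then have "a \<le> \<tau>\<^sup>2 * (LINT z|N. (f z)\<^sup>2)" using * a by (simp add: mult_le_cancel_right)
    then show ?thesis by (simp add: a_def \<tau>_def)
  qed
qed

text \<open>The factorisation yields everything but compactness, which will come from the continuity
  of a concrete kernel and is a premise here.\<close>

lemma compact_psd_operatorI:
  assumes "\<And>fs. (\<And>n. fs n \<in> l2 N) \<Longrightarrow> (\<And>n. (LINT z|N. (fs n z)\<^sup>2) \<le> 1) \<Longrightarrow>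
      \<exists>r g. strict_mono (r :: nat \<Rightarrow> nat) \<and> g \<in> l2 N \<and> (\<lambda>i. LINT z|N. (T (fs (r i)) z - g z)\<^sup>2) \<longlonglongrightarrow> 0"
  shows "compact_psd_operator N T (LINT z|N. K z z)"
proof
  show "T f \<in> l2 N" if "f \<in> l2 N" for f by (rule T_l2[OF that])
  show "T (\<lambda>z. f z + c * g z) z = T f z + c * T g z" if "f \<in> l2 N" "g \<in> l2 N" "z \<in> space N" for f g c z
    by (rule T_add[OF that])
  show "(LINT z|N. T f z * g z) = (LINT z|N. T g z * f z)" if "f \<in> l2 N" "g \<in> l2 N" for f g
    using T_ip[OF that] T_ip[OF that(2,1)] by (simp add: mult.commute)
  show "0 \<le> (LINT z|N. T f z * f z)" if "f \<in> l2 N" for f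
    by (simp add: coef_square_le[OF that])
  show "(LINT z|N. (T f z)\<^sup>2) \<le> (LINT z|N. K z z)\<^sup>2 * (LINT z|N. (f z)\<^sup>2)" if "f \<in> l2 N" for f
    by (rule T_bound[OF that])
  show "0 \<le> (LINT z|N. K z z)" by (rule K_trace_nonneg)
qed (rule assms)

text \<open>E[Y_z coef (e j)] is the value of T (e j) at z, and the coefficients are orthogonal with
  second moments \<open>lam j\<close>. Hence the mixed term and the square of the sum reduce to the
  same expression, which survives once with a minus sign.\<close>

lemma residual_second_moment:
  assumes F: "finite F" and e: "\<And>j. j \<in> F \<Longrightarrow> e j \<in> l2 N"
    and eig: "\<And>j z. j \<in> F \<Longrightarrow> z \<in> space N \<Longrightarrow> T (e j) z = lam j * e j z"
    and on: "\<And>i j. i \<in> F \<Longrightarrow> j \<in> F \<Longrightarrow> (LINT z|N. e i z * e j z) = (if i = j then 1 else 0)"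
    and z: "z \<in> space N"
  shows "(\<lambda>\<omega>. Y z \<omega> - (\<Sum>j\<in>F. coef (e j) \<omega> * e j z)) \<in> l2 M"
    and "(LINT \<omega>|M. (Y z \<omega> - (\<Sum>j\<in>F. coef (e j) \<omega> * e j z))\<^sup>2) = K z z - (\<Sum>j\<in>F. lam j * (e j z)\<^sup>2)"
proof -
  let ?S = "\<lambda>\<omega>. \<Sum>j\<in>F. e j z * coef (e j) \<omega>"
  have S: "?S \<in> l2 M" by (intro l2_sum coef_l2 e)
  have eq: "Y z \<omega> - (\<Sum>j\<in>F. coef (e j) \<omega> * e j z) = Y z \<omega> + (- 1) * ?S \<omega>" for \<omega>
    by (simp add: mult.commute)
  show "(\<lambda>\<omega>. Y z \<omega> - (\<Sum>j\<in>F. coef (e j) \<omega> * e j z)) \<in> l2 M"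
    unfolding eq by (rule l2_add_scale[OF Y_l2[OF z] S])
  have YS: "(LINT \<omega>|M. Y z \<omega> * ?S \<omega>) = (\<Sum>j\<in>F. lam j * (e j z)\<^sup>2)"
  proof -
    have "(LINT \<omega>|M. Y z \<omega> * ?S \<omega>) = (LINT \<omega>|M. (\<Sum>j\<in>F. e j z * (Y z \<omega> * coef (e j) \<omega>)))"
      by (simp add: sum_distrib_left mult_ac)
    also have "\<dots> = (\<Sum>j\<in>F. e j z * (LINT \<omega>|M. Y z \<omega> * coef (e j) \<omega>))"
      by (subst Bochner_Integration.integral_sum)
         (auto intro!: integrable_mult_right integrable_coef Y_l2 e z simp del: integrable_mult_right_iff)
    also have "\<dots> = (\<Sum>j\<in>F. lam j * (e j z)\<^sup>2)"
      by (rule sum.cong) (auto simp: T_eq[OF e z, symmetric] eig[OF _ z] power2_eq_square)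
    finally show ?thesis .
  qed
  have cc: "(LINT \<omega>|M. coef (e i) \<omega> * coef (e j) \<omega>) = (if i = j then lam j else 0)" if "i \<in> F" "j \<in> F" for i j
  proof -
    have "(LINT \<omega>|M. coef (e i) \<omega> * coef (e j) \<omega>) = (LINT z|N. T (e i) z * e j z)"
      by (rule T_ip[OF e[OF that(1)] e[OF that(2)], symmetric])
    also have "\<dots> = (LINT z|N. lam i * (e i z * e j z))"
      by (rule Bochner_Integration.integral_cong) (auto simp: eig[OF that(1)])
    also have "\<dots> = (if i = j then lam j else 0)" by (simp add: on[OF that])
    finally show ?thesis .
  qed
  have SS: "(LINT \<omega>|M. (?S \<omega>)\<^sup>2) = (\<Sum>j\<in>F. lam j * (e j z)\<^sup>2)"
  proof -
    have i: "integrable M (\<lambda>\<omega>. coef (e i) \<omega> * coef (e j) \<omega>)" if "i \<in> F" "j \<in> F" for i j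
      by (rule l2_integrable_mult[OF coef_l2[OF e[OF that(1)]] coef_l2[OF e[OF that(2)]]])
    have "(LINT \<omega>|M. (?S \<omega>)\<^sup>2) = (LINT \<omega>|M. (\<Sum>i\<in>F. \<Sum>j\<in>F. e i z * e j z * (coef (e i) \<omega> * coef (e j) \<omega>)))"
      by (simp add: power2_eq_square sum_product mult_ac)
    also have "\<dots> = (\<Sum>i\<in>F. LINT \<omega>|M. (\<Sum>j\<in>F. e i z * e j z * (coef (e i) \<omega> * coef (e j) \<omega>)))"
      by (rule Bochner_Integration.integral_sum) (intro Bochner_Integration.integrable_sum integrable_mult_right i)
    also have "\<dots> = (\<Sum>i\<in>F. \<Sum>j\<in>F. LINT \<omega>|M. e i z * e j z * (coef (e i) \<omega> * coef (e j) \<omega>))"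
      by (intro sum.cong refl Bochner_Integration.integral_sum integrable_mult_right i)
    also have "\<dots> = (\<Sum>i\<in>F. \<Sum>j\<in>F. if i = j then lam j * (e j z)\<^sup>2 else 0)"
      by (intro sum.cong refl) (auto simp: cc power2_eq_square)
    also have "\<dots> = (\<Sum>j\<in>F. lam j * (e j z)\<^sup>2)" using F by simp
    finally show ?thesis .
  qed
  have "(LINT \<omega>|M. (Y z \<omega> + (- 1) * ?S \<omega>)\<^sup>2) = (LINT \<omega>|M. (Y z \<omega>)\<^sup>2 + ((- 2) * (Y z \<omega> * ?S \<omega>) + (?S \<omega>)\<^sup>2))"
    by (rule Bochner_Integration.integral_cong) (auto simp: power2_eq_square algebra_simps)
  also have "\<dots> = (LINT \<omega>|M. (Y z \<omega>)\<^sup>2) + ((- 2) * (LINT \<omega>|M. Y z \<omega> * ?S \<omega>) + (LINT \<omega>|M. (?S \<omega>)\<^sup>2))"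
  proof -
    have "integrable M (\<lambda>\<omega>. (?S \<omega>)\<^sup>2)" "integrable M (\<lambda>\<omega>. Y z \<omega> * ?S \<omega>)" "integrable M (\<lambda>\<omega>. (Y z \<omega>)\<^sup>2)"
      using S Y_l2[OF z] l2_integrable_mult[OF Y_l2[OF z] S] by (auto simp: l2_def)
    then show ?thesis by (subst Bochner_Integration.integral_add; simp)
  qed
  also have "\<dots> = K z z - (\<Sum>j\<in>F. lam j * (e j z)\<^sup>2)"
    unfolding YS SS by (simp add: K_def power2_eq_square)
  finally show "(LINT \<omega>|M. (Y z \<omega> - (\<Sum>j\<in>F. coef (e j) \<omega> * e j z))\<^sup>2) = K z z - (\<Sum>j\<in>F. lam j * (e j z)\<^sup>2)"
    unfolding eq .
qed

end

section \<open>Splitting off finitely many eigenfunctions\<close>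

context compact_psd_operator
begin

text \<open>The remainder g of f after projection is orthogonal to the eigenfunctions, and by
  symmetry so is T g; the bound on the complement applies to both. The cross terms vanish, which
  separates the eigenvalue sum exactly.\<close>

lemma
  assumes F: "finite F" and e: "\<And>j. j \<in> F \<Longrightarrow> e j \<in> l2 N"
    and eig: "\<And>j z. j \<in> F \<Longrightarrow> z \<in> space N \<Longrightarrow> T (e j) z = lam j * e j z"
    and on: "\<And>i j. i \<in> F \<Longrightarrow> j \<in> F \<Longrightarrow> ip (e i) (e j) = (if i = j then 1 else 0)"
    and r: "0 \<le> r" and f: "f \<in> l2 N"
    and bound: "\<And>g. g \<in> l2 N \<Longrightarrow> (\<And>j. j \<in> F \<Longrightarrow> ip g (e j) = 0) \<Longrightarrow> ip (T g) g \<le> r * ip g g"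
  shows deflation_form: "ip (T f) f \<le> (\<Sum>j\<in>F. lam j * (ip f (e j))\<^sup>2) + r * ip f f"
    and deflation_norm: "(LINT z|N. (T f z - (\<Sum>j\<in>F. lam j * ip f (e j) * e j z))\<^sup>2) \<le> r\<^sup>2 * ip f f"
proof -
  define g where "g z = f z - (\<Sum>j\<in>F. ip f (e j) * e j z)" for z
  have g: "g \<in> l2 N" unfolding g_def[abs_def] by (rule l2_diff_sum[OF f e])
  have ip_sum: "ip (\<lambda>z. h z - (\<Sum>j\<in>G. c j * e j z)) u = ip h u - (\<Sum>j\<in>G. c j * ip (e j) u)"
    if h: "h \<in> l2 N" and G: "G \<subseteq> F" and u: "u \<in> l2 N" for h c u G
  proof -
    have "finite G" using G F by (rule finite_subset)
    then show ?thesis using G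
    proof induction
      case (insert a G)
      have "ip (\<lambda>z. h z - (\<Sum>j\<in>insert a G. c j * e j z)) u = ip (\<lambda>z. (h z - (\<Sum>j\<in>G. c j * e j z)) + (- c a) * e a z) u"
        using insert(1,2) by (intro ip_cong) (auto simp: algebra_simps)
      also have "\<dots> = ip (\<lambda>z. h z - (\<Sum>j\<in>G. c j * e j z)) u + (- c a) * ip (e a) u"
        by (rule ip_add[OF l2_diff_sum[OF h] _ u]) (use e insert in auto)
      finally show ?case using insert by simp
    qed simp
  qed
  have Tg: "T g z = T f z - (\<Sum>j\<in>F. lam j * ip f (e j) * e j z)" if z: "z \<in> space N" for z
  proof -
    have "T (\<lambda>z. f z - (\<Sum>j\<in>G. ip f (e j) * e j z)) z = T f z - (\<Sum>j\<in>G. lam j * ip f (e j) * e j z)"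
      if G: "G \<subseteq> F" for G
    proof -
      have "finite G" using G F by (rule finite_subset)
      then show ?thesis using G
      proof induction
        case (insert a G)
        have "(\<lambda>z. f z - (\<Sum>j\<in>insert a G. ip f (e j) * e j z)) = (\<lambda>z. (f z - (\<Sum>j\<in>G. ip f (e j) * e j z)) + (- ip f (e a)) * e a z)"
          using insert(1,2) by (auto simp: algebra_simps)
        then have "T (\<lambda>z. f z - (\<Sum>j\<in>insert a G. ip f (e j) * e j z)) z =
            T (\<lambda>z. (f z - (\<Sum>j\<in>G. ip f (e j) * e j z)) + (- ip f (e a)) * e a z) z" by (simp only:)
        also have "\<dots> = T (\<lambda>z. f z - (\<Sum>j\<in>G. ip f (e j) * e j z)) z + (- ip f (e a)) * T (e a) z"
          by (rule T_add[OF l2_diff_sum[OF f] _ z]) (use e insert in auto)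
        finally show ?case using insert eig[OF _ z] by (simp add: mult_ac)
      qed simp
    qed
    from this[of F] show ?thesis by (simp add: g_def[abs_def])
  qed
  have ge: "ip g (e j) = 0" if j: "j \<in> F" for j
  proof -
    have "ip g (e j) = ip f (e j) - (\<Sum>i\<in>F. ip f (e i) * ip (e i) (e j))"
      unfolding g_def[abs_def] by (rule ip_sum[OF f order_refl e[OF j]])
    also have "(\<Sum>i\<in>F. ip f (e i) * ip (e i) (e j)) = (\<Sum>i\<in>F. if i = j then ip f (e i) else 0)"
      by (rule sum.cong) (use on j in auto)
    finally show ?thesis using F j by simp
  qed
  have Tge: "ip (T g) (e j) = 0" if j: "j \<in> F" for j
  proof -
    have "ip (T g) (e j) = ip (T (e j)) g" using T_sym[OF g e[OF j]] by (simp add: ip_def)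
    also have "\<dots> = ip (\<lambda>z. lam j * e j z) g" by (rule ip_cong) (use eig j in auto)
    also have "\<dots> = lam j * ip g (e j)"
    proof -
      have "(\<lambda>z. lam j * e j z * g z) = (\<lambda>z. lam j * (g z * e j z))" by (simp add: mult_ac)
      then show ?thesis by (simp add: ip_def)
    qed
    finally show ?thesis using ge[OF j] by simp
  qed
  \<comment> \<open>Against a function orthogonal to all \<open>e j\<close>, f and its remainder g
    have the same inner product.\<close>
  have gf: "ip u g = ip u f" if u: "u \<in> l2 N" "\<And>j. j \<in> F \<Longrightarrow> ip u (e j) = 0" for u
  proof -
    have "ip g u = ip f u - (\<Sum>j\<in>F. ip f (e j) * ip (e j) u)"
      unfolding g_def[abs_def] by (rule ip_sum[OF f order_refl u(1)])
    also have "\<dots> = ip f u" using u(2) by (simp add: ip_commute[of "e _" u])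
    finally show ?thesis by (simp only: ip_commute[of u g] ip_commute[of u f])
  qed
  have gg: "ip g g = ip f f - (\<Sum>j\<in>F. (ip f (e j))\<^sup>2)"
  proof -
    have "ip g g = ip g f" by (rule gf[OF g ge])
    also have "\<dots> = ip f f - (\<Sum>j\<in>F. ip f (e j) * ip (e j) f)"
      unfolding g_def[abs_def] by (rule ip_sum[OF f order_refl f])
    finally show ?thesis by (simp add: ip_commute[of "e _" f] power2_eq_square)
  qed
  then have gg_le: "ip g g \<le> ip f f" by (simp add: sum_nonneg)
  have "ip (T g) g = ip (T g) f" by (rule gf[OF T_l2[OF g] Tge])
  also have "\<dots> = ip (\<lambda>z. T f z - (\<Sum>j\<in>F. (lam j * ip f (e j)) * e j z)) f"
    by (rule ip_cong) (use Tg in auto)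
  also have "\<dots> = ip (T f) f - (\<Sum>j\<in>F. (lam j * ip f (e j)) * ip (e j) f)"
    by (rule ip_sum[OF T_l2[OF f] order_refl f])
  also have "\<dots> = ip (T f) f - (\<Sum>j\<in>F. lam j * (ip f (e j))\<^sup>2)"
    by (simp add: ip_commute[of "e _" f] power2_eq_square mult.assoc)
  finally have TT: "ip (T g) g = ip (T f) f - (\<Sum>j\<in>F. lam j * (ip f (e j))\<^sup>2)" .
  have b: "ip (T g) g \<le> r * ip g g" by (rule bound[OF g ge])
  have "r * ip g g \<le> r * ip f f" using gg_le r by (rule mult_left_mono)
  then show "ip (T f) f \<le> (\<Sum>j\<in>F. lam j * (ip f (e j))\<^sup>2) + r * ip f f"
    using TT b by simp
  have "(LINT z|N. (T f z - (\<Sum>j\<in>F. lam j * ip f (e j) * e j z))\<^sup>2) = ip (T g) (T g)"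
    unfolding ip_self by (rule Bochner_Integration.integral_cong) (use Tg in auto)
  also have "\<dots> \<le> r\<^sup>2 * ip g g"
    by (rule norm_bounded_by_form[OF g b bound[OF T_l2[OF g] Tge]])
  also have "\<dots> \<le> r\<^sup>2 * ip f f" using gg_le by (rule mult_left_mono) simp
  finally show "(LINT z|N. (T f z - (\<Sum>j\<in>F. lam j * ip f (e j) * e j z))\<^sup>2) \<le> r\<^sup>2 * ip f f" .
qed

end

section \<open>Almost sure weak differentiability of sample paths\<close>

text \<open>A parameter whose functions oscillate little on the scale of a finite net is recorded by
  their values on the net, rounded down to multiples of 1 / (M + 1). There are countably many
  records, and one representative of each suffices. Both functions enter one record, so that a
  single q approximates \<open>f p\<close> and \<open>g p\<close> together.\<close>

lemma countable_dense_uniform: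
  fixes f g :: "'p \<Rightarrow> 'a::metric_space \<Rightarrow> real"
  assumes C: "compact C" and f: "\<And>p. p \<in> P \<Longrightarrow> continuous_on C (f p)" and g: "\<And>p. p \<in> P \<Longrightarrow> continuous_on C (g p)"
  obtains D where "countable D" "D \<subseteq> P"
    "\<And>p \<epsilon>. p \<in> P \<Longrightarrow> \<epsilon> > 0 \<Longrightarrow> \<exists>q\<in>D. \<forall>x\<in>C. \<bar>f p x - f q x\<bar> \<le> \<epsilon> \<and> \<bar>g p x - g q x\<bar> \<le> \<epsilon>"
proof -
  have "\<exists>G. finite G \<and> G \<subseteq> C \<and> C \<subseteq> (\<Union>x\<in>G. ball x (1 / real (Suc n)))" for n
    using seq_compact_imp_totally_bounded[of C] C by (auto simp: compact_imp_seq_compact)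
  then obtain G where G: "\<And>n. finite (G n)" "\<And>n. G n \<subseteq> C" "\<And>n. C \<subseteq> (\<Union>x\<in>G n. ball x (1 / real (Suc n)))"
    by metis
  define sig where "sig M n p = restrict (\<lambda>y. (\<lfloor>real (Suc M) * f p y\<rfloor>, \<lfloor>real (Suc M) * g p y\<rfloor>)) (G n)" for M n p
  define osc where "osc M n p \<longleftrightarrow> (\<forall>x\<in>C. \<forall>y\<in>C. dist x y < 1 / real (Suc n) \<longrightarrow>
     \<bar>f p x - f p y\<bar> \<le> 1 / real (Suc M) \<and> \<bar>g p x - g p y\<bar> \<le> 1 / real (Suc M))" for M n p
  define Q where "Q M n \<sigma> p \<longleftrightarrow> p \<in> P \<and> osc M n p \<and> sig M n p = \<sigma>" for M n \<sigma> p
  define I where "I = (SIGMA M:(UNIV :: nat set). SIGMA n:UNIV. PiE (G n) (\<lambda>_. UNIV :: (int \<times> int) set))"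
  have cI: "countable I"
    unfolding I_def by (intro countable_SIGMA countable_PiE G(1) countableI_type)
  define pick where "pick = (\<lambda>(M, n, \<sigma>). SOME p. Q M n \<sigma> p)"
  define D where "D = pick ` {(M, n, \<sigma>) \<in> I. \<exists>p. Q M n \<sigma> p}"
  have pick: "Q M n \<sigma> (pick (M, n, \<sigma>))" if "\<exists>p. Q M n \<sigma> p" for M n \<sigma>
    unfolding pick_def using that by (auto intro: someI_ex)
  show ?thesis
  proof
    show "countable D" unfolding D_def by (intro countable_image countable_subset[OF _ cI]) auto
    show "D \<subseteq> P" using pick by (auto simp: D_def Q_def)
    fix p and \<epsilon> :: real assume p: "p \<in> P" and \<epsilon>: "\<epsilon> > 0"
    \<comment> \<open>A third of \<epsilon> each for moving from x to a net point under p, for the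
      rounding there, and for moving back under q.\<close>
    obtain M where M: "inverse (real (Suc M)) < \<epsilon> / 3" using reals_Archimedean[of "\<epsilon> / 3"] \<epsilon> by auto
    define h where "h = 1 / real (Suc M)"
    have h: "h > 0" "3 * h < \<epsilon>" using M by (auto simp: h_def inverse_eq_divide)
    obtain n where n: "osc M n p"
    proof -
      have "uniformly_continuous_on C (f p)" "uniformly_continuous_on C (g p)"
        using compact_uniformly_continuous[OF f[OF p] C] compact_uniformly_continuous[OF g[OF p] C] .
      note uc = this[unfolded uniformly_continuous_on_def, rule_format, OF h(1)]
      obtain d1 where d1: "d1 > 0" "\<forall>x\<in>C. \<forall>y\<in>C. dist y x < d1 \<longrightarrow> dist (f p y) (f p x) < h"
        using uc(1) by blast
      obtain d2 where d2: "d2 > 0" "\<forall>x\<in>C. \<forall>y\<in>C. dist y x < d2 \<longrightarrow> dist (g p y) (g p x) < h"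
        using uc(2) by blast
      note d = d1(1) d2(1) d1(2)[rule_format] d2(2)[rule_format]
      obtain n where n: "inverse (real (Suc n)) < min d1 d2" using reals_Archimedean[of "min d1 d2"] d by auto
      have "osc M n p"
        unfolding osc_def
      proof (intro ballI impI)
        fix x y assume xy: "x \<in> C" "y \<in> C" "dist x y < 1 / real (Suc n)"
        then have "dist x y < d1" "dist x y < d2" using n by (auto simp: inverse_eq_divide)
        then show "\<bar>f p x - f p y\<bar> \<le> 1 / real (Suc M) \<and> \<bar>g p x - g p y\<bar> \<le> 1 / real (Suc M)"
          using d(3)[of y x] d(4)[of y x] xy unfolding dist_real_def h_def[symmetric] by (simp add: less_imp_le)
      qed
      then show ?thesis using that by blast
    qed
    define \<sigma> where "\<sigma> = sig M n p"
    have ex: "\<exists>p. Q M n \<sigma> p" using p n by (auto simp: Q_def \<sigma>_def)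
    define q where "q = pick (M, n, \<sigma>)"
    have q: "q \<in> P" "osc M n q" "sig M n q = sig M n p" using pick[OF ex] by (auto simp: Q_def q_def \<sigma>_def)
    have "\<sigma> \<in> PiE (G n) (\<lambda>_. UNIV)" by (auto simp: \<sigma>_def sig_def)
    then have "q \<in> D" using ex by (auto simp: D_def q_def I_def)
    moreover have "\<bar>f p x - f q x\<bar> \<le> \<epsilon> \<and> \<bar>g p x - g q x\<bar> \<le> \<epsilon>" if x: "x \<in> C" for x
    proof -
      obtain y where y: "y \<in> G n" "dist x y < 1 / real (Suc n)"
        using G(3)[of n] x by (auto simp: dist_commute)
      have yC: "y \<in> C" using y G(2) by auto
      have fl: "\<bar>a - b\<bar> \<le> h" if "\<lfloor>real (Suc M) * a\<rfloor> = \<lfloor>real (Suc M) * b\<rfloor>" for a b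
      proof -
        have "\<bar>real (Suc M) * a - real (Suc M) * b\<bar> < 1" using that by linarith
        then have "real (Suc M) * \<bar>a - b\<bar> < 1" by (simp add: abs_mult flip: right_diff_distrib)
        then show ?thesis by (simp add: h_def field_simps)
      qed
      have "sig M n q y = sig M n p y" using q(3) by simp
      then have "\<bar>f p y - f q y\<bar> \<le> h" "\<bar>g p y - g q y\<bar> \<le> h" using y(1) by (auto simp: sig_def intro!: fl)
      moreover have "\<bar>f p x - f p y\<bar> \<le> h" "\<bar>g p x - g p y\<bar> \<le> h" "\<bar>f q x - f q y\<bar> \<le> h" "\<bar>g q x - g q y\<bar> \<le> h"
        using n q(2) x yC y(2) unfolding osc_def h_def by blast+
      ultimately show ?thesis using h(2) by linarith
    qed
    ultimately show "\<exists>q\<in>D. \<forall>x\<in>C. \<bar>f p x - f q x\<bar> \<le> \<epsilon> \<and> \<bar>g p x - g q x\<bar> \<le> \<epsilon>" by blast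
  qed
qed

lemma LINT_mult_diff_bound:
  fixes u :: "'a \<Rightarrow> real"
  assumes "integrable N u" "integrable N (\<lambda>x. u x * a x)" "integrable N (\<lambda>x. u x * b x)"
    and "\<And>x. x \<in> space N \<Longrightarrow> \<bar>a x - b x\<bar> \<le> \<epsilon>"
  shows "\<bar>(LINT x|N. u x * a x) - (LINT x|N. u x * b x)\<bar> \<le> \<epsilon> * (LINT x|N. \<bar>u x\<bar>)"
proof -
  have "(LINT x|N. u x * a x) - (LINT x|N. u x * b x) = (LINT x|N. u x * a x - u x * b x)"
    using assms by simp
  also have "\<bar>\<dots>\<bar> \<le> (LINT x|N. \<bar>u x * a x - u x * b x\<bar>)" by (rule integral_abs_bound)
  also have "\<dots> \<le> (LINT x|N. \<epsilon> * \<bar>u x\<bar>)"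
  proof (rule integral_mono)
    fix x assume x: "x \<in> space N"
    have "u x * a x - u x * b x = (a x - b x) * u x" by (simp add: algebra_simps)
    then have "\<bar>u x * a x - u x * b x\<bar> = \<bar>a x - b x\<bar> * \<bar>u x\<bar>" by (simp only: abs_mult)
    then show "\<bar>u x * a x - u x * b x\<bar> \<le> \<epsilon> * \<bar>u x\<bar>" using assms(4)[OF x] by (simp add: mult_right_mono)
  qed (use assms in auto)
  finally show ?thesis by simp
qed

text \<open>The exceptional null set in the hypothesis depends on the test function. A countable set
  that approximates \<phi> and \<open>cderiv \<alpha> \<phi>\<close> uniformly at the same time
  yields one null set, and the identity passes to the limit because the paths are
  integrable.\<close>

lemma AE_has_weak_deriv:
  fixes S :: "(real ^ 'd::finite) set"
  assumes S: "open S" "bounded S"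
    and X: "AE \<omega> in M. (\<lambda>t. X t \<omega>) \<in> L2 S" and Y: "AE \<omega> in M. (\<lambda>t. Y t \<omega>) \<in> L2 S"
    and w: "\<And>\<phi>. \<phi> \<in> test_functions S \<Longrightarrow> AE \<omega> in M.
           (LINT t|lebesgue_on S. X t \<omega> * cderiv \<alpha> \<phi> t) = (- 1) ^ mi_order \<alpha> * (LINT t|lebesgue_on S. Y t \<omega> * \<phi> t)"
  shows "AE \<omega> in M. has_weak_deriv S \<alpha> (\<lambda>t. X t \<omega>) (\<lambda>t. Y t \<omega>)"
proof -
  interpret L: finite_measure "lebesgue_on S" by (rule finite_measure_lebesgue_on_open[OF S])
  have tc: "continuous_on (closure S) (cderiv \<beta> \<phi>)" if "\<phi> \<in> test_functions S" for \<phi> \<beta>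
    using that by (rule test_function_props) (blast intro: continuous_on_subset)
  have C: "compact (closure S)" using S by (simp add: compact_closure)
  obtain D where D: "countable D" "D \<subseteq> test_functions S"
    "\<And>\<phi> \<epsilon>. \<phi> \<in> test_functions S \<Longrightarrow> \<epsilon> > 0 \<Longrightarrow> \<exists>\<psi>\<in>D. \<forall>x\<in>closure S. \<bar>\<phi> x - \<psi> x\<bar> \<le> \<epsilon> \<and> \<bar>cderiv \<alpha> \<phi> x - cderiv \<alpha> \<psi> x\<bar> \<le> \<epsilon>"
  proof (rule countable_dense_uniform[OF C, of "test_functions S" "\<lambda>\<phi>. \<phi>" "cderiv \<alpha>"])
    show "continuous_on (closure S) \<phi>" if "\<phi> \<in> test_functions S" for \<phi> using tc[OF that, of 0] by simp
  qed (use tc in auto)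
  have "AE \<omega> in M. \<forall>\<psi>\<in>D. (LINT t|lebesgue_on S. X t \<omega> * cderiv \<alpha> \<psi> t) = (- 1) ^ mi_order \<alpha> * (LINT t|lebesgue_on S. Y t \<omega> * \<psi> t)"
    by (subst AE_ball_countable[OF D(1)]) (use w D(2) in blast)
  with X Y show ?thesis
  proof eventually_elim
    case (elim \<omega>)
    have Xi: "integrable (lebesgue_on S) (\<lambda>t. X t \<omega>)" and Yi: "integrable (lebesgue_on S) (\<lambda>t. Y t \<omega>)"
      using elim(1,2) unfolding L2_eq_l2 by (auto intro: L.l2_integrable)
    have mi: "integrable (lebesgue_on S) (\<lambda>t. X t \<omega> * cderiv \<beta> \<phi> t)" "integrable (lebesgue_on S) (\<lambda>t. Y t \<omega> * cderiv \<beta> \<phi> t)"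
      if "\<phi> \<in> test_functions S" for \<beta> \<phi>
      using elim(1,2) test_function_L2[OF S that, of \<beta>] unfolding L2_eq_l2
      by - (rule l2_integrable_mult; assumption)+
    show ?case
      unfolding has_weak_deriv_def
    proof
      fix \<phi> assume \<phi>: "\<phi> \<in> test_functions S"
      define L R where "L \<psi> = (LINT t|lebesgue_on S. X t \<omega> * cderiv \<alpha> \<psi> t)"
        and "R \<psi> = (LINT t|lebesgue_on S. Y t \<omega> * \<psi> t)" for \<psi>
      define m where "m = (LINT t|lebesgue_on S. \<bar>X t \<omega>\<bar>) + (LINT t|lebesgue_on S. \<bar>Y t \<omega>\<bar>)"
      have m: "m \<ge> 0" by (simp add: m_def)
      have "\<bar>L \<phi> - (- 1) ^ mi_order \<alpha> * R \<phi>\<bar> \<le> 0 + \<epsilon>" if \<epsilon>: "\<epsilon> > 0" for \<epsilon>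
      proof -
        \<comment> \<open>m is the sum of the L1 norms of both paths, so an error \<delta> in the
          test function and its derivative costs at most \<delta> m; the added 1 keeps the quotient
          meaningful for m = 0.\<close>
        define \<delta> where "\<delta> = \<epsilon> / (m + 1)"
        have \<delta>: "\<delta> > 0" using \<epsilon> m by (simp add: \<delta>_def)
        obtain \<psi> where \<psi>: "\<psi> \<in> D" "\<forall>x\<in>closure S. \<bar>\<phi> x - \<psi> x\<bar> \<le> \<delta> \<and> \<bar>cderiv \<alpha> \<phi> x - cderiv \<alpha> \<psi> x\<bar> \<le> \<delta>"
          using D(3)[OF \<phi> \<delta>] by blast
        have \<psi>t: "\<psi> \<in> test_functions S" using \<psi>(1) D(2) by blast
        have sub: "x \<in> S \<Longrightarrow> x \<in> closure S" for x using closure_subset by blast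
        have "\<bar>L \<phi> - L \<psi>\<bar> \<le> \<delta> * (LINT t|lebesgue_on S. \<bar>X t \<omega>\<bar>)"
          unfolding L_def by (rule LINT_mult_diff_bound[OF Xi mi(1)[OF \<phi>] mi(1)[OF \<psi>t]]) (use \<psi>(2) sub in auto)
        moreover have "\<bar>R \<phi> - R \<psi>\<bar> \<le> \<delta> * (LINT t|lebesgue_on S. \<bar>Y t \<omega>\<bar>)"
          unfolding R_def
          by (rule LINT_mult_diff_bound[OF Yi mi(2)[OF \<phi>, of 0, unfolded cderiv_0] mi(2)[OF \<psi>t, of 0, unfolded cderiv_0]])
             (use \<psi>(2) sub in auto)
        moreover have "L \<psi> = (- 1) ^ mi_order \<alpha> * R \<psi>" using elim(3) \<psi>(1) by (simp add: L_def R_def)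
        ultimately have "\<bar>L \<phi> - (- 1) ^ mi_order \<alpha> * R \<phi>\<bar> \<le> \<delta> * m"
          by (cases "even (mi_order \<alpha>)") (simp_all add: m_def distrib_left)
        also have "\<dots> \<le> \<delta> * (m + 1)" using \<delta> by simp
        also have "\<dots> = \<epsilon>" using m by (simp add: \<delta>_def)
        finally show ?thesis by simp
      qed
      then have "\<bar>L \<phi> - (- 1) ^ mi_order \<alpha> * R \<phi>\<bar> \<le> 0" by (rule field_le_epsilon)
      then show "(LINT x|lebesgue_on S. X x \<omega> * cderiv \<alpha> \<phi> x) = (- 1) ^ mi_order \<alpha> * (LINT x|lebesgue_on S. Y x \<omega> * \<phi> x)"
        by (simp add: L_def R_def)
    qed
  qed
qed

section \<open>Jets of functions\<close>

locale jet_space =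
  fixes \<Theta> :: "(real ^ 'd::finite) set" and k :: nat
  assumes open_domain: "open \<Theta>" and bounded_domain: "bounded \<Theta>"
begin

definition A :: "'d multi_index set" where "A = {\<alpha>. mi_order \<alpha> \<le> k}"

text \<open>Counting measure in the first factor makes L2 of this measure the direct sum of copies
  of L2 over \<Theta>, one for each index, so that the H^k inner product becomes a single
  integral.\<close>

definition N :: "('d multi_index \<times> (real ^ 'd)) measure" where
  "N = count_space A \<Otimes>\<^sub>M lebesgue_on \<Theta>"

lemma finite_A: "finite A"
  by (simp add: A_def finite_mi_order_le)

lemma zero_in_A: "0 \<in> A"
  by (simp add: A_def)

sublocale L: finite_measure "lebesgue_on \<Theta>"
  by (rule finite_measure_lebesgue_on_open[OF open_domain bounded_domain])

sublocale C: finite_measure "count_space A"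
  by (rule finite_measure_count_space[OF finite_A])

sublocale CL: pair_sigma_finite "count_space A" "lebesgue_on \<Theta>" ..

lemma space_N [simp]: "space N = A \<times> \<Theta>"
  by (simp add: N_def space_pair_measure)

lemma finite_measure_N: "finite_measure N"
  unfolding N_def by (rule finite_measure_pair_measure[OF L.finite_measure_axioms C.finite_measure_axioms])

lemma N_measurableI:
  "(\<And>\<alpha>. \<alpha> \<in> A \<Longrightarrow> (\<lambda>x. f (\<alpha>, x)) \<in> borel_measurable (lebesgue_on \<Theta>)) \<Longrightarrow> f \<in> borel_measurable N"
  unfolding N_def by (rule measurable_pair_measure_countable1) (auto simp: finite_A countable_finite)

lemma N_section_measurable:
  "f \<in> borel_measurable N \<Longrightarrow> \<alpha> \<in> A \<Longrightarrow> (\<lambda>x. f (\<alpha>, x)) \<in> borel_measurable (lebesgue_on \<Theta>)"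
  unfolding N_def using measurable_compose[OF measurable_Pair1'] by fastforce

lemma N_integrableI:
  fixes f :: "'d multi_index \<times> (real ^ 'd) \<Rightarrow> real"
  assumes "\<And>\<alpha>. \<alpha> \<in> A \<Longrightarrow> integrable (lebesgue_on \<Theta>) (\<lambda>x. f (\<alpha>, x))"
  shows "integrable N f"
  unfolding N_def
proof (rule CL.Fubini_integrable)
  show "f \<in> borel_measurable (count_space A \<Otimes>\<^sub>M lebesgue_on \<Theta>)"
    using N_measurableI[of f] assms unfolding N_def by auto
  show "integrable (count_space A) (\<lambda>x. LINT y|lebesgue_on \<Theta>. norm (f (x, y)))"
    by (rule integrable_count_space[OF finite_A])
  show "AE x in count_space A. integrable (lebesgue_on \<Theta>) (\<lambda>y. f (x, y))"
    using assms by (simp add: AE_count_space)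
qed

lemma N_section_integrable:
  fixes f :: "'d multi_index \<times> (real ^ 'd) \<Rightarrow> real"
  assumes "integrable N f" "\<alpha> \<in> A"
  shows "integrable (lebesgue_on \<Theta>) (\<lambda>x. f (\<alpha>, x))"
  using CL.AE_integrable_fst'[OF assms(1)[unfolded N_def]] assms(2) by (simp add: AE_count_space)

lemma N_integral:
  fixes f :: "'d multi_index \<times> (real ^ 'd) \<Rightarrow> real"
  assumes "integrable N f"
  shows "(LINT z|N. f z) = (\<Sum>\<alpha>\<in>A. LINT x|lebesgue_on \<Theta>. f (\<alpha>, x))"
  using CL.integral_fst'[OF assms[unfolded N_def]]
  by (simp add: N_def lebesgue_integral_count_space_finite finite_A)

lemma l2_N_iff: "f \<in> l2 N \<longleftrightarrow> (\<forall>\<alpha>\<in>A. (\<lambda>x. f (\<alpha>, x)) \<in> L2 \<Theta>)"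
proof
  assume f: "f \<in> l2 N"
  show "\<forall>\<alpha>\<in>A. (\<lambda>x. f (\<alpha>, x)) \<in> L2 \<Theta>"
  proof
    fix \<alpha> assume \<alpha>: "\<alpha> \<in> A"
    have fm: "f \<in> borel_measurable N" "integrable N (\<lambda>z. (f z)\<^sup>2)" using f by (simp_all add: l2_def)
    show "(\<lambda>x. f (\<alpha>, x)) \<in> L2 \<Theta>"
      unfolding L2_def using N_section_measurable[OF fm(1) \<alpha>] N_section_integrable[OF fm(2) \<alpha>] by simp
  qed
next
  assume f: "\<forall>\<alpha>\<in>A. (\<lambda>x. f (\<alpha>, x)) \<in> L2 \<Theta>"
  have "f \<in> borel_measurable N"
    by (rule N_measurableI) (use f in \<open>simp add: L2_def\<close>)
  moreover have "integrable N (\<lambda>z. (f z)\<^sup>2)"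
    by (rule N_integrableI) (use f in \<open>simp add: L2_def\<close>)
  ultimately show "f \<in> l2 N" by (simp add: l2_def)
qed

definition jet :: "(real ^ 'd \<Rightarrow> real) \<Rightarrow> 'd multi_index \<times> (real ^ 'd) \<Rightarrow> real" where
  "jet e z = cderiv (fst z) e (snd z)"

text \<open>F is a version of all weak derivatives of f. A relation is used because such an F is
  determined only up to null sets and three kinds occur: classical jets, the chosen
  \<open>wderiv\<close>, and the paths of the derivative process.\<close>

definition rep :: "(real ^ 'd \<Rightarrow> real) \<Rightarrow> ('d multi_index \<times> (real ^ 'd) \<Rightarrow> real) \<Rightarrow> bool" where
  "rep f F \<longleftrightarrow> f \<in> Hk k \<Theta> \<and> F \<in> l2 N \<and> (\<forall>\<alpha>\<in>A. AE x in lebesgue_on \<Theta>. wderiv \<Theta> \<alpha> f x = F (\<alpha>, x))"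

lemma rep_l2: "rep f F \<Longrightarrow> F \<in> l2 N" and rep_Hk: "rep f F \<Longrightarrow> f \<in> Hk k \<Theta>"
  by (simp_all add: rep_def)

lemma rep_jet:
  assumes "e \<in> Ck_uniform k \<Theta>"
  shows "rep e (jet e)"
  unfolding rep_def
proof (intro conjI ballI)
  show "e \<in> Hk k \<Theta>" by (rule Ck_uniform_Hk[OF open_domain bounded_domain assms])
  show "jet e \<in> l2 N"
    using cderiv_L2[OF open_domain bounded_domain assms] by (simp add: l2_N_iff A_def jet_def)
  show "AE x in lebesgue_on \<Theta>. wderiv \<Theta> \<alpha> e x = jet e (\<alpha>, x)" if "\<alpha> \<in> A" for \<alpha>
    using wderiv_eq_cderiv[OF open_domain bounded_domain assms, of \<alpha>] that by (simp add: A_def jet_def)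
qed

lemma rep_wderiv:
  assumes "f \<in> Hk k \<Theta>"
  shows "rep f (\<lambda>z. wderiv \<Theta> (fst z) f (snd z))"
  using assms wderiv_Hk(1)[OF assms] by (simp add: rep_def l2_N_iff A_def)

lemma Hk_inner_rep:
  assumes "rep f F" "rep g G"
  shows "Hk_inner k \<Theta> f g = (LINT z|N. F z * G z)"
proof -
  have "Hk_inner k \<Theta> f g = (\<Sum>\<alpha> | mi_order \<alpha> \<le> k. LINT x|lebesgue_on \<Theta>. F (\<alpha>, x) * G (\<alpha>, x))"
    by (rule Hk_inner_eqI) (use assms in \<open>auto simp: rep_def l2_N_iff A_def\<close>)
  then show ?thesis
    using N_integral[OF l2_integrable_mult[OF rep_l2[OF assms(1)] rep_l2[OF assms(2)]]] by (simp add: A_def)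
qed

text \<open>Two versions of the same jet differ by a null function for each index; with g a section
  of the kernel this makes T independent of the version.\<close>

lemma rep_integral_cong:
  assumes "rep f F" "rep f G" "g \<in> l2 N"
  shows "(LINT z|N. g z * F z) = (LINT z|N. g z * G z)"
proof -
  have "(\<Sum>\<alpha>\<in>A. LINT x|lebesgue_on \<Theta>. g (\<alpha>, x) * F (\<alpha>, x)) = (\<Sum>\<alpha>\<in>A. LINT x|lebesgue_on \<Theta>. g (\<alpha>, x) * G (\<alpha>, x))"
  proof (rule sum.cong[OF refl], rule integral_cong_AE)
    fix \<alpha> assume \<alpha>: "\<alpha> \<in> A"
    have m: "(\<lambda>x. h (\<alpha>, x)) \<in> borel_measurable (lebesgue_on \<Theta>)" if "h \<in> l2 N" for h
      using that \<alpha> by (auto simp: l2_N_iff L2_def)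
    show "(\<lambda>x. g (\<alpha>, x) * F (\<alpha>, x)) \<in> borel_measurable (lebesgue_on \<Theta>)"
      "(\<lambda>x. g (\<alpha>, x) * G (\<alpha>, x)) \<in> borel_measurable (lebesgue_on \<Theta>)"
      by (intro borel_measurable_times m assms(3) rep_l2[OF assms(1)] rep_l2[OF assms(2)])+
    have "AE x in lebesgue_on \<Theta>. wderiv \<Theta> \<alpha> f x = F (\<alpha>, x)" "AE x in lebesgue_on \<Theta>. wderiv \<Theta> \<alpha> f x = G (\<alpha>, x)"
      using assms \<alpha> by (auto simp: rep_def)
    then show "AE x in lebesgue_on \<Theta>. g (\<alpha>, x) * F (\<alpha>, x) = g (\<alpha>, x) * G (\<alpha>, x)"
      by eventually_elim simp
  qed
  then show ?thesis
    using N_integral[OF l2_integrable_mult[OF assms(3) rep_l2[OF assms(1)]]]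
      N_integral[OF l2_integrable_mult[OF assms(3) rep_l2[OF assms(2)]]] by simp
qed

end

text \<open>The set of disagreement is open and null, hence empty. This turns almost everywhere
  identities into identities that can be differentiated.\<close>

lemma AE_eq_continuous_on:
  fixes f g :: "real ^ 'd::finite \<Rightarrow> real"
  assumes S: "open S" and f: "continuous_on S f" and g: "continuous_on S g"
    and ae: "AE x in lebesgue_on S. f x = g x" and x: "x \<in> S"
  shows "f x = g x"
proof (rule ccontr)
  assume ne: "f x \<noteq> g x"
  define U where "U = S \<inter> (\<lambda>x. f x - g x) -` (- {0})"
  have U: "open U" unfolding U_def
    by (rule continuous_open_preimage[OF _ S]) (auto intro!: continuous_on_diff f g)
  have "AE x in lebesgue. x \<in> S \<longrightarrow> f x = g x"
    using ae S by (subst (asm) AE_restrict_space_iff) auto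
  then have "AE x in lebesgue. x \<notin> U" by eventually_elim (auto simp: U_def)
  then have "U \<in> null_sets lebesgue" using U by (simp add: AE_iff_null_sets)
  then have "negligible U" by (simp add: negligible_iff_null_sets)
  moreover have "x \<in> U" using ne x by (simp add: U_def)
  ultimately show False using open_not_negligible[OF U] by blast
qed

section \<open>The kernel operator of a random field\<close>

locale covariance_setup = jet_space \<Theta> k + prob_space M
  for \<Theta> :: "(real ^ 'd::finite) set" and k :: nat and M :: "'w measure" +
  fixes X :: "real ^ 'd \<Rightarrow> 'w \<Rightarrow> real" and Y :: "'d multi_index \<Rightarrow> real ^ 'd \<Rightarrow> 'w \<Rightarrow> real"
  assumes kernel: "cov_kernel M X \<in> Ckk k \<Theta>"
    and process: "weak_deriv_process M k \<Theta> X Y"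
begin

abbreviation \<gamma> where "\<gamma> \<equiv> cov_kernel M X"

definition kernel_bound :: real where
  "kernel_bound = (SOME b. \<forall>\<alpha>\<in>A. \<forall>\<beta>\<in>A. \<forall>s\<in>\<Theta>. \<forall>t\<in>\<Theta>. \<bar>mixed_deriv \<alpha> \<beta> \<gamma> s t\<bar> \<le> b)"

lemma kernel_uc: "\<alpha> \<in> A \<Longrightarrow> \<beta> \<in> A \<Longrightarrow> uniformly_continuous_on (\<Theta> \<times> \<Theta>) (\<lambda>(x, y). mixed_deriv \<alpha> \<beta> \<gamma> x y)"
  using kernel by (simp add: Ckk_def A_def)

text \<open>Uniform continuity on a bounded set bounds each mixed derivative, and there are finitely
  many pairs of indices. On the diagonal the same number bounds the second moments of the
  process.\<close>

lemma kernel_bound: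
  assumes "\<alpha> \<in> A" "\<beta> \<in> A" "s \<in> \<Theta>" "t \<in> \<Theta>"
  shows "\<bar>mixed_deriv \<alpha> \<beta> \<gamma> s t\<bar> \<le> kernel_bound"
proof -
  have "\<exists>b. \<forall>s\<in>\<Theta>. \<forall>t\<in>\<Theta>. \<bar>mixed_deriv (fst p) (snd p) \<gamma> s t\<bar> \<le> b" if p: "p \<in> A \<times> A" for p
  proof -
    have "bounded ((\<lambda>(x, y). mixed_deriv (fst p) (snd p) \<gamma> x y) ` (\<Theta> \<times> \<Theta>))"
      by (rule bounded_uniformly_continuous_image)
         (use kernel_uc p bounded_domain in \<open>auto intro: bounded_Times\<close>)
    then show ?thesis unfolding bounded_iff by fastforce
  qed
  then obtain b where b: "\<And>p s t. p \<in> A \<times> A \<Longrightarrow> s \<in> \<Theta> \<Longrightarrow> t \<in> \<Theta> \<Longrightarrow> \<bar>mixed_deriv (fst p) (snd p) \<gamma> s t\<bar> \<le> b p"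
    by metis
  have "\<forall>\<alpha>\<in>A. \<forall>\<beta>\<in>A. \<forall>s\<in>\<Theta>. \<forall>t\<in>\<Theta>. \<bar>mixed_deriv \<alpha> \<beta> \<gamma> s t\<bar> \<le> (\<Sum>p\<in>A \<times> A. \<bar>b p\<bar>)"
  proof (intro ballI)
    fix \<alpha> \<beta> s t assume "\<alpha> \<in> A" "\<beta> \<in> A" "s \<in> \<Theta>" "t \<in> \<Theta>"
    then have "\<bar>mixed_deriv \<alpha> \<beta> \<gamma> s t\<bar> \<le> \<bar>b (\<alpha>, \<beta>)\<bar>" using b[of "(\<alpha>, \<beta>)" s t] by simp
    also have "\<dots> \<le> (\<Sum>p\<in>A \<times> A. \<bar>b p\<bar>)"
      using \<open>\<alpha> \<in> A\<close> \<open>\<beta> \<in> A\<close> by (intro member_le_sum) (auto simp: finite_A)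
    finally show "\<bar>mixed_deriv \<alpha> \<beta> \<gamma> s t\<bar> \<le> (\<Sum>p\<in>A \<times> A. \<bar>b p\<bar>)" .
  qed
  then have "\<exists>b. \<forall>\<alpha>\<in>A. \<forall>\<beta>\<in>A. \<forall>s\<in>\<Theta>. \<forall>t\<in>\<Theta>. \<bar>mixed_deriv \<alpha> \<beta> \<gamma> s t\<bar> \<le> b" by blast
  from someI_ex[OF this] show ?thesis unfolding kernel_bound_def using assms by blast
qed

definition Yp :: "'d multi_index \<times> (real ^ 'd) \<Rightarrow> 'w \<Rightarrow> real" where
  "Yp z \<omega> = Y (fst z) (snd z) \<omega>"

lemma Y_moments: "\<alpha> \<in> A \<Longrightarrow> \<beta> \<in> A \<Longrightarrow> s \<in> \<Theta> \<Longrightarrow> t \<in> \<Theta> \<Longrightarrow>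
    (LINT \<omega>|M. Y \<beta> s \<omega> * Y \<alpha> t \<omega>) = mixed_deriv \<beta> \<alpha> \<gamma> s t"
  using process by (simp add: weak_deriv_process_def A_def)

lemma Yp_measurable: "(\<lambda>p. Yp (fst p) (snd p)) \<in> borel_measurable (N \<Otimes>\<^sub>M M)"
proof -
  \<comment> \<open>The process is measurable for the Borel sets of \<Theta>, whereas
    \<open>N\<close> carries the Lebesgue sets; the identity from the larger to the smaller
    sigma-algebra is measurable.\<close>
  have id: "(\<lambda>x. x) \<in> measurable (lebesgue_on \<Theta>) (restrict_space borel \<Theta>)"
    by (rule measurable_restrict_space3) (auto intro: measurable_completion)
  have snd_N: "snd \<in> measurable N (restrict_space borel \<Theta>)"
    unfolding N_def by (rule measurable_compose[OF measurable_snd id])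
  have fst_N: "fst \<in> measurable N (count_space A)" unfolding N_def by (rule measurable_fst)
  have "(\<lambda>p. Y \<alpha> (snd (fst p)) (snd p)) \<in> borel_measurable (N \<Otimes>\<^sub>M M)" if "\<alpha> \<in> A" for \<alpha>
  proof -
    have "(\<lambda>(t, \<omega>). Y \<alpha> t \<omega>) \<in> borel_measurable (restrict_space borel \<Theta> \<Otimes>\<^sub>M M)"
      using process that by (simp add: weak_deriv_process_def A_def measurable_field_def)
    moreover have "(\<lambda>p. (snd (fst p), snd p)) \<in> measurable (N \<Otimes>\<^sub>M M) (restrict_space borel \<Theta> \<Otimes>\<^sub>M M)"
      by (intro measurable_Pair measurable_compose[OF measurable_fst snd_N] measurable_snd)
    ultimately have "(\<lambda>p. (\<lambda>(t, \<omega>). Y \<alpha> t \<omega>) (snd (fst p), snd p)) \<in> borel_measurable (N \<Otimes>\<^sub>M M)"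
      by (rule measurable_compose[rotated])
    then show ?thesis by simp
  qed
  then have "(\<lambda>p. (\<lambda>\<alpha> p. Y \<alpha> (snd (fst p)) (snd p)) (fst (fst p)) p) \<in> borel_measurable (N \<Otimes>\<^sub>M M)"
    by (rule measurable_compose_countable'[OF _ measurable_compose[OF measurable_fst fst_N] countable_finite[OF finite_A]])
  then show ?thesis by (simp add: Yp_def)
qed

sublocale second_order_process N M Yp kernel_bound
proof -
  interpret finite_measure N by (rule finite_measure_N)
  show "second_order_process N M Yp kernel_bound"
  proof
    show "(\<lambda>p. Yp (fst p) (snd p)) \<in> borel_measurable (N \<Otimes>\<^sub>M M)" by (rule Yp_measurable)
    fix z assume "z \<in> space N"
    then have z: "fst z \<in> A" "snd z \<in> \<Theta>" by auto
    show "integrable M (\<lambda>\<omega>. (Yp z \<omega>)\<^sup>2)"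
      using process z by (simp add: weak_deriv_process_def A_def second_order_field_def Yp_def)
    show "(LINT \<omega>|M. (Yp z \<omega>)\<^sup>2) \<le> kernel_bound"
      using Y_moments[OF z(1) z(1) z(2) z(2)] kernel_bound[OF z(1) z(1) z(2) z(2)]
      by (simp add: Yp_def power2_eq_square)
  qed
qed

lemma K_eq: "w \<in> space N \<Longrightarrow> z \<in> space N \<Longrightarrow> K w z = mixed_deriv (fst w) (fst z) \<gamma> (snd w) (snd z)"
  unfolding K_def Yp_def by (rule Y_moments) auto

lemma K_abs_le: "w \<in> space N \<Longrightarrow> z \<in> space N \<Longrightarrow> \<bar>K w z\<bar> \<le> kernel_bound"
  by (subst K_eq) (auto intro!: kernel_bound)

lemma l2_N_integrable: "f \<in> l2 N \<Longrightarrow> integrable N f"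
  by (rule N.l2_integrable)

text \<open>\<delta> is uniform in the first argument w, which lets the estimate pass through the
  integral that defines T.\<close>

lemma K_equicontinuous:
  assumes "\<epsilon> > 0"
  obtains \<delta> where "\<delta> > 0" "\<And>w \<beta> y y'. w \<in> space N \<Longrightarrow> \<beta> \<in> A \<Longrightarrow> y \<in> \<Theta> \<Longrightarrow> y' \<in> \<Theta> \<Longrightarrow> dist y y' < \<delta> \<Longrightarrow>
     \<bar>K w (\<beta>, y) - K w (\<beta>, y')\<bar> \<le> \<epsilon>"
proof -
  have "\<exists>\<delta>>0. \<forall>x\<in>\<Theta>. \<forall>y\<in>\<Theta>. \<forall>y'\<in>\<Theta>. dist y y' < \<delta> \<longrightarrow> \<bar>mixed_deriv (fst p) (snd p) \<gamma> x y - mixed_deriv (fst p) (snd p) \<gamma> x y'\<bar> \<le> \<epsilon>"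
    if p: "p \<in> A \<times> A" for p
  proof -
    have "uniformly_continuous_on (\<Theta> \<times> \<Theta>) (\<lambda>(x, y). mixed_deriv (fst p) (snd p) \<gamma> x y)"
      using kernel_uc p by auto
    from this[unfolded uniformly_continuous_on_def, rule_format, OF assms]
    obtain \<delta> where \<delta>: "\<delta> > 0" "\<forall>u\<in>\<Theta> \<times> \<Theta>. \<forall>v\<in>\<Theta> \<times> \<Theta>. dist v u < \<delta> \<longrightarrow>
      dist ((\<lambda>(x, y). mixed_deriv (fst p) (snd p) \<gamma> x y) v) ((\<lambda>(x, y). mixed_deriv (fst p) (snd p) \<gamma> x y) u) < \<epsilon>"
      by blast
    have "\<bar>mixed_deriv (fst p) (snd p) \<gamma> x y - mixed_deriv (fst p) (snd p) \<gamma> x y'\<bar> \<le> \<epsilon>"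
      if "x \<in> \<Theta>" "y \<in> \<Theta>" "y' \<in> \<Theta>" "dist y y' < \<delta>" for x y y'
      using \<delta>(2)[rule_format, of "(x, y')" "(x, y)"] that by (simp add: dist_Pair_Pair dist_real_def)
    then show ?thesis using \<delta>(1) by blast
  qed
  then obtain \<delta> where \<delta>: "\<And>p. p \<in> A \<times> A \<Longrightarrow> \<delta> p > 0" "\<And>p x y y'. p \<in> A \<times> A \<Longrightarrow> x \<in> \<Theta> \<Longrightarrow> y \<in> \<Theta> \<Longrightarrow> y' \<in> \<Theta> \<Longrightarrow> dist y y' < \<delta> p \<Longrightarrow>
      \<bar>mixed_deriv (fst p) (snd p) \<gamma> x y - mixed_deriv (fst p) (snd p) \<gamma> x y'\<bar> \<le> \<epsilon>"
    by metis
  define m where "m = Min (\<delta> ` (A \<times> A))"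
  have ne: "finite (\<delta> ` (A \<times> A))" "\<delta> ` (A \<times> A) \<noteq> {}" using finite_A zero_in_A by auto
  show ?thesis
  proof
    show "m > 0" unfolding m_def using ne \<delta>(1) by (subst Min_gr_iff) auto
    fix w \<beta> y y' assume *: "w \<in> space N" "\<beta> \<in> A" "y \<in> \<Theta>" "y' \<in> \<Theta>" "dist y y' < m"
    then have p: "(fst w, \<beta>) \<in> A \<times> A" and w: "snd w \<in> \<Theta>" by auto
    then have "m \<le> \<delta> (fst w, \<beta>)" unfolding m_def by (intro Min_le ne) auto
    then show "\<bar>K w (\<beta>, y) - K w (\<beta>, y')\<bar> \<le> \<epsilon>"
      using \<delta>(2)[OF p w *(3,4)] * by (simp add: K_eq)
  qed
qed

text \<open>\<delta> is the same for all f; this is the equicontinuity behind the compactness of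
  T.\<close>

lemma T_equicontinuous:
  assumes "\<epsilon> > 0"
  obtains \<delta> where "\<delta> > 0" "\<And>f \<beta> y y'. f \<in> l2 N \<Longrightarrow> \<beta> \<in> A \<Longrightarrow> y \<in> \<Theta> \<Longrightarrow> y' \<in> \<Theta> \<Longrightarrow> dist y y' < \<delta> \<Longrightarrow>
     \<bar>T f (\<beta>, y) - T f (\<beta>, y')\<bar> \<le> \<epsilon> * (LINT z|N. \<bar>f z\<bar>)"
proof -
  obtain \<delta> where \<delta>: "\<delta> > 0" "\<And>w \<beta> y y'. w \<in> space N \<Longrightarrow> \<beta> \<in> A \<Longrightarrow> y \<in> \<Theta> \<Longrightarrow> y' \<in> \<Theta> \<Longrightarrow> dist y y' < \<delta> \<Longrightarrow>
     \<bar>K w (\<beta>, y) - K w (\<beta>, y')\<bar> \<le> \<epsilon>" using K_equicontinuous[OF assms] by blast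
  have "\<bar>T f (\<beta>, y) - T f (\<beta>, y')\<bar> \<le> \<epsilon> * (LINT z|N. \<bar>f z\<bar>)"
    if "f \<in> l2 N" "\<beta> \<in> A" "y \<in> \<Theta>" "y' \<in> \<Theta>" "dist y y' < \<delta>" for f \<beta> y y'
  proof -
    have "\<bar>(LINT w|N. f w * K w (\<beta>, y)) - (LINT w|N. f w * K w (\<beta>, y'))\<bar> \<le> \<epsilon> * (LINT z|N. \<bar>f z\<bar>)"
      by (rule LINT_mult_diff_bound[OF l2_N_integrable[OF that(1)] l2_integrable_mult[OF that(1) K_section_l2]
            l2_integrable_mult[OF that(1) K_section_l2]]) (use that \<delta>(2) in auto)
    then show ?thesis by (simp add: T_def mult.commute)
  qed
  then show ?thesis using that \<delta>(1) by blast
qed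

lemma T_uniformly_continuous:
  assumes f: "f \<in> l2 N" and \<beta>: "\<beta> \<in> A"
  shows "uniformly_continuous_on \<Theta> (\<lambda>y. T f (\<beta>, y))"
  unfolding uniformly_continuous_on_def
proof (intro allI impI)
  fix \<epsilon> :: real assume \<epsilon>: "\<epsilon> > 0"
  define a where "a = (LINT z|N. \<bar>f z\<bar>) + 1"
  have a: "a > 0" unfolding a_def by (rule add_nonneg_pos) auto
  have "\<epsilon> / (2 * a) > 0" using \<epsilon> a by simp
  then obtain \<delta> where \<delta>: "\<delta> > 0" "\<And>f \<beta> y y'. f \<in> l2 N \<Longrightarrow> \<beta> \<in> A \<Longrightarrow> y \<in> \<Theta> \<Longrightarrow> y' \<in> \<Theta> \<Longrightarrow> dist y y' < \<delta> \<Longrightarrow>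
     \<bar>T f (\<beta>, y) - T f (\<beta>, y')\<bar> \<le> \<epsilon> / (2 * a) * (LINT z|N. \<bar>f z\<bar>)" using T_equicontinuous by blast
  have "dist (T f (\<beta>, y')) (T f (\<beta>, y)) < \<epsilon>" if "y \<in> \<Theta>" "y' \<in> \<Theta>" "dist y' y < \<delta>" for y y'
  proof -
    have "\<bar>T f (\<beta>, y') - T f (\<beta>, y)\<bar> \<le> \<epsilon> / (2 * a) * (LINT z|N. \<bar>f z\<bar>)"
      by (rule \<delta>(2)[OF f \<beta> that(2,1,3)])
    also have "\<dots> \<le> \<epsilon> / (2 * a) * a" using \<epsilon> a by (intro mult_left_mono) (auto simp: a_def)
    also have "\<dots> < \<epsilon>" using \<epsilon> a by simp
    finally show ?thesis by (simp add: dist_real_def)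
  qed
  then show "\<exists>d>0. \<forall>x\<in>\<Theta>. \<forall>x'\<in>\<Theta>. dist x' x < d \<longrightarrow> dist (T f (\<beta>, x')) (T f (\<beta>, x)) < \<epsilon>"
    using \<delta>(1) by blast
qed

text \<open>The kernel is differentiated in its second argument under the integral, with majorant
  \<open>kernel_bound * \<bar>f w\<bar>\<close>. Since f is an arbitrary square integrable function
  and need not be a jet, the whole range of T consists of jets.\<close>

lemma T_deriv_family:
  assumes f: "f \<in> l2 N"
  shows "deriv_family k \<Theta> (\<lambda>\<beta> y. T f (\<beta>, y))"
  unfolding deriv_family_def
proof (intro allI ballI impI)
  fix \<beta> :: "'d multi_index" and i y assume y: "y \<in> \<Theta>" and \<beta>k: "mi_order \<beta> < k"
  have \<beta>: "\<beta> \<in> A" "\<beta> + axis i 1 \<in> A" using \<beta>k by (auto simp: A_def mi_order_add)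
  let ?v = "axis i 1 :: real ^ 'd"
  obtain d where d: "d > 0" "ball y d \<subseteq> \<Theta>" using open_domain y openE by blast
  have in\<Theta>: "y + t *\<^sub>R ?v \<in> \<Theta>" if "t \<in> {-d<..<d}" for t
  proof -
    have "dist y (y + t *\<^sub>R ?v) < d" using that by (simp add: dist_norm norm_axis_1 abs_less_iff)
    then show ?thesis using d(2) by auto
  qed
  have der: "((\<lambda>t. K w (\<beta>, y + t *\<^sub>R ?v) * f w) has_real_derivative K w (\<beta> + axis i 1, y + t *\<^sub>R ?v) * f w) (at t)"
    if t: "t \<in> {-d<..<d}" and w: "w \<in> space N" for t w
  proof -
    have w': "fst w \<in> A" "snd w \<in> \<Theta>" using w by auto
    let ?m = "\<lambda>\<beta> y. mixed_deriv (fst w) \<beta> \<gamma> (snd w) y"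
    have "((\<lambda>s. ?m \<beta> ((y + t *\<^sub>R ?v) + s *\<^sub>R ?v)) has_real_derivative ?m (\<beta> + axis i 1) (y + t *\<^sub>R ?v)) (at 0)"
      using kernel w' in\<Theta>[OF t] \<beta>k by (simp add: Ckk_def A_def)
    moreover have "(y + t *\<^sub>R ?v) + s *\<^sub>R ?v = y + (s + t) *\<^sub>R ?v" for s by (simp add: algebra_simps)
    ultimately have 1: "((\<lambda>t. ?m \<beta> (y + t *\<^sub>R ?v)) has_real_derivative ?m (\<beta> + axis i 1) (y + t *\<^sub>R ?v)) (at t)"
      using DERIV_shift[of "\<lambda>t. ?m \<beta> (y + t *\<^sub>R ?v)" "?m (\<beta> + axis i 1) (y + t *\<^sub>R ?v)" 0 t] by simp
    have "((\<lambda>t. K w (\<beta>, y + t *\<^sub>R ?v)) has_real_derivative K w (\<beta> + axis i 1, y + t *\<^sub>R ?v)) (at t)"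
    proof (rule has_field_derivative_transform_within_open[where S = "{-d<..<d}"])
      show "((\<lambda>t. ?m \<beta> (y + t *\<^sub>R ?v)) has_real_derivative K w (\<beta> + axis i 1, y + t *\<^sub>R ?v)) (at t)"
        using 1 K_eq[OF w, of "(\<beta> + axis i 1, y + t *\<^sub>R ?v)"] \<beta>(2) in\<Theta>[OF t] by simp
      show "?m \<beta> (y + s *\<^sub>R ?v) = K w (\<beta>, y + s *\<^sub>R ?v)" if "s \<in> {-d<..<d}" for s
        using K_eq[OF w, of "(\<beta>, y + s *\<^sub>R ?v)"] \<beta>(1) in\<Theta>[OF that] by simp
    qed (use t in auto)
    then show ?thesis by (rule DERIV_cmult_right)
  qed
  have Ki: "integrable N (\<lambda>w. K w (\<alpha>, y + t *\<^sub>R ?v) * f w)" if "\<alpha> \<in> A" "t \<in> {-d<..<d}" for \<alpha> t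
    by (rule l2_integrable_mult[OF K_section_l2 f]) (use that in\<Theta>[OF that(2)] in auto)
  have "((\<lambda>t. LINT w|N. K w (\<beta>, y + t *\<^sub>R ?v) * f w) has_real_derivative
     (LINT w|N. K w (\<beta> + axis i 1, y + 0 *\<^sub>R ?v) * f w)) (at 0)"
  proof (rule DERIV_integral[where a = "-d" and b = d and w = "\<lambda>w. kernel_bound * \<bar>f w\<bar>"])
    show "\<bar>K w (\<beta> + axis i 1, y + t *\<^sub>R ?v) * f w\<bar> \<le> kernel_bound * \<bar>f w\<bar>" if "t \<in> {-d<..<d}" "w \<in> space N" for t w
      unfolding abs_mult by (intro mult_right_mono K_abs_le) (use that in\<Theta>[OF that(1)] \<beta> in auto)
    show "(\<lambda>w. K w (\<beta> + axis i 1, y + 0 *\<^sub>R ?v) * f w) \<in> borel_measurable N"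
      by (rule borel_measurable_integrable[OF Ki]) (use d \<beta> in auto)
    show "integrable N (\<lambda>w. kernel_bound * \<bar>f w\<bar>)" using l2_N_integrable[OF f] by simp
  qed (use d Ki \<beta> der in auto)
  then show "((\<lambda>t. T f (\<beta>, y + t *\<^sub>R ?v)) has_real_derivative T f (\<beta> + axis i 1, y)) (at 0)"
    by (simp add: T_def)
qed

lemma T_Ck_uniform:
  assumes f: "f \<in> l2 N"
  shows "(\<lambda>y. T f (0, y)) \<in> Ck_uniform k \<Theta>"
  by (rule Ck_uniform_familyI[OF open_domain _ T_deriv_family[OF f]])
     (use T_uniformly_continuous[OF f] in \<open>auto simp: A_def\<close>)

lemma jet_T:
  assumes f: "f \<in> l2 N" and z: "z \<in> space N"
  shows "jet (\<lambda>y. T f (0, y)) z = T f z"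
  unfolding jet_def
  using cderiv_eqI[OF open_domain _ T_deriv_family[OF f], of "\<lambda>y. T f (0, y)" "fst z" "snd z"] z
  by (auto simp: A_def)

lemma T_rep_cong:
  assumes "rep f F" "rep f G" "z \<in> space N"
  shows "T F z = T G z"
  unfolding T_def by (rule rep_integral_cong[OF assms(1,2) K_section_l2[OF assms(3)]])

text \<open>The sum over indices and the integral over \<Theta> in \<open>kernel_op\<close> form one
  integral over \<open>N\<close>; the index 0 at y reflects that only the first argument of the
  kernel is differentiated.\<close>

lemma kernel_op_eq:
  assumes "rep f F" "y \<in> \<Theta>"
  shows "kernel_op k \<Theta> \<gamma> f y = T F (0, y)"
proof -
  define W where "W z = wderiv \<Theta> (fst z) f (snd z)" for z
  have W: "rep f W" unfolding W_def[abs_def] by (rule rep_wderiv[OF rep_Hk[OF assms(1)]])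
  have z: "(0, y) \<in> space N" using assms(2) zero_in_A by simp
  have i: "integrable N (\<lambda>w. K w (0, y) * W w)"
    by (rule l2_integrable_mult[OF K_section_l2[OF z] rep_l2[OF W]])
  have eq: "(\<lambda>x. K (\<alpha>, x) (0, y) * W (\<alpha>, x)) x = mixed_deriv \<alpha> 0 \<gamma> x y * wderiv \<Theta> \<alpha> f x" if "\<alpha> \<in> A" "x \<in> \<Theta>" for \<alpha> x
    using K_eq[of "(\<alpha>, x)" "(0, y)"] that z by (simp add: W_def)
  have i': "integrable (lebesgue_on \<Theta>) (\<lambda>x. mixed_deriv \<alpha> 0 \<gamma> x y * wderiv \<Theta> \<alpha> f x)" if "\<alpha> \<in> A" for \<alpha>
    using N_section_integrable[OF i that] by (rule Bochner_Integration.integrable_cong[THEN iffD1, rotated 2]) (use eq that in auto)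
  have "kernel_op k \<Theta> \<gamma> f y = (\<Sum>\<alpha>\<in>A. LINT x|lebesgue_on \<Theta>. mixed_deriv \<alpha> 0 \<gamma> x y * wderiv \<Theta> \<alpha> f x)"
    unfolding kernel_op_def A_def[symmetric] by (rule Bochner_Integration.integral_sum[OF i'])
  also have "\<dots> = (\<Sum>\<alpha>\<in>A. LINT x|lebesgue_on \<Theta>. K (\<alpha>, x) (0, y) * W (\<alpha>, x))"
    by (intro sum.cong refl Bochner_Integration.integral_cong) (use eq in auto)
  also have "\<dots> = T W (0, y)" unfolding T_def using N_integral[OF i] by simp
  also have "\<dots> = T F (0, y)" by (rule T_rep_cong[OF W assms(1) z])
  finally show ?thesis .
qed

text \<open>An Arzela-Ascoli argument: uniformly bounded, equicontinuous images converge along a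
  diagonal subsequence on a countable dense set, and then at every point. Bounded pointwise
  convergence on a finite measure gives convergence in mean square.\<close>

lemma T_compact:
  assumes fs: "\<And>n. fs n \<in> l2 N" "\<And>n. (LINT z|N. (fs n z)\<^sup>2) \<le> 1"
  shows "\<exists>r g. strict_mono (r :: nat \<Rightarrow> nat) \<and> g \<in> l2 N \<and> (\<lambda>i. LINT z|N. (T (fs (r i)) z - g z)\<^sup>2) \<longlonglongrightarrow> 0"
proof -
  define c where "c = sqrt (kernel_bound * (LINT z|N. K z z))"
  have bd: "\<bar>T (fs n) z\<bar> \<le> c" if z: "z \<in> space N" for n z
  proof -
    have "(T (fs n) z)\<^sup>2 \<le> kernel_bound * (LINT z|N. K z z) * (LINT z|N. (fs n z)\<^sup>2)"
      by (rule T_pointwise_bound[OF fs(1) z])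
    also have "\<dots> \<le> kernel_bound * (LINT z|N. K z z) * 1"
      by (intro mult_left_mono fs(2) mult_nonneg_nonneg B_nonneg[OF z] K_trace_nonneg)
    finally show ?thesis unfolding c_def by (intro real_le_rsqrt) simp
  qed
  \<comment> \<open>The modulus of continuity of T f is measured by the L1 norm of f, which the unit
    bound in L2 controls on a finite measure.\<close>
  have L1: "(LINT z|N. \<bar>fs n z\<bar>) \<le> sqrt (measure N (space N))" for n
  proof -
    have "(\<lambda>z. \<bar>fs n z\<bar>) \<in> l2 N" using fs(1)[of n] by (auto simp: l2_def)
    then have "(LINT z|N. \<bar>fs n z\<bar> * 1)\<^sup>2 \<le> (LINT z|N. \<bar>fs n z\<bar>\<^sup>2) * (LINT z|N. 1\<^sup>2)"
      by (rule l2_cauchy_schwarz[OF _ one_l2_N])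
    also have "\<dots> \<le> 1 * measure N (space N)"
      using fs(2)[of n] by (intro mult_mono) auto
    finally show ?thesis by (intro real_le_rsqrt) simp
  qed
  obtain D where D: "countable D" "D \<subseteq> \<Theta>" "\<Theta> \<subseteq> closure D" using separable by blast
  have "countable (A \<times> D)" by (intro countable_SIGMA countable_finite finite_A D(1))
  then obtain r where r: "strict_mono (r :: nat \<Rightarrow> nat)" "\<And>z. z \<in> A \<times> D \<Longrightarrow> \<exists>l. (\<lambda>n. T (fs (r n)) z) \<longlonglongrightarrow> l"
    by (rule function_convergent_subsequence[where f = "\<lambda>n. T (fs n)" and M = c]) (use bd D(2) in auto)
  have conv: "convergent (\<lambda>n. T (fs (r n)) z)" if z: "z \<in> space N" for z
  proof -
    obtain \<beta> y where zy: "z = (\<beta>, y)" and \<beta>: "\<beta> \<in> A" and y: "y \<in> \<Theta>" using z by auto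
    have "Cauchy (\<lambda>n. T (fs (r n)) (\<beta>, y))"
      unfolding Cauchy_def
    proof (intro allI impI)
      fix \<epsilon> :: real assume \<epsilon>: "\<epsilon> > 0"
      define q where "q = sqrt (measure N (space N)) + 1"
      \<comment> \<open>Scaled so that moving between y and y' costs \<epsilon> / 4; two such moves
        and the Cauchy error at y' add up to at most three quarters of \<epsilon>.\<close>
      define \<epsilon>' where "\<epsilon>' = \<epsilon> / (4 * q)"
      have p: "q > 0" unfolding q_def by (rule add_nonneg_pos) auto
      have "\<epsilon>' > 0" using \<epsilon> p by (simp add: \<epsilon>'_def)
      then obtain \<delta> where \<delta>: "\<delta> > 0" "\<And>f \<beta> y y'. f \<in> l2 N \<Longrightarrow> \<beta> \<in> A \<Longrightarrow> y \<in> \<Theta> \<Longrightarrow> y' \<in> \<Theta> \<Longrightarrow> dist y y' < \<delta> \<Longrightarrow>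
        \<bar>T f (\<beta>, y) - T f (\<beta>, y')\<bar> \<le> \<epsilon>' * (LINT z|N. \<bar>f z\<bar>)" using T_equicontinuous by blast
      obtain y' where y': "y' \<in> D" "dist y' y < \<delta>" using D(3) y \<delta>(1) closure_approachable[of y D] by blast
      have close: "\<bar>T (fs n) (\<beta>, y) - T (fs n) (\<beta>, y')\<bar> \<le> \<epsilon> / 4" for n
      proof -
        have "\<bar>T (fs n) (\<beta>, y) - T (fs n) (\<beta>, y')\<bar> \<le> \<epsilon>' * (LINT z|N. \<bar>fs n z\<bar>)"
          by (rule \<delta>(2)[OF fs(1) \<beta> y]) (use y' D(2) in \<open>auto simp: dist_commute\<close>)
        also have "\<dots> \<le> \<epsilon>' * q"
          using L1[of n] \<open>\<epsilon>' > 0\<close> unfolding q_def by (intro mult_left_mono) auto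
        also have "\<dots> = \<epsilon> / 4" using p by (simp add: \<epsilon>'_def)
        finally show ?thesis .
      qed
      have "Cauchy (\<lambda>n. T (fs (r n)) (\<beta>, y'))"
        using r(2)[of "(\<beta>, y')"] \<beta> y' by (auto intro: LIMSEQ_imp_Cauchy)
      moreover have "\<epsilon> / 4 > 0" using \<epsilon> by simp
      ultimately obtain n0 where n0: "\<And>m n. m \<ge> n0 \<Longrightarrow> n \<ge> n0 \<Longrightarrow> dist (T (fs (r m)) (\<beta>, y')) (T (fs (r n)) (\<beta>, y')) < \<epsilon> / 4"
        unfolding Cauchy_def by blast
      have "dist (T (fs (r m)) (\<beta>, y)) (T (fs (r n)) (\<beta>, y)) < \<epsilon>" if "m \<ge> n0" "n \<ge> n0" for m n
        using close[of "r m"] close[of "r n"] n0[OF that] \<epsilon> unfolding dist_real_def by linarith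
      then show "\<exists>n0. \<forall>m\<ge>n0. \<forall>n\<ge>n0. dist (T (fs (r m)) (\<beta>, y)) (T (fs (r n)) (\<beta>, y)) < \<epsilon>" by blast
    qed
    then show ?thesis by (simp add: zy Cauchy_convergent_iff)
  qed
  define g where "g z = lim (\<lambda>n. T (fs (r n)) z)" for z
  have g: "(\<lambda>n. T (fs (r n)) z) \<longlonglongrightarrow> g z" if "z \<in> space N" for z
    using conv[OF that] by (simp add: g_def convergent_LIMSEQ_iff)
  have gm: "g \<in> borel_measurable N"
    by (rule borel_measurable_LIMSEQ_real[OF g T_measurable[OF fs(1)]])
  have gb: "\<bar>g z\<bar> \<le> c" if "z \<in> space N" for z
    by (rule LIMSEQ_le_const2[OF tendsto_rabs[OF g[OF that]]]) (use bd[OF that] in auto)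
  have gl: "g \<in> l2 N" by (rule l2_bounded[OF N.finite_measure_axioms gm gb])
  have "(\<lambda>i. LINT z|N. (T (fs (r i)) z - g z)\<^sup>2) \<longlonglongrightarrow> (LINT z|N. 0)"
  proof (rule integral_dominated_convergence[where w = "\<lambda>_. (2 * c)\<^sup>2"])
    show "AE z in N. (\<lambda>i. (T (fs (r i)) z - g z)\<^sup>2) \<longlonglongrightarrow> 0"
    proof (intro AE_I2)
      fix z assume z: "z \<in> space N"
      have "(\<lambda>i. (T (fs (r i)) z - g z)\<^sup>2) \<longlonglongrightarrow> (g z - g z)\<^sup>2"
        by (intro tendsto_intros g z)
      then show "(\<lambda>i. (T (fs (r i)) z - g z)\<^sup>2) \<longlonglongrightarrow> 0" by simp
    qed
    show "AE z in N. norm ((T (fs (r i)) z - g z)\<^sup>2) \<le> (2 * c)\<^sup>2" for i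
    proof (intro AE_I2)
      fix z assume z: "z \<in> space N"
      have "\<bar>T (fs (r i)) z - g z\<bar> \<le> 2 * c" using bd[OF z, of "r i"] gb[OF z] by linarith
      then have "\<bar>T (fs (r i)) z - g z\<bar>\<^sup>2 \<le> (2 * c)\<^sup>2" by (intro power_mono) auto
      then show "norm ((T (fs (r i)) z - g z)\<^sup>2) \<le> (2 * c)\<^sup>2" by simp
    qed
    show "(\<lambda>z. (T (fs (r i)) z - g z)\<^sup>2) \<in> borel_measurable N" for i
      by (intro borel_measurable_power borel_measurable_diff gm T_measurable fs(1))
  qed auto
  then show ?thesis using r(1) gl by (intro exI[of _ r] exI[of _ g]) simp
qed

sublocale CPO: compact_psd_operator N T "LINT z|N. K z z"
  by (rule compact_psd_operatorI) (rule T_compact)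

end

section \<open>Linear combinations and their jets\<close>

lemma
  assumes "open S" "finite F" "\<And>j. j \<in> F \<Longrightarrow> e j \<in> Ck_uniform k S"
  shows Ck_uniform_sum: "(\<lambda>x. \<Sum>j\<in>F. c j * e j x) \<in> Ck_uniform k S"
    and cderiv_sum: "mi_order \<alpha> \<le> k \<Longrightarrow> x \<in> S \<Longrightarrow> cderiv \<alpha> (\<lambda>x. \<Sum>j\<in>F. c j * e j x) x = (\<Sum>j\<in>F. c j * cderiv \<alpha> (e j) x)"
proof -
  have "(\<lambda>x. \<Sum>j\<in>F. c j * e j x) \<in> Ck_uniform k S \<and>
    (mi_order \<alpha> \<le> k \<longrightarrow> x \<in> S \<longrightarrow> cderiv \<alpha> (\<lambda>x. \<Sum>j\<in>F. c j * e j x) x = (\<Sum>j\<in>F. c j * cderiv \<alpha> (e j) x))"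
    using assms(2,3)
  proof (induction F)
    case empty
    then show ?case by (simp add: zero_Ck_uniform cderiv_zero)
  next
    case (insert a F)
    have eq: "(\<lambda>x. \<Sum>j\<in>insert a F. c j * e j x) = (\<lambda>x. (\<Sum>j\<in>F. c j * e j x) + c a * e a x)"
      using insert(1,2) by (simp add: add.commute)
    have F: "(\<lambda>x. \<Sum>j\<in>F. c j * e j x) \<in> Ck_uniform k S" and a: "e a \<in> Ck_uniform k S"
      using insert by auto
    show ?case
      unfolding eq using Ck_uniform_add_scale[OF assms(1) F a] cderiv_add_scale[OF assms(1) F a] insert by auto
  qed
  then show "(\<lambda>x. \<Sum>j\<in>F. c j * e j x) \<in> Ck_uniform k S"
    "mi_order \<alpha> \<le> k \<Longrightarrow> x \<in> S \<Longrightarrow> cderiv \<alpha> (\<lambda>x. \<Sum>j\<in>F. c j * e j x) x = (\<Sum>j\<in>F. c j * cderiv \<alpha> (e j) x)"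
    by auto
qed

lemma (in jet_space)
  assumes "f \<in> Ck_uniform k \<Theta>"
  shows scale_Ck_uniform: "(\<lambda>x. c * f x) \<in> Ck_uniform k \<Theta>"
    and jet_scale: "z \<in> space N \<Longrightarrow> jet (\<lambda>x. c * f x) z = c * jet f z"
  using Ck_uniform_add_scale[OF open_domain zero_Ck_uniform assms, of c]
    cderiv_add_scale[OF open_domain zero_Ck_uniform assms, of "fst z" "snd z" c]
  by (auto simp: jet_def A_def cderiv_zero)

lemma (in jet_space) jet_cong:
  assumes "\<And>x. x \<in> \<Theta> \<Longrightarrow> f x = g x" "z \<in> space N"
  shows "jet f z = jet g z"
  unfolding jet_def by (rule cderiv_cong_open[OF open_domain assms(1)]) (use assms(2) in auto)

lemma (in jet_space) Ck_uniform_continuous: "f \<in> Ck_uniform k \<Theta> \<Longrightarrow> continuous_on \<Theta> f"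
proof -
  assume "f \<in> Ck_uniform k \<Theta>"
  then have "uniformly_continuous_on \<Theta> (cderiv 0 f)" unfolding Ck_uniform_def by (auto simp del: cderiv_0)
  then show ?thesis by (simp add: uniformly_continuous_imp_continuous)
qed

section \<open>Mercer's theorem for the mixed derivatives of the covariance kernel\<close>

locale mercer_setup = covariance_setup \<Theta> k M X Y
  for \<Theta> :: "(real ^ 'd::finite) set" and k :: nat and M :: "'w measure"
    and X :: "real ^ 'd \<Rightarrow> 'w \<Rightarrow> real" and Y :: "'d multi_index \<Rightarrow> real ^ 'd \<Rightarrow> 'w \<Rightarrow> real" +
  fixes J :: "nat set" and lam :: "nat \<Rightarrow> real" and e :: "nat \<Rightarrow> real ^ 'd \<Rightarrow> real"
  assumes eigensystem: "eigensystem k \<Theta> (cov_kernel M X) J lam e"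
begin

lemma J_shape: "J = {1..} \<or> (\<exists>N. J = {1..N})"
  and lam_nonzero: "j \<in> J \<Longrightarrow> lam j \<noteq> 0"
  and lam_decreasing: "i \<in> J \<Longrightarrow> j \<in> J \<Longrightarrow> i \<le> j \<Longrightarrow> lam j \<le> lam i"
  and e_Ck: "j \<in> J \<Longrightarrow> e j \<in> Ck_uniform k \<Theta>"
  and e_eigen_AE: "j \<in> J \<Longrightarrow> AE y in lebesgue_on \<Theta>. kernel_op k \<Theta> \<gamma> (e j) y = lam j * e j y"
  and e_orthonormal_Hk: "i \<in> J \<Longrightarrow> j \<in> J \<Longrightarrow> Hk_inner k \<Theta> (e i) (e j) = (if i = j then 1 else 0)"
  and e_complete: "\<mu> \<noteq> 0 \<Longrightarrow> f \<in> Hk k \<Theta> \<Longrightarrow> AE y in lebesgue_on \<Theta>. kernel_op k \<Theta> \<gamma> f y = \<mu> * f y \<Longrightarrow>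
     \<exists>F c. finite F \<and> F \<subseteq> {j\<in>J. lam j = \<mu>} \<and> (AE y in lebesgue_on \<Theta>. f y = (\<Sum>j\<in>F. c j * e j y))"
  using eigensystem unfolding eigensystem_def by blast+

lemma J_initial: "j \<in> J \<Longrightarrow> 1 \<le> i \<Longrightarrow> i \<le> j \<Longrightarrow> i \<in> J" and J_pos: "j \<in> J \<Longrightarrow> 1 \<le> j"
  using J_shape by auto

abbreviation je where "je j \<equiv> jet (e j)"

lemma je_rep: "j \<in> J \<Longrightarrow> rep (e j) (je j)"
  by (rule rep_jet[OF e_Ck])

lemma je_l2: "j \<in> J \<Longrightarrow> je j \<in> l2 N"
  by (rule rep_l2[OF je_rep])

lemma je_orthonormal: "i \<in> J \<Longrightarrow> j \<in> J \<Longrightarrow> (LINT z|N. je i z * je j z) = (if i = j then 1 else 0)"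
  using Hk_inner_rep[OF je_rep je_rep, of i j] e_orthonormal_Hk by simp

text \<open>The eigenvalue equation is given almost everywhere and for index 0. Continuity of both
  sides makes it hold on all of \<Theta>, and differentiating both sides then yields every
  index.\<close>

lemma je_eigen:
  assumes j: "j \<in> J" and z: "z \<in> space N"
  shows "T (je j) z = lam j * je j z"
proof -
  have eq: "T (je j) (0, y) = lam j * e j y" if y: "y \<in> \<Theta>" for y
  proof (rule AE_eq_continuous_on[OF open_domain _ _ _ y])
    show "continuous_on \<Theta> (\<lambda>y. T (je j) (0, y))"
      by (rule Ck_uniform_continuous[OF T_Ck_uniform[OF je_l2[OF j]]])
    show "continuous_on \<Theta> (\<lambda>y. lam j * e j y)"
      by (intro continuous_on_mult continuous_on_const Ck_uniform_continuous e_Ck j)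
    show "AE y in lebesgue_on \<Theta>. T (je j) (0, y) = lam j * e j y"
      using e_eigen_AE[OF j] AE_space
      by eventually_elim (simp add: kernel_op_eq[OF je_rep[OF j]])
  qed
  have "T (je j) z = jet (\<lambda>y. T (je j) (0, y)) z" by (rule jet_T[OF je_l2[OF j] z, symmetric])
  also have "\<dots> = jet (\<lambda>y. lam j * e j y) z" by (rule jet_cong[OF eq z])
  also have "\<dots> = lam j * je j z" by (rule jet_scale[OF e_Ck[OF j] z])
  finally show ?thesis .
qed

text \<open>An eigensystem lists non-zero eigenvalues; their sign comes from the positivity of
  T.\<close>

lemma lam_pos:
  assumes j: "j \<in> J"
  shows "0 < lam j"
proof -
  have "0 \<le> (LINT z|N. T (je j) z * je j z)" by (rule CPO.T_pos[OF je_l2[OF j]])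
  also have "\<dots> = (LINT z|N. lam j * (je j z * je j z))"
    by (rule Bochner_Integration.integral_cong) (auto simp: je_eigen[OF j])
  also have "\<dots> = lam j" using je_orthonormal[OF j j] by simp
  finally show ?thesis using lam_nonzero[OF j] by simp
qed

section \<open>The trace and the decay of the eigenvalues\<close>

definition trace :: real where "trace = (LINT z|N. K z z)"

lemma trace_nonneg: "0 \<le> trace"
  unfolding trace_def by (rule K_trace_nonneg)

lemma residual:
  assumes "finite F" "F \<subseteq> J" "z \<in> space N"
  shows "(\<lambda>\<omega>. Yp z \<omega> - (\<Sum>j\<in>F. coef (je j) \<omega> * je j z)) \<in> l2 M"
    and "(LINT \<omega>|M. (Yp z \<omega> - (\<Sum>j\<in>F. coef (je j) \<omega> * je j z))\<^sup>2) = K z z - (\<Sum>j\<in>F. lam j * (je j z)\<^sup>2)"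
proof -
  note r = residual_second_moment[OF assms(1) _ _ _ assms(3), of je lam]
  have J: "j \<in> J" if "j \<in> F" for j using assms(2) that by blast
  show "(\<lambda>\<omega>. Yp z \<omega> - (\<Sum>j\<in>F. coef (je j) \<omega> * je j z)) \<in> l2 M"
    by (rule r(1)) (auto intro: je_l2 je_eigen J simp: je_orthonormal J)
  show "(LINT \<omega>|M. (Yp z \<omega> - (\<Sum>j\<in>F. coef (je j) \<omega> * je j z))\<^sup>2) = K z z - (\<Sum>j\<in>F. lam j * (je j z)\<^sup>2)"
    by (rule r(2)) (auto intro: je_l2 je_eigen J simp: je_orthonormal J)
qed

text \<open>The residual of a finite expansion has a non-negative second moment at each z;
  integration over z turns each squared eigenfunction into 1.\<close>

lemma sum_lam_le:
  assumes F: "finite F" "F \<subseteq> J"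
  shows "(\<Sum>j\<in>F. lam j) \<le> trace"
proof -
  have i: "integrable N (\<lambda>z. (je j z)\<^sup>2)" if "j \<in> F" for j
    using je_l2[of j] F that by (auto simp: l2_def)
  have "(\<Sum>j\<in>F. lam j) = (\<Sum>j\<in>F. LINT z|N. lam j * (je j z)\<^sup>2)"
    by (rule sum.cong) (use je_orthonormal F in \<open>auto simp: power2_eq_square subset_iff\<close>)
  also have "\<dots> = (LINT z|N. (\<Sum>j\<in>F. lam j * (je j z)\<^sup>2))"
    by (rule Bochner_Integration.integral_sum[symmetric]) (use i in auto)
  also have "\<dots> \<le> (LINT z|N. K z z)"
  proof (rule integral_mono)
    show "integrable N (\<lambda>z. \<Sum>j\<in>F. lam j * (je j z)\<^sup>2)" using i by auto
    show "integrable N (\<lambda>z. K z z)" by (rule K_diag_integrable)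
    fix z assume z: "z \<in> space N"
    have "0 \<le> (LINT \<omega>|M. (Yp z \<omega> - (\<Sum>j\<in>F. coef (je j) \<omega> * je j z))\<^sup>2)" by simp
    then show "(\<Sum>j\<in>F. lam j * (je j z)\<^sup>2) \<le> K z z" using residual(2)[OF F z] by simp
  qed
  finally show ?thesis by (simp add: trace_def)
qed

text \<open>Indices start at 1, so exactly j eigenvalues have index at most j, and by monotonicity
  each of them is at least \<open>lam j\<close>.\<close>

lemma lam_le: "j \<in> J \<Longrightarrow> real j * lam j \<le> trace"
proof -
  assume j: "j \<in> J"
  have sub: "{1..j} \<subseteq> J" using J_initial[OF j] by auto
  have "real j * lam j = (\<Sum>i\<in>{1..j}. lam j)" by simp
  also have "\<dots> \<le> (\<Sum>i\<in>{1..j}. lam i)"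
    by (rule sum_mono) (use lam_decreasing[OF _ j] sub in auto)
  also have "\<dots> \<le> trace" by (rule sum_lam_le) (use sub in auto)
  finally show ?thesis .
qed

definition F :: "nat \<Rightarrow> nat set" where "F m = {j \<in> J. j \<le> m}"

lemma finite_F: "finite (F m)" and F_subset: "F m \<subseteq> J"
  by (auto simp: F_def)

text \<open>An upper bound for the eigenvalue of index m + 1. It makes sense also when J ends
  earlier, and it tends to 0.\<close>

definition rad :: "nat \<Rightarrow> real" where "rad m = trace / real (Suc m)"

lemma rad_nonneg: "0 \<le> rad m"
  by (simp add: rad_def trace_nonneg)

lemma rad_tendsto: "rad \<longlonglongrightarrow> 0"
proof -
  have "(\<lambda>m. trace * inverse (real (Suc m))) \<longlonglongrightarrow> trace * 0"
    by (intro tendsto_mult tendsto_const LIMSEQ_inverse_real_of_nat)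
  then show ?thesis by (simp add: rad_def[abs_def] divide_inverse)
qed

lemma lam_gt_rad:
  assumes "j \<in> J" "lam j > rad m"
  shows "j \<in> F m"
proof (rule ccontr)
  assume "j \<notin> F m"
  then have "Suc m \<le> j" using assms(1) by (auto simp: F_def)
  then have "real (Suc m) * lam j \<le> real j * lam j"
    using lam_pos[OF assms(1)] by (intro mult_right_mono) auto
  then have "real (Suc m) * lam j \<le> trace" using lam_le[OF assms(1)] by simp
  then show False using assms(2) by (simp add: rad_def field_simps)
qed

text \<open>Up to a null function f is the jet of \<open>g0\<close>, which is then an H^k
  eigenfunction of the kernel operator. By completeness of the eigensystem it is a combination of
  eigenfunctions with \<open>lam j = \<mu>\<close>, which exceeds \<open>rad m\<close>; all of these
  lie in \<open>F m\<close>, so orthogonality leaves nothing.\<close>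

lemma no_large_eigenvalue:
  assumes f: "f \<in> l2 N" and orth: "\<And>j. j \<in> F m \<Longrightarrow> CPO.ip f (je j) = 0"
    and \<mu>: "\<mu> > rad m" and eig: "(LINT z|N. (T f z - \<mu> * f z)\<^sup>2) = 0"
  shows "(LINT z|N. (f z)\<^sup>2) = 0"
proof -
  have \<mu>0: "\<mu> > 0" using \<mu> rad_nonneg[of m] by linarith
  define g0 where "g0 y = (1 / \<mu>) * T f (0, y)" for y
  have g0: "g0 \<in> Ck_uniform k \<Theta>"
    unfolding g0_def[abs_def] by (rule scale_Ck_uniform[OF T_Ck_uniform[OF f]])
  have jg: "jet g0 z = (1 / \<mu>) * T f z" if "z \<in> space N" for z
    unfolding g0_def[abs_def] jet_scale[OF T_Ck_uniform[OF f] that] jet_T[OF f that] ..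
  have gl: "jet g0 \<in> l2 N" by (rule rep_l2[OF rep_jet[OF g0]])
  \<comment> \<open>The difference between the jet and f is null but need not be zero, so inner
    products and T have to be shown to ignore it.\<close>
  define h where "h z = jet g0 z + (- 1) * f z" for z
  have hl: "h \<in> l2 N" unfolding h_def[abs_def] by (rule l2_add_scale[OF gl f])
  have h0: "(LINT z|N. (h z)\<^sup>2) = 0"
  proof -
    have "(LINT z|N. (h z)\<^sup>2) = (LINT z|N. (1 / \<mu>\<^sup>2) * (T f z - \<mu> * f z)\<^sup>2)"
    proof (rule Bochner_Integration.integral_cong[OF refl])
      fix z assume z: "z \<in> space N"
      have "h z = (1 / \<mu>) * (T f z - \<mu> * f z)" using \<mu>0 by (simp add: h_def jg[OF z] field_simps)
      then show "(h z)\<^sup>2 = (1 / \<mu>\<^sup>2) * (T f z - \<mu> * f z)\<^sup>2" by (simp add: power_mult_distrib power_divide)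
    qed
    then show ?thesis using eig by simp
  qed
  have ip_h: "CPO.ip u h = 0" if "u \<in> l2 N" for u
    using CPO.ip_cauchy_schwarz[OF that hl] h0 unfolding CPO.ip_self by simp
  \<comment> \<open>The pointwise bound makes T of a null function vanish at every point, not just
    almost everywhere.\<close>
  have Tg: "T (jet g0) z = T f z" if z: "z \<in> space N" for z
  proof -
    have "(T h z)\<^sup>2 \<le> 0" using T_pointwise_bound[OF hl z] h0 by simp
    then have "T h z = 0" by simp
    then show ?thesis using T_add[OF gl f z, of "- 1"] by (simp add: h_def[abs_def])
  qed
  have "AE y in lebesgue_on \<Theta>. kernel_op k \<Theta> \<gamma> g0 y = \<mu> * g0 y"
  proof (intro AE_I2)
    fix y assume "y \<in> space (lebesgue_on \<Theta>)"
    then have y: "y \<in> \<Theta>" by simp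
    have "kernel_op k \<Theta> \<gamma> g0 y = T (jet g0) (0, y)" by (rule kernel_op_eq[OF rep_jet[OF g0] y])
    also have "\<dots> = T f (0, y)" by (rule Tg) (use y zero_in_A in simp)
    finally show "kernel_op k \<Theta> \<gamma> g0 y = \<mu> * g0 y" using \<mu>0 by (simp add: g0_def)
  qed
  then obtain F' c where F': "finite F'" "F' \<subseteq> {j\<in>J. lam j = \<mu>}"
    and ae: "AE y in lebesgue_on \<Theta>. g0 y = (\<Sum>j\<in>F'. c j * e j y)"
    using e_complete[of \<mu> g0] \<mu>0 Ck_uniform_Hk[OF open_domain bounded_domain g0] by auto
  have F'J: "j \<in> J" "j \<in> F m" if "j \<in> F'" for j
    using that F'(2) lam_gt_rad[of j m] \<mu> by auto
  have sC: "(\<lambda>y. \<Sum>j\<in>F'. c j * e j y) \<in> Ck_uniform k \<Theta>"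
    by (rule Ck_uniform_sum[OF open_domain F'(1)]) (rule e_Ck[OF F'J(1)])
  have g0_eq: "g0 y = (\<Sum>j\<in>F'. c j * e j y)" if "y \<in> \<Theta>" for y
    by (rule AE_eq_continuous_on[OF open_domain Ck_uniform_continuous[OF g0] Ck_uniform_continuous[OF sC] ae that])
  have jg_eq: "jet g0 z = (\<Sum>j\<in>F'. c j * je j z)" if z: "z \<in> space N" for z
  proof -
    have "jet g0 z = jet (\<lambda>y. \<Sum>j\<in>F'. c j * e j y) z" by (rule jet_cong[OF g0_eq z])
    also have "\<dots> = (\<Sum>j\<in>F'. c j * je j z)"
      unfolding jet_def by (rule cderiv_sum[OF open_domain F'(1) e_Ck[OF F'J(1)]]) (use z in \<open>auto simp: A_def\<close>)
    finally show ?thesis .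
  qed
  have gj: "CPO.ip (jet g0) (je j) = 0" if j: "j \<in> F'" for j
  proof -
    note jl = je_l2[OF F'J(1)[OF j]]
    have "CPO.ip h (je j) = CPO.ip (jet g0) (je j) + (- 1) * CPO.ip f (je j)"
      unfolding h_def[abs_def] by (rule CPO.ip_add[OF gl f jl])
    moreover have "CPO.ip h (je j) = 0" using ip_h[OF jl] by (simp only: CPO.ip_commute[of h])
    ultimately show ?thesis using orth[OF F'J(2)[OF j]] by simp
  qed
  have gg: "CPO.ip (jet g0) (jet g0) = 0"
  proof -
    have "CPO.ip (jet g0) (jet g0) = (LINT z|N. (\<Sum>j\<in>F'. c j * (jet g0 z * je j z)))"
      unfolding CPO.ip_def
    proof (rule Bochner_Integration.integral_cong[OF refl])
      fix z assume z: "z \<in> space N"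
      have "jet g0 z * jet g0 z = jet g0 z * (\<Sum>j\<in>F'. c j * je j z)" by (simp only: jg_eq[OF z])
      then show "jet g0 z * jet g0 z = (\<Sum>j\<in>F'. c j * (jet g0 z * je j z))"
        by (simp add: sum_distrib_left mult_ac)
    qed
    also have "\<dots> = (\<Sum>j\<in>F'. LINT z|N. c j * (jet g0 z * je j z))"
      by (rule Bochner_Integration.integral_sum)
         (intro integrable_mult_right l2_integrable_mult[OF gl je_l2[OF F'J(1)]])
    also have "\<dots> = 0" using gj by (simp add: CPO.ip_def)
    finally show ?thesis .
  qed
  have "CPO.ip (\<lambda>z. jet g0 z + (- 1) * h z) (\<lambda>z. jet g0 z + (- 1) * h z) = 0"
    unfolding CPO.ip_square_add[OF gl hl] gg ip_h[OF gl] ip_h[OF hl] by simp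
  moreover have "(\<lambda>z. jet g0 z + (- 1) * h z) = f" by (simp add: h_def)
  ultimately have "CPO.ip f f = 0" by (simp only:)
  then show ?thesis by (simp only: CPO.ip_self)
qed

text \<open>The orthogonal complement of the eigenfunctions in \<open>F m\<close> is a closed
  invariant subspace without eigenvalues above \<open>rad m\<close>, so the general bound on the
  form applies to it.\<close>

lemma deflated_form_bound:
  assumes f: "f \<in> l2 N" and orth: "\<And>j. j \<in> F m \<Longrightarrow> CPO.ip f (je j) = 0"
  shows "CPO.ip (T f) f \<le> rad m * CPO.ip f f"
proof -
  let ?W = "{f \<in> l2 N. \<forall>j\<in>F m. CPO.ip f (je j) = 0}"
  show ?thesis
  proof (rule CPO.form_bounded_by_eigenvalues[where W = ?W])
    have J: "j \<in> J" if "j \<in> F m" for j using that by (simp add: F_def)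
    show "?W \<subseteq> l2 N" by auto
    show "(\<lambda>z. f z + c * g z) \<in> ?W"
      if "f \<in> ?W" "g \<in> ?W" for f g c
      using that by (auto intro!: l2_add_scale simp: CPO.ip_add je_l2 J)
    show "T f \<in> ?W"
      if "f \<in> ?W" for f
    proof (intro CollectI conjI ballI)
      have fl: "f \<in> l2 N" using that by simp
      then show "T f \<in> l2 N" by (rule T_l2)
      fix j assume j: "j \<in> F m"
      have "CPO.ip (T f) (je j) = CPO.ip (T (je j)) f"
        unfolding CPO.ip_def by (rule CPO.T_sym[OF fl je_l2[OF J[OF j]]])
      also have "\<dots> = CPO.ip (\<lambda>z. je j z + (lam j - 1) * je j z) f"
        by (rule CPO.ip_cong) (auto simp: je_eigen[OF J[OF j]] algebra_simps)
      also have "\<dots> = 0"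
        using that j CPO.ip_add[OF je_l2[OF J[OF j]] je_l2[OF J[OF j]] fl, of "lam j - 1"] CPO.ip_commute[of f "je j"] by simp
      finally show "CPO.ip (T f) (je j) = 0" .
    qed
    show "g \<in> ?W"
      if fs: "\<And>i::nat. fs i \<in> ?W" and g: "g \<in> l2 N"
        and lim: "(\<lambda>i. LINT z|N. (fs i z - g z)\<^sup>2) \<longlonglongrightarrow> 0" for fs g
    proof (intro CollectI conjI ballI g)
      fix j assume j: "j \<in> F m"
      note jl = je_l2[OF J[OF j]]
      \<comment> \<open>Cauchy-Schwarz with the unit vector \<open>je j\<close>: as
        \<open>fs i\<close> is orthogonal to it only g contributes, and the right-hand side tends to
        0.\<close>
      have "(CPO.ip g (je j))\<^sup>2 \<le> (LINT z|N. (fs i z - g z)\<^sup>2)" for i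
      proof -
        have fl: "fs i \<in> l2 N" using fs by simp
        have dl: "(\<lambda>z. fs i z + (- 1) * g z) \<in> l2 N" by (rule l2_add_scale[OF fl g])
        have "CPO.ip (\<lambda>z. fs i z + (- 1) * g z) (je j) = - CPO.ip g (je j)"
          using CPO.ip_add[OF fl g jl, of "- 1"] fs[of i] j by simp
        moreover have "CPO.ip (je j) (je j) = 1" using je_orthonormal[OF J[OF j] J[OF j]] by (simp add: CPO.ip_def)
        moreover have "CPO.ip (\<lambda>z. fs i z + (- 1) * g z) (\<lambda>z. fs i z + (- 1) * g z) = (LINT z|N. (fs i z - g z)\<^sup>2)"
          unfolding CPO.ip_self by simp
        ultimately show ?thesis using CPO.ip_cauchy_schwarz[OF dl jl] by (simp only: power2_minus mult_1_right)
      qed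
      then have "(CPO.ip g (je j))\<^sup>2 \<le> 0" by (intro LIMSEQ_le_const[OF lim]) auto
      then show "CPO.ip g (je j) = 0" by simp
    qed
    show "0 \<le> rad m" by (rule rad_nonneg)
    show "(LINT z|N. (f z)\<^sup>2) = 0"
      if "f \<in> ?W" "\<mu> > rad m" "(LINT z|N. (T f z - \<mu> * f z)\<^sup>2) = 0" for f \<mu>
      by (rule no_large_eigenvalue[OF _ _ that(2,3)]) (use that(1) in auto)
    show "f \<in> ?W" using f orth by simp
  qed
qed

lemma
  assumes f: "f \<in> l2 N"
  shows form_expansion: "CPO.ip (T f) f \<le> (\<Sum>j\<in>F m. lam j * (CPO.ip f (je j))\<^sup>2) + rad m * CPO.ip f f"
    and norm_expansion: "(LINT z|N. (T f z - (\<Sum>j\<in>F m. lam j * CPO.ip f (je j) * je j z))\<^sup>2) \<le> (rad m)\<^sup>2 * CPO.ip f f"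
proof -
  have J: "j \<in> J" if "j \<in> F m" for j using that by (simp add: F_def)
  have on: "CPO.ip (je i) (je j) = (if i = j then 1 else 0)" if "i \<in> F m" "j \<in> F m" for i j
    using je_orthonormal[OF J[OF that(1)] J[OF that(2)]] by (simp add: CPO.ip_def)
  note d = CPO.deflation_form[OF finite_F je_l2[OF J] je_eigen[OF J] on rad_nonneg f deflated_form_bound]
    CPO.deflation_norm[OF finite_F je_l2[OF J] je_eigen[OF J] on rad_nonneg f deflated_form_bound]
  show "CPO.ip (T f) f \<le> (\<Sum>j\<in>F m. lam j * (CPO.ip f (je j))\<^sup>2) + rad m * CPO.ip f f"
    by (rule d(1)) auto
  show "(LINT z|N. (T f z - (\<Sum>j\<in>F m. lam j * CPO.ip f (je j) * je j z))\<^sup>2) \<le> (rad m)\<^sup>2 * CPO.ip f f"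
    by (rule d(2)) auto
qed

lemma lam_summable: "lam summable_on S" if "S \<subseteq> J" for S
proof (rule nonneg_bdd_above_summable_on)
  show "0 \<le> lam x" if "x \<in> S" for x using lam_pos[of x] that \<open>S \<subseteq> J\<close> by auto
  show "bdd_above (sum lam ` {F. F \<subseteq> S \<and> finite F})"
    by (rule bdd_aboveI[of _ trace]) (use sum_lam_le that in auto)
qed

text \<open>Testing the operator against the uniform density of a small ball around t and letting the ball
  shrink transfers the operator bound to the diagonal of the kernel.\<close>

lemma residual_kernel_le_tail:
  assumes \<alpha>: "\<alpha> \<in> A" and t: "t \<in> \<Theta>" and C: "\<And>j x. j \<in> J \<Longrightarrow> x \<in> \<Theta> \<Longrightarrow> \<bar>cderiv \<alpha> (e j) x\<bar> \<le> C"
  shows "K (\<alpha>, t) (\<alpha>, t) - (\<Sum>j\<in>F m. lam j * (je j (\<alpha>, t))\<^sup>2) \<le> C\<^sup>2 * (\<Sum>\<^sub>\<infinity>j\<in>{j\<in>J. j > m}. lam j)"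
proof -
  define R where "R w w' = mixed_deriv \<alpha> \<alpha> \<gamma> w w' - (\<Sum>j\<in>F m. lam j * cderiv \<alpha> (e j) w * cderiv \<alpha> (e j) w')" for w w'
  define tail where "tail = (\<Sum>\<^sub>\<infinity>j\<in>{j\<in>J. j > m}. lam j)"
  have K_R: "K (\<alpha>, w) (\<alpha>, w') - (\<Sum>j\<in>F m. lam j * je j (\<alpha>, w) * je j (\<alpha>, w')) = R w w'" if "w \<in> \<Theta>" "w' \<in> \<Theta>" for w w'
    using K_eq[of "(\<alpha>, w)" "(\<alpha>, w')"] \<alpha> that by (simp add: R_def jet_def)
  have "R t t \<le> C\<^sup>2 * tail + \<epsilon>" if \<epsilon>: "\<epsilon> > 0" for \<epsilon>
  proof -
    have ec: "continuous_on \<Theta> (cderiv \<alpha> (e j))" if "j \<in> F m" for j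
      using e_Ck[of j] that \<alpha> F_subset by (auto simp: Ck_uniform_def A_def intro!: uniformly_continuous_imp_continuous)
    have "continuous_on (\<Theta> \<times> \<Theta>) (\<lambda>p. R (fst p) (snd p))"
      unfolding R_def
    proof (intro continuous_on_diff continuous_on_sum continuous_on_mult continuous_on_const)
      show "continuous_on (\<Theta> \<times> \<Theta>) (\<lambda>p. mixed_deriv \<alpha> \<alpha> \<gamma> (fst p) (snd p))"
        using uniformly_continuous_imp_continuous[OF kernel_uc[OF \<alpha> \<alpha>]] by (simp add: split_beta')
    qed (auto intro!: continuous_on_compose2[OF ec] continuous_intros)
    then have "\<exists>d>0. \<forall>p\<in>\<Theta> \<times> \<Theta>. dist p (t, t) < d \<longrightarrow> dist (R (fst p) (snd p)) (R t t) < \<epsilon>"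
      using t \<epsilon> unfolding continuous_on_iff by fastforce
    then obtain d where d: "d > 0" "\<And>w w'. w \<in> \<Theta> \<Longrightarrow> w' \<in> \<Theta> \<Longrightarrow> dist (w, w') (t, t) < d \<Longrightarrow> \<bar>R w w' - R t t\<bar> < \<epsilon>"
      by (auto simp: dist_real_def)
    obtain d' where d': "d' > 0" "ball t d' \<subseteq> \<Theta>" using open_domain t openE by blast
    \<comment> \<open>Half of d for each point keeps a pair of points of U within d of (t,
      t).\<close>
    define \<delta> where "\<delta> = min (d / 2) d'"
    define U where "U = ball t \<delta>"
    have \<delta>: "\<delta> > 0" using d(1) d'(1) by (simp add: \<delta>_def)
    have U: "U \<subseteq> \<Theta>" unfolding U_def \<delta>_def using d'(2) by auto
    have RU: "R t t - \<epsilon> \<le> R w w'" if "w \<in> U" "w' \<in> U" for w w'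
    proof -
      have "dist w t < d / 2" "dist w' t < d / 2" using that by (auto simp: U_def \<delta>_def dist_commute)
      then have "dist (w, w') (t, t) < d"
        using sqrt_sum_squares_le_sum[of "dist w t" "dist w' t"] by (simp add: dist_Pair_Pair)
      moreover have "w \<in> \<Theta>" "w' \<in> \<Theta>" using that U by auto
      ultimately show ?thesis using d(2)[of w w'] by (simp add: abs_less_iff)
    qed
    define v where "v = measure (lebesgue_on \<Theta>) U"
    have Um: "U \<in> sets (lebesgue_on \<Theta>)"
      unfolding U_def using U open_domain by (subst sets_restrict_space_iff) (auto simp: U_def)
    have v: "v > 0"
    proof -
      have "v = measure lebesgue U"
        unfolding v_def using U open_domain by (intro measure_restrict_space) auto
      then show ?thesis using content_ball_pos[OF \<delta>, of t] by (simp add: U_def)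
    qed
    \<comment> \<open>The uniform probability density of U, concentrated on the index
      \<alpha>.\<close>
    define b where "b z = (if fst z = \<alpha> then indicator U (snd z) / v else 0)" for z :: "'d multi_index \<times> (real ^ 'd)"
    have b_nonneg: "0 \<le> b z" for z using v by (simp add: b_def)
    have b_supp: "z = (\<alpha>, snd z) \<and> snd z \<in> U" if "b z \<noteq> 0" for z
      using that by (cases z) (auto simp: b_def indicator_def split: if_splits)
    have bm: "b \<in> borel_measurable N"
    proof (rule N_measurableI)
      fix \<beta> assume "\<beta> \<in> A"
      show "(\<lambda>x. b (\<beta>, x)) \<in> borel_measurable (lebesgue_on \<Theta>)"
        using Um by (cases "\<beta> = \<alpha>") (simp_all add: b_def)
    qed
    have bl: "b \<in> l2 N"
      by (rule l2_bounded[OF finite_measure_N bm, of "1 / v"]) (use v in \<open>auto simp: b_def indicator_def\<close>)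
    have bi: "integrable N b" by (rule l2_N_integrable[OF bl])
    have b1: "(LINT z|N. b z) = 1"
    proof -
      have "(LINT z|N. b z) = (\<Sum>\<beta>\<in>A. if \<beta> = \<alpha> then 1 else 0)"
        unfolding N_integral[OF bi]
      proof (rule sum.cong[OF refl])
        fix \<beta> assume "\<beta> \<in> A"
        show "(LINT x|lebesgue_on \<Theta>. b (\<beta>, x)) = (if \<beta> = \<alpha> then 1 else 0)"
          using v Um U by (simp add: b_def v_def Int_absorb2)
      qed
      then show ?thesis using \<alpha> finite_A by simp
    qed
    define c where "c j = CPO.ip b (je j)" for j
    have c_le: "\<bar>c j\<bar> \<le> C" if j: "j \<in> J" for j
    proof -
      have "\<bar>c j\<bar> \<le> (LINT z|N. \<bar>b z * je j z\<bar>)" unfolding c_def CPO.ip_def by (rule integral_abs_bound)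
      also have "\<dots> \<le> (LINT z|N. C * b z)"
      proof (rule integral_mono)
        show "integrable N (\<lambda>z. \<bar>b z * je j z\<bar>)" using l2_integrable_mult[OF bl je_l2[OF j]] by simp
        show "integrable N (\<lambda>z. C * b z)" using bi by simp
        fix z assume z: "z \<in> space N"
        show "\<bar>b z * je j z\<bar> \<le> C * b z"
        proof (cases "b z = 0")
          case False
          then have "\<bar>je j z\<bar> \<le> C" using b_supp[OF False] C[OF j, of "snd z"] U unfolding jet_def by (metis fst_conv subsetD)
          then show ?thesis using b_nonneg[of z] 
            using mult_right_mono[of "\<bar>je j z\<bar>" C "b z"] by (simp add: abs_mult mult.commute)
        qed simp
      qed
      also have "\<dots> = C" using b1 by simp
      finally show ?thesis .
    qed
    \<comment> \<open>On U times U the residual kernel R is at least R t t - \<epsilon>. Averaging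
      against b in both arguments, one after the other, preserves this bound, and the average of R
      is the right-hand side.\<close>
    have lower: "R t t - \<epsilon> \<le> CPO.ip (T b) b - (\<Sum>j\<in>F m. lam j * (c j)\<^sup>2)"
    proof -
      have FJ: "j \<in> J" if "j \<in> F m" for j using that F_subset by blast
      define Q where "Q w' = T b (\<alpha>, w') - (\<Sum>j\<in>F m. lam j * c j * je j (\<alpha>, w'))" for w'
      have Q: "R t t - \<epsilon> \<le> Q w'" if w': "w' \<in> U" for w'
      proof -
        have z': "(\<alpha>, w') \<in> space N" using \<alpha> U w' by auto
        have i1: "integrable N (\<lambda>w. K w (\<alpha>, w') * b w)" by (rule l2_integrable_mult[OF K_section_l2[OF z'] bl])
        have i2: "integrable N (\<lambda>w. b w * je j w)" if "j \<in> F m" for j by (rule l2_integrable_mult[OF bl je_l2[OF FJ[OF that]]])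
        have i3: "integrable N (\<lambda>w. \<Sum>j\<in>F m. (lam j * je j (\<alpha>, w')) * (b w * je j w))"
          by (intro Bochner_Integration.integrable_sum integrable_mult_right i2)
        have "R t t - \<epsilon> = (LINT w|N. (R t t - \<epsilon>) * b w)" using b1 by simp
        also have "\<dots> \<le> (LINT w|N. K w (\<alpha>, w') * b w - (\<Sum>j\<in>F m. (lam j * je j (\<alpha>, w')) * (b w * je j w)))"
        proof (rule integral_mono)
          show "integrable N (\<lambda>w. (R t t - \<epsilon>) * b w)" using bi by simp
          show "integrable N (\<lambda>w. K w (\<alpha>, w') * b w - (\<Sum>j\<in>F m. (lam j * je j (\<alpha>, w')) * (b w * je j w)))"
            by (rule Bochner_Integration.integrable_diff[OF i1 i3])
          fix w assume w: "w \<in> space N"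
          show "(R t t - \<epsilon>) * b w \<le> K w (\<alpha>, w') * b w - (\<Sum>j\<in>F m. (lam j * je j (\<alpha>, w')) * (b w * je j w))"
          proof (cases "b w = 0")
            case False
            then obtain x where x: "w = (\<alpha>, x)" "x \<in> U" using b_supp[OF False] by metis
            have "K w (\<alpha>, w') * b w - (\<Sum>j\<in>F m. (lam j * je j (\<alpha>, w')) * (b w * je j w)) =
              (K w (\<alpha>, w') - (\<Sum>j\<in>F m. lam j * je j w * je j (\<alpha>, w'))) * b w"
              by (simp add: algebra_simps sum_distrib_left)
            also have "\<dots> = R x w' * b w" unfolding x(1) by (subst K_R) (use x(2) w' U in auto)
            finally show ?thesis using RU[OF x(2) w'] b_nonneg[of w] by (simp add: mult_right_mono)
          qed simp
        qed
        also have "\<dots> = (LINT w|N. K w (\<alpha>, w') * b w) - (\<Sum>j\<in>F m. LINT w|N. (lam j * je j (\<alpha>, w')) * (b w * je j w))"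
          by (simp only: Bochner_Integration.integral_diff[OF i1 i3] Bochner_Integration.integral_sum[OF integrable_mult_right[OF i2]])
        also have "\<dots> = (LINT w|N. K w (\<alpha>, w') * b w) - (\<Sum>j\<in>F m. (lam j * je j (\<alpha>, w')) * c j)"
          by (simp add: c_def CPO.ip_def)
        also have "\<dots> = Q w'" by (simp add: Q_def T_def mult_ac)
        finally show ?thesis .
      qed
      have iT: "integrable N (\<lambda>z. T b z * b z)" by (rule l2_integrable_mult[OF T_l2[OF bl] bl])
      have i2: "integrable N (\<lambda>w. b w * je j w)" if "j \<in> F m" for j by (rule l2_integrable_mult[OF bl je_l2[OF FJ[OF that]]])
      have i3: "integrable N (\<lambda>w. \<Sum>j\<in>F m. (lam j * c j) * (b w * je j w))"
        by (intro Bochner_Integration.integrable_sum integrable_mult_right i2)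
      have "R t t - \<epsilon> = (LINT z|N. (R t t - \<epsilon>) * b z)" using b1 by simp
      also have "\<dots> \<le> (LINT z|N. T b z * b z - (\<Sum>j\<in>F m. (lam j * c j) * (b z * je j z)))"
      proof (rule integral_mono)
        show "integrable N (\<lambda>w. (R t t - \<epsilon>) * b w)" using bi by simp
        show "integrable N (\<lambda>z. T b z * b z - (\<Sum>j\<in>F m. (lam j * c j) * (b z * je j z)))"
          by (rule Bochner_Integration.integrable_diff[OF iT i3])
        fix z assume "z \<in> space N"
        show "(R t t - \<epsilon>) * b z \<le> T b z * b z - (\<Sum>j\<in>F m. (lam j * c j) * (b z * je j z))"
        proof (cases "b z = 0")
          case False
          then obtain x where x: "z = (\<alpha>, x)" "x \<in> U" using b_supp[OF False] by metis
          have "T b z * b z - (\<Sum>j\<in>F m. (lam j * c j) * (b z * je j z)) = Q x * b z"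
            by (simp add: Q_def x(1) algebra_simps sum_distrib_left)
          then show ?thesis using Q[OF x(2)] b_nonneg[of z] by (simp add: mult_right_mono)
        qed simp
      qed
      also have "\<dots> = (LINT z|N. T b z * b z) - (\<Sum>j\<in>F m. LINT z|N. (lam j * c j) * (b z * je j z))"
        by (simp only: Bochner_Integration.integral_diff[OF iT i3] Bochner_Integration.integral_sum[OF integrable_mult_right[OF i2]])
      also have "\<dots> = (LINT z|N. T b z * b z) - (\<Sum>j\<in>F m. (lam j * c j) * c j)"
        by (simp add: c_def CPO.ip_def)
      also have "\<dots> = CPO.ip (T b) b - (\<Sum>j\<in>F m. lam j * (c j)\<^sup>2)"
        by (simp add: CPO.ip_def power2_eq_square mult.assoc)
      finally show ?thesis .
    qed
    \<comment> \<open>The form is expanded at a level n \<ge> m: the terms up to m cancel those in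
      \<open>lower\<close>, the terms between m and n go into the tail by \<open>c_le\<close>, and
      the remainder carries \<open>rad n\<close>.\<close>
    have upper: "R t t - \<epsilon> \<le> C\<^sup>2 * tail + rad n * CPO.ip b b" if n: "n \<ge> m" for n
    proof -
      have sub: "F m \<subseteq> F n" using n by (auto simp: F_def)
      have "CPO.ip (T b) b \<le> (\<Sum>j\<in>F n. lam j * (c j)\<^sup>2) + rad n * CPO.ip b b"
        unfolding c_def by (rule form_expansion[OF bl])
      also have "(\<Sum>j\<in>F n. lam j * (c j)\<^sup>2) = (\<Sum>j\<in>F n - F m. lam j * (c j)\<^sup>2) + (\<Sum>j\<in>F m. lam j * (c j)\<^sup>2)"
        by (rule sum.subset_diff[OF sub finite_F])
      also have "(\<Sum>j\<in>F n - F m. lam j * (c j)\<^sup>2) \<le> (\<Sum>j\<in>F n - F m. lam j * C\<^sup>2)"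
      proof (rule sum_mono)
        fix j assume "j \<in> F n - F m"
        then have j: "j \<in> J" using F_subset by blast
        have "(c j)\<^sup>2 \<le> C\<^sup>2" using power_mono[OF c_le[OF j], of 2] by simp
        then show "lam j * (c j)\<^sup>2 \<le> lam j * C\<^sup>2" using lam_pos[OF j] by (intro mult_left_mono) auto
      qed
      also have "\<dots> = C\<^sup>2 * (\<Sum>j\<in>F n - F m. lam j)" by (simp add: sum_distrib_left mult.commute)
      also have "(\<Sum>j\<in>F n - F m. lam j) \<le> tail"
        unfolding tail_def
      proof (rule finite_sum_le_infsum)
        show "lam summable_on {j \<in> J. j > m}" by (rule lam_summable) auto
        show "0 \<le> lam j" if "j \<in> {j \<in> J. j > m} - (F n - F m)" for j
          using lam_pos[of j] that by auto
      qed (auto simp: F_def finite_F intro: finite_subset[OF _ finite_F[of n]])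
      finally show ?thesis using lower by (simp add: mult_left_mono)
    qed
    \<comment> \<open>b stays fixed while n grows: its squared norm is the reciprocal of the volume
      of U and would explode if the ball shrank first.\<close>
    have "(\<lambda>n. C\<^sup>2 * tail + rad n * CPO.ip b b) \<longlonglongrightarrow> C\<^sup>2 * tail + 0 * CPO.ip b b"
      by (intro tendsto_intros rad_tendsto)
    then have "R t t - \<epsilon> \<le> C\<^sup>2 * tail + 0 * CPO.ip b b"
      by (rule LIMSEQ_le_const) (use upper in blast)
    then show ?thesis by simp
  qed
  then have "R t t \<le> C\<^sup>2 * tail" by (rule field_le_epsilon)
  then show ?thesis using K_R[OF t t] by (simp add: tail_def power2_eq_square mult.assoc)
qed

text \<open>\<open>Y 0\<close> coincides with X on \<Theta>, so the paths of X are square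
  integrable. Each of the finitely many weak derivative identities holds outside one null set, and
  together they make the derivative process a version of the jet of the path.\<close>

lemma AE_path_rep: "AE \<omega> in M. rep (\<lambda>t. X t \<omega>) (\<lambda>z. Yp z \<omega>)"
proof -
  have Y0: "Y 0 t \<omega> = X t \<omega>" if "t \<in> \<Theta>" "\<omega> \<in> space M" for t \<omega>
    using process that by (simp add: weak_deriv_process_def)
  have YL: "AE \<omega> in M. (\<lambda>t. Y \<alpha> t \<omega>) \<in> L2 \<Theta>" if "\<alpha> \<in> A" for \<alpha>
    using process that by (simp add: weak_deriv_process_def A_def)
  have XL: "AE \<omega> in M. (\<lambda>t. X t \<omega>) \<in> L2 \<Theta>"
    using YL[OF zero_in_A] AE_space
  proof eventually_elim
    case (elim \<omega>)
    have "(\<lambda>t. X t \<omega>) \<in> borel_measurable (lebesgue_on \<Theta>) \<longleftrightarrow> (\<lambda>t. Y 0 t \<omega>) \<in> borel_measurable (lebesgue_on \<Theta>)"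
      by (rule measurable_cong) (simp add: Y0 elim(2))
    then have "(\<lambda>t. X t \<omega>) \<in> borel_measurable (lebesgue_on \<Theta>)"
      using elim(1) by (simp add: L2_def)
    then show ?case
      unfolding L2_eq_l2
      by (rule l2_cong_AE[OF elim(1)[unfolded L2_eq_l2]]) (auto intro!: AE_I2 simp: Y0 elim(2))
  qed
  have "AE \<omega> in M. has_weak_deriv \<Theta> \<alpha> (\<lambda>t. X t \<omega>) (\<lambda>t. Y \<alpha> t \<omega>)" if \<alpha>: "\<alpha> \<in> A" for \<alpha>
    by (rule AE_has_weak_deriv[OF open_domain bounded_domain XL YL[OF \<alpha>]])
       (use process \<alpha> in \<open>simp add: weak_deriv_process_def A_def\<close>)
  then have "AE \<omega> in M. \<forall>\<alpha>\<in>A. has_weak_deriv \<Theta> \<alpha> (\<lambda>t. X t \<omega>) (\<lambda>t. Y \<alpha> t \<omega>)"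
    by (rule AE_finite_allI[OF finite_A])
  moreover have "AE \<omega> in M. \<forall>\<alpha>\<in>A. (\<lambda>t. Y \<alpha> t \<omega>) \<in> L2 \<Theta>"
    by (rule AE_finite_allI[OF finite_A YL])
  ultimately show ?thesis using XL
  proof eventually_elim
    case (elim \<omega>)
    have "(\<lambda>t. X t \<omega>) \<in> Hk k \<Theta>"
      unfolding Hk_def using elim by (auto simp: A_def)
    then show ?case
      unfolding rep_def using elim by (auto simp: l2_N_iff Yp_def intro: wderiv_AE[OF open_domain bounded_domain])
  qed
qed

lemma AE_coefficient:
  assumes "finite F'" "F' \<subseteq> J"
  shows "AE \<omega> in M. \<forall>j\<in>F'. Hk_inner k \<Theta> (Hk_path k \<Theta> X \<omega>) (e j) = coef (je j) \<omega>"
  using AE_path_rep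
proof eventually_elim
  case (elim \<omega>)
  have "Hk_path k \<Theta> X \<omega> = (\<lambda>t. X t \<omega>)" using rep_Hk[OF elim] by (simp add: Hk_path_def)
  then show ?case
    using Hk_inner_rep[OF elim je_rep] assms(2) by (auto simp: coef_def)
qed

text \<open>Almost surely the H^k coefficients of the path are the values of \<open>coef\<close>, so
  the expectation is the residual second moment, to which the estimate on the diagonal
  applies.\<close>

lemma truncation_error:
  assumes \<alpha>: "\<alpha> \<in> A" and t: "t \<in> \<Theta>" and C: "\<And>j x. j \<in> J \<Longrightarrow> x \<in> \<Theta> \<Longrightarrow> \<bar>cderiv \<alpha> (e j) x\<bar> \<le> C"
  shows "(\<integral>\<^sup>+\<omega>. ennreal (\<bar>Y \<alpha> t \<omega> -
      (\<Sum>j\<in>{j\<in>J. j \<le> m}. Hk_inner k \<Theta> (Hk_path k \<Theta> X \<omega>) (e j) * cderiv \<alpha> (e j) t)\<bar>\<^sup>2) \<partial>M)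
    \<le> ennreal (C\<^sup>2 * (\<Sum>\<^sub>\<infinity>j\<in>{j\<in>J. j > m}. lam j))"
proof -
  have z: "(\<alpha>, t) \<in> space N" using \<alpha> t by simp
  note r = residual[OF finite_F[of m] F_subset z]
  have "(\<integral>\<^sup>+\<omega>. ennreal (\<bar>Y \<alpha> t \<omega> -
      (\<Sum>j\<in>{j\<in>J. j \<le> m}. Hk_inner k \<Theta> (Hk_path k \<Theta> X \<omega>) (e j) * cderiv \<alpha> (e j) t)\<bar>\<^sup>2) \<partial>M)
    = (\<integral>\<^sup>+\<omega>. ennreal ((Yp (\<alpha>, t) \<omega> - (\<Sum>j\<in>F m. coef (je j) \<omega> * je j (\<alpha>, t)))\<^sup>2) \<partial>M)"
    by (rule nn_integral_cong_AE)
       (use AE_coefficient[OF finite_F[of m] F_subset] in \<open>eventually_elim, auto simp: F_def Yp_def jet_def\<close>)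
  also have "\<dots> = ennreal (LINT \<omega>|M. (Yp (\<alpha>, t) \<omega> - (\<Sum>j\<in>F m. coef (je j) \<omega> * je j (\<alpha>, t)))\<^sup>2)"
    by (rule nn_integral_eq_integral) (use r(1) in \<open>auto simp: l2_def\<close>)
  also have "\<dots> \<le> ennreal (C\<^sup>2 * (\<Sum>\<^sub>\<infinity>j\<in>{j\<in>J. j > m}. lam j))"
    unfolding r(2) by (rule ennreal_leI[OF residual_kernel_le_tail[OF \<alpha> t C]])
  finally show ?thesis .
qed

text \<open>The spectral expansion is the nuclear representation: for the factors lam j e_j and e_j
  the products of norms are the eigenvalues, summable by the trace bound, and the remainder after m
  terms has norm at most \<open>rad m\<close> times that of f.\<close>

lemma nuclear: "nuclear_on_Hk k \<Theta> (kernel_op k \<Theta> \<gamma>)"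
  unfolding nuclear_on_Hk_def
proof (intro conjI ballI exI allI)
  have op_Ck: "kernel_op k \<Theta> \<gamma> f \<in> Ck_uniform k \<Theta>" and op_jet: "z \<in> space N \<Longrightarrow> jet (kernel_op k \<Theta> \<gamma> f) z = T G z"
    if G: "rep f G" for f G z
  proof -
    have eq: "T G (0, y) = kernel_op k \<Theta> \<gamma> f y" if "y \<in> \<Theta>" for y by (rule kernel_op_eq[OF G that, symmetric])
    show "kernel_op k \<Theta> \<gamma> f \<in> Ck_uniform k \<Theta>"
      by (rule Ck_uniform_cong_open[OF open_domain T_Ck_uniform[OF rep_l2[OF G]] eq])
    show "jet (kernel_op k \<Theta> \<gamma> f) z = T G z" if z: "z \<in> space N"
      using jet_cong[OF eq z] jet_T[OF rep_l2[OF G] z] by simp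
  qed
  show "kernel_op k \<Theta> \<gamma> f \<in> Hk k \<Theta>" if "f \<in> Hk k \<Theta>" for f
    by (rule Ck_uniform_Hk[OF open_domain bounded_domain op_Ck[OF rep_wderiv[OF that]]])
  \<comment> \<open>The representation is indexed from 0 and the eigensystem from 1; a finite
    eigensystem is padded with zeros.\<close>
  define v where "v n = (if Suc n \<in> J then e (Suc n) else (\<lambda>_. 0))" for n
  define l where "l n = (if Suc n \<in> J then lam (Suc n) else 0)" for n
  define u where "u n = (\<lambda>x. l n * v n x)" for n
  have vC: "v n \<in> Ck_uniform k \<Theta>" for n by (simp add: v_def e_Ck zero_Ck_uniform)
  have uC: "u n \<in> Ck_uniform k \<Theta>" for n unfolding u_def by (rule scale_Ck_uniform[OF vC])
  show "u n \<in> Hk k \<Theta>" "v n \<in> Hk k \<Theta>" for n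
    by (rule Ck_uniform_Hk[OF open_domain bounded_domain], rule uC vC)+
  have l0: "0 \<le> l n" for n using lam_pos[of "Suc n"] by (auto simp: l_def less_imp_le)
  have jv: "Suc n \<in> J \<Longrightarrow> v n = e (Suc n)" for n by (simp add: v_def)
  have ju: "jet (u n) z = l n * jet (v n) z" if "z \<in> space N" for n z
    unfolding u_def by (rule jet_scale[OF vC that])
  have nv: "Hk_inner k \<Theta> (v n) (v n) \<le> 1" for n
  proof (cases "Suc n \<in> J")
    case True
    then show ?thesis using e_orthonormal_Hk[OF True True] by (simp add: v_def)
  next
    case False
    have "Hk_inner k \<Theta> (v n) (v n) = (LINT z|N. jet (v n) z * jet (v n) z)"
      by (rule Hk_inner_rep[OF rep_jet[OF vC] rep_jet[OF vC]])
    also have "\<dots> = 0" using False by (simp add: v_def jet_def cderiv_zero)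
    finally show ?thesis by simp
  qed
  have inner_nonneg: "0 \<le> Hk_inner k \<Theta> f f" if "f \<in> Ck_uniform k \<Theta>" for f
    using Hk_inner_rep[OF rep_jet[OF that] rep_jet[OF that]] by simp
  have nu: "Hk_inner k \<Theta> (u n) (u n) = (l n)\<^sup>2 * Hk_inner k \<Theta> (v n) (v n)" for n
  proof -
    have "Hk_inner k \<Theta> (u n) (u n) = (LINT z|N. (l n)\<^sup>2 * (jet (v n) z * jet (v n) z))"
      unfolding Hk_inner_rep[OF rep_jet[OF uC] rep_jet[OF uC]]
      by (rule Bochner_Integration.integral_cong) (auto simp: ju power2_eq_square)
    then show ?thesis using Hk_inner_rep[OF rep_jet[OF vC] rep_jet[OF vC], of n n] by simp
  qed
  have prod_le: "Hk_norm k \<Theta> (u n) * Hk_norm k \<Theta> (v n) \<le> l n" for n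
  proof -
    have "Hk_norm k \<Theta> (u n) * Hk_norm k \<Theta> (v n) = l n * Hk_inner k \<Theta> (v n) (v n)"
      using l0[of n] inner_nonneg[OF vC[of n]] by (simp add: Hk_norm_def nu real_sqrt_mult)
    also have "\<dots> \<le> l n * 1" by (rule mult_left_mono[OF nv l0])
    finally show ?thesis by simp
  qed
  have sum_l: "(\<Sum>n<m. l n) \<le> trace" for m
  proof -
    have "(\<Sum>n<m. l n) = (\<Sum>n\<in>{n. n < m \<and> Suc n \<in> J}. lam (Suc n))"
      unfolding l_def by (rule sum.mono_neutral_cong_right) auto
    also have "\<dots> = (\<Sum>j\<in>Suc ` {n. n < m \<and> Suc n \<in> J}. lam j)" by (subst sum.reindex) auto
    also have "\<dots> \<le> trace" by (rule sum_lam_le) auto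
    finally show ?thesis .
  qed
  have "summable l" by (rule summableI_nonneg_bounded[OF l0 sum_l])
  then show "summable (\<lambda>n. Hk_norm k \<Theta> (u n) * Hk_norm k \<Theta> (v n))"
  proof (rule summable_comparison_test'[where N = 0])
    fix n :: nat
    have "0 \<le> Hk_norm k \<Theta> (u n) * Hk_norm k \<Theta> (v n)"
      using inner_nonneg[OF uC[of n]] inner_nonneg[OF vC[of n]] by (simp add: Hk_norm_def)
    then show "norm (Hk_norm k \<Theta> (u n) * Hk_norm k \<Theta> (v n)) \<le> l n" using prod_le[of n] by simp
  qed
  fix f assume fH: "f \<in> Hk k \<Theta>"
  define G where "G z = wderiv \<Theta> (fst z) f (snd z)" for z
  have G: "rep f G" unfolding G_def[abs_def] by (rule rep_wderiv[OF fH])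
  note Gl = rep_l2[OF G]
  define D where "D m y = kernel_op k \<Theta> \<gamma> f y - (\<Sum>n<m. Hk_inner k \<Theta> f (u n) * v n y)" for m y
  have DC: "D m \<in> Ck_uniform k \<Theta>"
    and Dj: "z \<in> space N \<Longrightarrow> jet (D m) z = T G z - (\<Sum>n<m. Hk_inner k \<Theta> f (u n) * jet (v n) z)" for m z
  proof -
    let ?s = "\<lambda>y. \<Sum>n<m. Hk_inner k \<Theta> f (u n) * v n y"
    have sC: "?s \<in> Ck_uniform k \<Theta>" by (rule Ck_uniform_sum[OF open_domain]) (use vC in auto)
    have D_eq: "D m = (\<lambda>y. kernel_op k \<Theta> \<gamma> f y + (- 1) * ?s y)" by (simp add: D_def[abs_def])
    show "D m \<in> Ck_uniform k \<Theta>"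
      unfolding D_eq by (rule Ck_uniform_add_scale[OF open_domain op_Ck[OF G] sC])
    assume z: "z \<in> space N"
    then have a: "mi_order (fst z) \<le> k" "snd z \<in> \<Theta>" by (auto simp: A_def)
    have "jet (D m) z = jet (kernel_op k \<Theta> \<gamma> f) z + (- 1) * jet ?s z"
      unfolding jet_def D_eq by (rule cderiv_add_scale[OF open_domain op_Ck[OF G] sC a])
    also have "jet ?s z = (\<Sum>n<m. Hk_inner k \<Theta> f (u n) * jet (v n) z)"
      unfolding jet_def by (rule cderiv_sum[OF open_domain _ _ a]) (use vC in auto)
    finally show "jet (D m) z = T G z - (\<Sum>n<m. Hk_inner k \<Theta> f (u n) * jet (v n) z)"
      using op_jet[OF G z] by simp
  qed
  \<comment> \<open>The shift by \<open>Suc\<close> identifies the first m terms with the indices in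
    \<open>F m\<close>, for which the deflation estimate is available.\<close>
  have sum_eq: "(\<Sum>n<m. Hk_inner k \<Theta> f (u n) * jet (v n) z) = (\<Sum>j\<in>F m. lam j * CPO.ip G (je j) * je j z)" for m z
  proof -
    have "(\<Sum>n<m. Hk_inner k \<Theta> f (u n) * jet (v n) z) = (\<Sum>n\<in>{n. n < m \<and> Suc n \<in> J}. lam (Suc n) * CPO.ip G (je (Suc n)) * je (Suc n) z)"
    proof (rule sum.mono_neutral_cong_right)
      fix n assume n: "n \<in> {n. n < m \<and> Suc n \<in> J}"
      have "Hk_inner k \<Theta> f (u n) = (LINT z|N. lam (Suc n) * (G z * je (Suc n) z))"
        unfolding Hk_inner_rep[OF G rep_jet[OF uC]]
        by (rule Bochner_Integration.integral_cong) (use n in \<open>auto simp: ju l_def v_def\<close>)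
      then show "Hk_inner k \<Theta> f (u n) * jet (v n) z = lam (Suc n) * CPO.ip G (je (Suc n)) * je (Suc n) z"
        using n by (simp add: CPO.ip_def v_def)
    next
      show "\<forall>i\<in>{..<m} - {n. n < m \<and> Suc n \<in> J}. Hk_inner k \<Theta> f (u i) * jet (v i) z = 0"
        by (auto simp: v_def jet_def cderiv_zero)
    qed auto
    also have "\<dots> = (\<Sum>j\<in>Suc ` {n. n < m \<and> Suc n \<in> J}. lam j * CPO.ip G (je j) * je j z)" by (subst sum.reindex) auto
    also have "Suc ` {n. n < m \<and> Suc n \<in> J} = F m"
    proof
      show "F m \<subseteq> Suc ` {n. n < m \<and> Suc n \<in> J}"
      proof
        fix j assume j: "j \<in> F m"
        then have "j = Suc (j - 1)" using J_pos[of j] by (simp add: F_def)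
        then show "j \<in> Suc ` {n. n < m \<and> Suc n \<in> J}" using j by (intro image_eqI[of _ _ "j - 1"]) (auto simp: F_def)
      qed
    qed (auto simp: F_def)
    finally show ?thesis .
  qed
  have norm_le: "Hk_norm k \<Theta> (D m) \<le> rad m * sqrt (CPO.ip G G)" for m
  proof -
    have "Hk_inner k \<Theta> (D m) (D m) = (LINT z|N. (T G z - (\<Sum>j\<in>F m. lam j * CPO.ip G (je j) * je j z))\<^sup>2)"
      unfolding Hk_inner_rep[OF rep_jet[OF DC] rep_jet[OF DC]]
      by (rule Bochner_Integration.integral_cong) (auto simp: Dj sum_eq power2_eq_square)
    also have "\<dots> \<le> (rad m)\<^sup>2 * CPO.ip G G" by (rule norm_expansion[OF Gl])
    finally have "Hk_norm k \<Theta> (D m) \<le> sqrt ((rad m)\<^sup>2 * CPO.ip G G)" by (simp add: Hk_norm_def)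
    then show ?thesis using rad_nonneg[of m] by (simp add: real_sqrt_mult)
  qed
  have "(\<lambda>m. rad m * sqrt (CPO.ip G G)) \<longlonglongrightarrow> 0 * sqrt (CPO.ip G G)"
    by (intro tendsto_mult rad_tendsto tendsto_const)
  then have up: "(\<lambda>m. rad m * sqrt (CPO.ip G G)) \<longlonglongrightarrow> 0" by simp
  have "(\<lambda>m. Hk_norm k \<Theta> (D m)) \<longlonglongrightarrow> 0"
  proof (rule tendsto_sandwich[OF _ _ tendsto_const up])
    show "\<forall>\<^sub>F m in sequentially. 0 \<le> Hk_norm k \<Theta> (D m)"
      using inner_nonneg[OF DC] by (simp add: Hk_norm_def)
    show "\<forall>\<^sub>F m in sequentially. Hk_norm k \<Theta> (D m) \<le> rad m * sqrt (CPO.ip G G)"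
      using norm_le by simp
  qed
  then show "(\<lambda>N. Hk_norm k \<Theta> (\<lambda>y. kernel_op k \<Theta> \<gamma> f y - (\<Sum>n<N. Hk_inner k \<Theta> f (u n) * v n y))) \<longlonglongrightarrow> 0"
    by (simp add: D_def[abs_def])
qed

end

section \<open>The uniform bound on the eigenfunctions and the conclusion\<close>

lemma eigenfunction_boundD:
  assumes "eigenfunction_bound S s J e C" "0 \<le> C" "j \<in> J" "mi_order \<alpha> \<le> s" "x \<in> S"
  shows "\<bar>cderiv \<alpha> (e j) x\<bar> \<le> C"
proof -
  have "ennreal \<bar>cderiv \<alpha> (e j) x\<bar> \<le> (SUP x\<in>S. ennreal \<bar>cderiv \<alpha> (e j) x\<bar>)"
    using assms(5) by (rule SUP_upper)
  also have "\<dots> \<le> (MAX \<alpha>\<in>{\<alpha>. mi_order \<alpha> \<le> s}. SUP x\<in>S. ennreal \<bar>cderiv \<alpha> (e j) x\<bar>)"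
    using assms(4) by (intro Max_ge finite_imageI finite_mi_order_le) auto
  also have "\<dots> \<le> ennreal C" using assms(1,3) by (simp add: eigenfunction_bound_def)
  finally show ?thesis using assms(2) by simp
qed

lemma eigenfunction_boundI:
  assumes "\<And>j \<alpha> x. j \<in> J \<Longrightarrow> mi_order \<alpha> \<le> s \<Longrightarrow> x \<in> S \<Longrightarrow> \<bar>cderiv \<alpha> (e j) x\<bar> \<le> C"
  shows "eigenfunction_bound S s J e C"
  unfolding eigenfunction_bound_def
proof
  fix j assume j: "j \<in> J"
  have ne: "{\<alpha> :: 'a multi_index. mi_order \<alpha> \<le> s} \<noteq> {}"
    by (auto intro!: exI[of _ 0])
  show "(MAX \<alpha>\<in>{\<alpha>. mi_order \<alpha> \<le> s}. SUP x\<in>S. ennreal \<bar>cderiv \<alpha> (e j) x\<bar>) \<le> ennreal C"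
    using ne assms[OF j]
    by (subst Max_le_iff) (auto simp: finite_mi_order_le intro!: SUP_least ennreal_leI)
qed

text \<open>Each order contributes one non-negative summand to the squared H^k norm, which is 1 for
  an eigenfunction; this is the normalisation that the Sobolev bound asks for.\<close>

lemma (in jet_space) eigensystem_derivative_norm:
  assumes "eigensystem k \<Theta> h J lam e" "j \<in> J" "mi_order \<beta> \<le> k"
  shows "(LINT z|lebesgue_on \<Theta>. (cderiv \<beta> (e j) z)\<^sup>2) \<le> 1"
proof -
  have e: "e j \<in> Ck_uniform k \<Theta>" and n: "Hk_inner k \<Theta> (e j) (e j) = 1"
    using assms(1,2) by (auto simp: eigensystem_def)
  note r = rep_jet[OF e]
  have "(LINT z|lebesgue_on \<Theta>. (cderiv \<beta> (e j) z)\<^sup>2) \<le> (\<Sum>\<alpha>\<in>A. LINT z|lebesgue_on \<Theta>. (cderiv \<alpha> (e j) z)\<^sup>2)"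
    by (rule member_le_sum) (use assms(3) finite_A in \<open>auto simp: A_def\<close>)
  also have "\<dots> = 1"
    using Hk_inner_rep[OF r r] N_integral[OF l2_integrable_mult[OF rep_l2[OF r] rep_l2[OF r]]] n
    by (simp add: jet_def power2_eq_square)
  finally show ?thesis .
qed

theorem corollary4p9:
  fixes \<Theta> :: "(real ^ 'd::finite) set" and k :: nat
  assumes "open \<Theta>" and "bounded \<Theta>" and "cone_property \<Theta>"
  shows
    "(\<exists>C>0. \<forall>s h J lam e.
        real k - real CARD('d) / 2 > real s \<longrightarrow>
        positive_definite_on \<Theta> h \<longrightarrow> h \<in> Ckk k \<Theta> \<longrightarrow> eigensystem k \<Theta> h J lam e \<longrightarrow>
        eigenfunction_bound \<Theta> s J e C) \<and>
     (\<forall>(M :: 'w measure) X Y J lam e s.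
        prob_space M \<longrightarrow> complete_measure M \<longrightarrow>
        measurable_field M \<Theta> X \<longrightarrow> second_order_field M \<Theta> X \<longrightarrow> centred_field M \<Theta> X \<longrightarrow>
        cov_kernel M X \<in> Ckk k \<Theta> \<longrightarrow>
        eigensystem k \<Theta> (cov_kernel M X) J lam e \<longrightarrow>
        weak_deriv_process M k \<Theta> X Y \<longrightarrow>
        real k - real CARD('d) / 2 > real s \<longrightarrow>
        nuclear_on_Hk k \<Theta> (kernel_op k \<Theta> (cov_kernel M X)) \<and>
        (\<forall>C>0. eigenfunction_bound \<Theta> s J e C \<longrightarrow>
           (\<forall>\<alpha> m. mi_order \<alpha> \<le> s \<and> m \<ge> 1 \<longrightarrow>
              (SUP t\<in>\<Theta>. \<integral>\<^sup>+\<omega>. ennreal (\<bar>Y \<alpha> t \<omega> -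
                  (\<Sum>j\<in>{j\<in>J. j \<le> m}. Hk_inner k \<Theta> (Hk_path k \<Theta> X \<omega>) (e j) * cderiv \<alpha> (e j) t)\<bar>\<^sup>2) \<partial>M)
              \<le> ennreal (C\<^sup>2 * (\<Sum>\<^sub>\<infinity>j\<in>{j\<in>J. j > m}. lam j)))))"
proof -
  interpret jet_space \<Theta> k by standard fact+
  \<comment> \<open>The constant is obtained before s, the kernel and the eigensystem are
    introduced, so it depends on \<Theta>, k and the dimension alone.\<close>
  obtain C where C: "C > 0" and Cb: "\<And>u s x \<alpha>. u \<in> Ck_uniform k \<Theta> \<Longrightarrow> real k - real CARD('d) / 2 > real s \<Longrightarrow>
       mi_order \<alpha> \<le> s \<Longrightarrow> (\<And>\<beta>. mi_order \<beta> \<le> k \<Longrightarrow> (LINT z|lebesgue_on \<Theta>. (cderiv \<beta> u z)\<^sup>2) \<le> 1) \<Longrightarrow>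
       x \<in> \<Theta> \<Longrightarrow> \<bar>cderiv \<alpha> u x\<bar> \<le> C"
    using sobolev_inequality[OF assms, of k] by blast
  show ?thesis
  proof (intro conjI exI[of _ C] allI impI)
    show "C > 0" by (rule C)
  next
    fix s h J lam and e :: "nat \<Rightarrow> real ^ 'd \<Rightarrow> real"
    assume s: "real k - real CARD('d) / 2 > real s" and es: "eigensystem k \<Theta> h J lam e"
    show "eigenfunction_bound \<Theta> s J e C"
    proof (rule eigenfunction_boundI)
      fix j and \<alpha> :: "'d multi_index" and x assume "j \<in> J" "mi_order \<alpha> \<le> s" "x \<in> \<Theta>"
      moreover from this have "e j \<in> Ck_uniform k \<Theta>" using es by (simp add: eigensystem_def)
      ultimately show "\<bar>cderiv \<alpha> (e j) x\<bar> \<le> C"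
        using Cb[OF _ s _ eigensystem_derivative_norm[OF es]] by blast
    qed
  next
    fix M :: "'w measure" and X Y J lam e s
    assume M: "prob_space M" and kernel: "cov_kernel M X \<in> Ckk k \<Theta>"
      and es: "eigensystem k \<Theta> (cov_kernel M X) J lam e"
      and process: "weak_deriv_process M k \<Theta> X Y"
    interpret prob_space M by (rule M)
    interpret mercer_setup \<Theta> k M X Y J lam e by standard fact+
    show "nuclear_on_Hk k \<Theta> (kernel_op k \<Theta> (cov_kernel M X))" by (rule nuclear)
    fix C :: real and \<alpha> :: "'d multi_index" and m :: nat
    assume C: "C > 0" and eb: "eigenfunction_bound \<Theta> s J e C"
      and \<alpha>: "mi_order \<alpha> \<le> s \<and> m \<ge> 1" and s: "real k - real CARD('d) / 2 > real s"
    have "real s < real k" using s of_nat_0_le_iff[of "CARD('d)"] by linarith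
    then have "\<alpha> \<in> A" using \<alpha> by (simp add: A_def)
    then show "(SUP t\<in>\<Theta>. \<integral>\<^sup>+\<omega>. ennreal (\<bar>Y \<alpha> t \<omega> -
          (\<Sum>j\<in>{j\<in>J. j \<le> m}. Hk_inner k \<Theta> (Hk_path k \<Theta> X \<omega>) (e j) * cderiv \<alpha> (e j) t)\<bar>\<^sup>2) \<partial>M)
      \<le> ennreal (C\<^sup>2 * (\<Sum>\<^sub>\<infinity>j\<in>{j\<in>J. j > m}. lam j))"
      using eigenfunction_boundD[OF eb less_imp_le[OF C]] \<alpha>
      by (intro SUP_least truncation_error) auto
  qed
qed

end
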